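(* For every integer $n\ge 4$, the $n$-strand braid group $B_n$ is not commensurable to any group that splits non-trivially over an NF subgroup.
   Context: The $n$-strand braid group $B_n$ is the group with generators $s_1,\dots,s_{n-1}$ and relations $s_i s_{i+1} s_i = s_{i+1} s_i s_{i+1}$ for all $1\le i\le n-2$ and $s_i s_j=s_j s_i$ for all $|i-j|>1$. Two groups are (abstractly) commensurable if they contain isomorphic finite index subgroups. A group $G$ splits non-trivially over a subgroup $C$ if $G$ decomposes as an amalgamated product $G=A*_C B$ with $G\ne A,B$ or as an HNN-extension $G=A*_C$ with $G\ne A$. A group is NF if it contains no non-abelian free subgroups. *)

theory Defs
  imports "HOL-Algebra.Coset"
begin

section \<open>Groups given by generators and relations\<close>

text \<open>The letter \<open>(s, True)\<close> stands for the generator \<open>s\<close>, and \<open>(s, False)\<close> for its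
  formal inverse.\<close>

type_synonym 's word = "('s \<times> bool) list"

abbreviation pos :: "'s \<Rightarrow> 's \<times> bool" where "pos s \<equiv> (s, True)"
abbreviation neg :: "'s \<Rightarrow> 's \<times> bool" where "neg s \<equiv> (s, False)"

definition words :: "'s set \<Rightarrow> 's word set" where
  "words S = lists (S \<times> UNIV)"

text \<open>A pair \<open>(l, r)\<close> in \<open>R\<close> is the relation \<open>l = r\<close>. Two words over \<open>S\<close> represent the same
  element of \<open>\<langle>S | R\<rangle>\<close> iff they are related by the congruence generated by free cancellation
  and the relations.\<close>

inductive word_eq :: "'s set \<Rightarrow> ('s word \<times> 's word) set \<Rightarrow> 's word \<Rightarrow> 's word \<Rightarrow> bool"
  for S R where
  refl: "w \<in> words S \<Longrightarrow> word_eq S R w w"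
| sym: "word_eq S R u v \<Longrightarrow> word_eq S R v u"
| trans: "word_eq S R u v \<Longrightarrow> word_eq S R v w \<Longrightarrow> word_eq S R u w"
| cancel: "\<lbrakk>u \<in> words S; v \<in> words S; s \<in> S\<rbrakk>
    \<Longrightarrow> word_eq S R (u @ [(s, b), (s, \<not> b)] @ v) (u @ v)"
| rel: "\<lbrakk>u \<in> words S; v \<in> words S; (l, r) \<in> R; l \<in> words S; r \<in> words S\<rbrakk>
    \<Longrightarrow> word_eq S R (u @ l @ v) (u @ r @ v)"

definition word_class :: "'s set \<Rightarrow> ('s word \<times> 's word) set \<Rightarrow> 's word \<Rightarrow> 's word set" where
  "word_class S R w = {v. word_eq S R w v}"

definition presented_group :: "'s set \<Rightarrow> ('s word \<times> 's word) set \<Rightarrow> 's word set monoid" where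
  "presented_group S R =
    \<lparr>carrier = word_class S R ` words S,
     mult = (\<lambda>X Y. \<Union>u\<in>X. \<Union>v\<in>Y. word_class S R (u @ v)),
     one = word_class S R []\<rparr>"

abbreviation gen_class :: "'s set \<Rightarrow> ('s word \<times> 's word) set \<Rightarrow> 's \<Rightarrow> 's word set" where
  "gen_class S R s \<equiv> word_class S R [pos s]"

text \<open>The group \<open>G\<close> is presented by \<open>\<langle>S | R\<rangle>\<close>, where the generator \<open>s\<close> is interpreted in \<open>G\<close>
  as the element \<open>f s\<close>: the canonical map is a well-defined isomorphism.\<close>

definition presented_by ::
  "('g, 'm) monoid_scheme \<Rightarrow> ('s \<Rightarrow> 'g) \<Rightarrow> 's set \<Rightarrow> ('s word \<times> 's word) set \<Rightarrow> bool" where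
  "presented_by G f S R \<longleftrightarrow>
    (\<exists>\<phi> \<in> iso (presented_group S R) G. \<forall>s\<in>S. \<phi> (gen_class S R s) = f s)"

section \<open>Braid groups\<close>

definition braid_relations :: "nat \<Rightarrow> (nat word \<times> nat word) set" where
  "braid_relations n =
    {([pos i, pos (i + 1), pos i], [pos (i + 1), pos i, pos (i + 1)]) | i. 1 \<le> i \<and> i + 2 \<le> n} \<union>
    {([pos i, pos j], [pos j, pos i]) | i j.
        i \<in> {1..<n} \<and> j \<in> {1..<n} \<and> \<bar>int i - int j\<bar> > 1}"

definition braid_group :: "nat \<Rightarrow> nat word set monoid" where
  "braid_group n = presented_group {1..<n} (braid_relations n)"

section \<open>Commensurability\<close>

definition finite_index_subgroup :: "'g set \<Rightarrow> ('g, 'm) monoid_scheme \<Rightarrow> bool" where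
  "finite_index_subgroup H G \<longleftrightarrow> subgroup H G \<and> finite (rcosets\<^bsub>G\<^esub> H)"

definition commensurable :: "('g, 'm) monoid_scheme \<Rightarrow> ('h, 'k) monoid_scheme \<Rightarrow> bool" where
  "commensurable G G' \<longleftrightarrow>
    (\<exists>H K. finite_index_subgroup H G \<and> finite_index_subgroup K G' \<and>
       G\<lparr>carrier := H\<rparr> \<cong> G'\<lparr>carrier := K\<rparr>)"

section \<open>Splittings\<close>

text \<open>The multiplication table of \<open>A\<close>, with \<open>f a\<close> the generator that names \<open>a\<close>.\<close>

definition mult_table :: "('a, 'm) monoid_scheme \<Rightarrow> ('a \<Rightarrow> 's) \<Rightarrow> ('s word \<times> 's word) set" where
  "mult_table A f =
    {([pos (f a), pos (f b)], [pos (f (a \<otimes>\<^bsub>A\<^esub> b))]) | a b. a \<in> carrier A \<and> b \<in> carrier A}"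

text \<open>\<open>G = A *\<^sub>C B\<close> internally: \<open>A\<close>, \<open>B\<close> and \<open>C \<subseteq> A \<inter> B\<close> are subgroups of \<open>G\<close>, and the
  canonical map to \<open>G\<close> from the amalgamated product (the free product of \<open>A\<close> and \<open>B\<close> with the
  two copies of \<open>C\<close> identified) is an isomorphism.\<close>

definition amalgam_relations ::
  "('g, 'm) monoid_scheme \<Rightarrow> 'g set \<Rightarrow> 'g set \<Rightarrow> 'g set \<Rightarrow> (('g + 'g) word \<times> ('g + 'g) word) set" where
  "amalgam_relations G A C B =
    mult_table (G\<lparr>carrier := A\<rparr>) Inl \<union> mult_table (G\<lparr>carrier := B\<rparr>) Inr \<union>
    {([pos (Inl c)], [pos (Inr c)]) | c. c \<in> C}"

definition is_amalgamated_product ::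
  "('g, 'm) monoid_scheme \<Rightarrow> 'g set \<Rightarrow> 'g set \<Rightarrow> 'g set \<Rightarrow> bool" where
  "is_amalgamated_product G A C B \<longleftrightarrow>
    subgroup A G \<and> subgroup B G \<and> subgroup C G \<and> C \<subseteq> A \<and> C \<subseteq> B \<and>
    presented_by G (case_sum id id) (A <+> B) (amalgam_relations G A C B)"

text \<open>\<open>G = A *\<^sub>C\<close> internally: \<open>C \<le> A\<close> are subgroups of \<open>G\<close>, \<open>\<theta> : C \<rightarrow> A\<close> is an injective
  homomorphism (an isomorphism between the associated subgroups \<open>C\<close> and \<open>\<theta>(C)\<close>), and \<open>G\<close> is
  presented by adding to \<open>A\<close> a stable letter \<open>t\<close> with \<open>t c t\<inverse> = \<theta>(c)\<close> for \<open>c\<close> in \<open>C\<close>. The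
  generator \<open>None\<close> names \<open>t\<close>, and \<open>Some a\<close> names \<open>a\<close>.\<close>

definition hnn_relations ::
  "('g, 'm) monoid_scheme \<Rightarrow> 'g set \<Rightarrow> 'g set \<Rightarrow> ('g \<Rightarrow> 'g)
    \<Rightarrow> ('g option word \<times> 'g option word) set" where
  "hnn_relations G A C \<theta> =
    mult_table (G\<lparr>carrier := A\<rparr>) Some \<union>
    {([pos None, pos (Some c), neg None], [pos (Some (\<theta> c))]) | c. c \<in> C}"

definition is_hnn_extension :: "('g, 'm) monoid_scheme \<Rightarrow> 'g set \<Rightarrow> 'g set \<Rightarrow> bool" where
  "is_hnn_extension G A C \<longleftrightarrow>
    subgroup A G \<and> subgroup C G \<and> C \<subseteq> A \<and>
    (\<exists>\<theta> \<in> hom (G\<lparr>carrier := C\<rparr>) (G\<lparr>carrier := A\<rparr>). inj_on \<theta> C \<and>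
      (\<exists>t \<in> carrier G.
        presented_by G (case_option t id) (insert None (Some ` A)) (hnn_relations G A C \<theta>)))"

definition splits_nontrivially_over :: "('g, 'm) monoid_scheme \<Rightarrow> 'g set \<Rightarrow> bool" where
  "splits_nontrivially_over G C \<longleftrightarrow>
    (\<exists>A B. is_amalgamated_product G A C B \<and> carrier G \<noteq> A \<and> carrier G \<noteq> B) \<or>
    (\<exists>A. is_hnn_extension G A C \<and> carrier G \<noteq> A)"

section \<open>NF groups\<close>

definition free_group :: "('g, 'm) monoid_scheme \<Rightarrow> bool" where
  "free_group F \<longleftrightarrow> group F \<and> (\<exists>X \<subseteq> carrier F. presented_by F id X {})"

definition NF :: "('g, 'm) monoid_scheme \<Rightarrow> bool" where
  "NF G \<longleftrightarrow>
    \<not> (\<exists>H. subgroup H G \<and> free_group (G\<lparr>carrier := H\<rparr>) \<and> \<not> comm_group (G\<lparr>carrier := H\<rparr>))"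

section \<open>Presented groups are groups, and their universal property\<close>

lemma words_Nil [simp]: "[] \<in> words S"
  and words_Cons [simp]: "x # w \<in> words S \<longleftrightarrow> fst x \<in> S \<and> w \<in> words S"
  and words_append [simp]: "u @ v \<in> words S \<longleftrightarrow> u \<in> words S \<and> v \<in> words S"
  by (auto simp: words_def mem_Times_iff)

lemma word_eq_words: "word_eq S R u v \<Longrightarrow> u \<in> words S \<and> v \<in> words S"
  by (induction rule: word_eq.induct) auto

lemma word_eq_context:
  assumes "word_eq S R u v" "x \<in> words S" "y \<in> words S"
  shows "word_eq S R (x @ u @ y) (x @ v @ y)"
  using assms
proof (induction rule: word_eq.induct)
  case (refl w)
  then show ?case by (simp add: word_eq.refl)
next
  case (sym u v)
  then show ?case by (blast intro: word_eq.sym)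
next
  case (trans u v w)
  then show ?case by (blast intro: word_eq.trans)
next
  case (cancel u v s b)
  then show ?case using word_eq.cancel[of "x @ u" S "v @ y" s R b] by simp
next
  case (rel u v l r)
  then show ?case using word_eq.rel[of "x @ u" S "v @ y" l r R] by simp
qed

lemma word_eq_append:
  assumes "word_eq S R u u'" "word_eq S R v v'"
  shows "word_eq S R (u @ v) (u' @ v')"
  using word_eq_context[OF assms(1), of "[]" v] word_eq_context[OF assms(2), of u' "[]"]
    word_eq_words[OF assms(1)] word_eq_words[OF assms(2)]
  by (simp add: word_eq.trans[of S R "u @ v" "u' @ v" "u' @ v'"])

lemma word_class_eq_iff:
  assumes "u \<in> words S"
  shows "word_class S R u = word_class S R v \<longleftrightarrow> word_eq S R u v"
proof
  assume "word_class S R u = word_class S R v"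
  then have "word_eq S R v u"
    using word_eq.refl[OF assms, of R] by (auto simp: word_class_def)
  then show "word_eq S R u v" by (rule word_eq.sym)
next
  assume "word_eq S R u v"
  then have "word_eq S R u w \<longleftrightarrow> word_eq S R v w" for w
    by (meson word_eq.sym word_eq.trans)
  then show "word_class S R u = word_class S R v"
    by (simp add: word_class_def)
qed

lemma mult_word_class:
  assumes "u \<in> words S" "v \<in> words S"
  shows "word_class S R u \<otimes>\<^bsub>presented_group S R\<^esub> word_class S R v = word_class S R (u @ v)"
proof -
  have *: "word_class S R (u' @ v') = word_class S R (u @ v)"
    if "u' \<in> word_class S R u" "v' \<in> word_class S R v" for u' v'
  proof -
    have "word_eq S R (u @ v) (u' @ v')"
      using that by (auto simp: word_class_def intro: word_eq_append)
    then show ?thesis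
      using assms word_class_eq_iff[of "u @ v" S R "u' @ v'"] by simp
  qed
  have "u \<in> word_class S R u" "v \<in> word_class S R v"
    using assms by (auto simp: word_class_def intro: word_eq.refl)
  then have "(\<Union>u'\<in>word_class S R u. \<Union>v'\<in>word_class S R v. word_class S R (u' @ v'))
      = word_class S R (u @ v)"
    using * by (intro equalityI UN_least) blast+
  then show ?thesis
    by (simp add: presented_group_def)
qed

lemma carrier_presented_group: "carrier (presented_group S R) = word_class S R ` words S"
  and one_presented_group: "\<one>\<^bsub>presented_group S R\<^esub> = word_class S R []"
  by (simp_all add: presented_group_def)

definition inv_word :: "'s word \<Rightarrow> 's word" where
  "inv_word w = rev (map (\<lambda>(s, b). (s, \<not> b)) w)"

lemma inv_word_words: "w \<in> words S \<Longrightarrow> inv_word w \<in> words S"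
  by (induction w) (auto simp: inv_word_def)

lemma inv_word_left:
  "w \<in> words S \<Longrightarrow> word_eq S R (inv_word w @ w) []"
proof (induction w)
  case (Cons x w)
  obtain s b where x: "x = (s, b)" by fastforce
  have "word_eq S R (inv_word w @ [(s, \<not> b), (s, \<not> \<not> b)] @ w) (inv_word w @ w)"
    using Cons.prems by (intro word_eq.cancel) (auto simp: x inv_word_words)
  moreover have "word_eq S R (inv_word w @ w) []"
    using Cons by simp
  ultimately have "word_eq S R (inv_word w @ [(s, \<not> b), (s, \<not> \<not> b)] @ w) []"
    by (rule word_eq.trans)
  then show ?case
    by (simp add: x inv_word_def)
qed (auto simp: inv_word_def intro: word_eq.refl)

theorem group_presented_group: "group (presented_group S R)"
proof (rule groupI)
  fix x assume "x \<in> carrier (presented_group S R)"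
  then obtain w where w: "w \<in> words S" "x = word_class S R w"
    by (auto simp: carrier_presented_group)
  then have "word_class S R (inv_word w) \<otimes>\<^bsub>presented_group S R\<^esub> x = \<one>\<^bsub>presented_group S R\<^esub>"
    using inv_word_left[of w S R] inv_word_words[of w S]
    by (simp add: mult_word_class one_presented_group word_class_eq_iff)
  then show "\<exists>y\<in>carrier (presented_group S R). y \<otimes>\<^bsub>presented_group S R\<^esub> x = \<one>\<^bsub>presented_group S R\<^esub>"
    using w inv_word_words[of w S] by (auto simp: carrier_presented_group)
qed (auto simp: carrier_presented_group one_presented_group mult_word_class)

corollary group_braid_group: "group (braid_group n)"
  by (simp add: braid_group_def group_presented_group)

primrec word_value :: "('g, 'm) monoid_scheme \<Rightarrow> ('s \<Rightarrow> 'g) \<Rightarrow> 's word \<Rightarrow> 'g" where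
  "word_value G f [] = \<one>\<^bsub>G\<^esub>"
| "word_value G f (x # w) =
    (if snd x then f (fst x) else inv\<^bsub>G\<^esub> f (fst x)) \<otimes>\<^bsub>G\<^esub> word_value G f w"

theorem presented_group_universal:
  assumes "group G" and f: "f \<in> S \<rightarrow> carrier G"
    and R: "\<And>l r. (l, r) \<in> R \<Longrightarrow> word_value G f l = word_value G f r"
  shows "\<exists>\<phi> \<in> hom (presented_group S R) G. \<forall>w\<in>words S. \<phi> (word_class S R w) = word_value G f w"
proof -
  interpret group G by fact
  have closed: "word_value G f w \<in> carrier G" if "w \<in> words S" for w
    using that f by (induction w) auto
  have app: "word_value G f (u @ v) = word_value G f u \<otimes>\<^bsub>G\<^esub> word_value G f v"
    if "u \<in> words S" "v \<in> words S" for u v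
    using that
  proof (induction u)
    case (Cons x u)
    then have "f (fst x) \<in> carrier G" using f by auto
    with Cons show ?case by (simp add: closed m_assoc)
  qed (simp add: closed)
  have canc: "word_value G f ([(s, b), (s, \<not> b)] @ v) = word_value G f v"
    if "s \<in> S" "v \<in> words S" for s b v
  proof -
    have "f s \<in> carrier G" using f that by auto
    then show ?thesis
      using closed[OF that(2)] by (simp add: m_assoc[symmetric])
  qed
  have eq: "word_value G f u = word_value G f v" if "word_eq S R u v" for u v
    using that
  proof (induction rule: word_eq.induct)
    case (cancel u v s b)
    then show ?case
      using canc[of s v b] app[of u "[(s, b), (s, \<not> b)] @ v"] app[of u v] by simp
  next
    case (rel u v l r)
    then show ?case using R[of l r] by (simp add: app)
  qed auto
  define \<phi> where "\<phi> X = word_value G f (SOME w. w \<in> X)" for X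
  have val: "\<phi> (word_class S R w) = word_value G f w" if "w \<in> words S" for w
  proof -
    have "w \<in> word_class S R w"
      using that by (simp add: word_class_def word_eq.refl)
    then have "(SOME v. v \<in> word_class S R w) \<in> word_class S R w"
      by (rule someI)
    then have "word_eq S R w (SOME v. v \<in> word_class S R w)"
      by (simp add: word_class_def)
    then show ?thesis
      unfolding \<phi>_def by (rule eq[symmetric])
  qed
  have "\<phi> \<in> hom (presented_group S R) G"
    by (rule homI) (auto simp: carrier_presented_group mult_word_class val closed app)
  with val show ?thesis by blast
qed

end

theory Submission
  imports Defs Complex_Main
begin

text \<open>Let a finite index subgroup \<open>H\<close> of \<open>B\<^sub>n\<close> act, through an isomorphism with a finite index
  subgroup of \<open>G\<close>, on the Bass--Serre tree of the splitting. Edge stabilizers contain no free pair.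
  The elements \<open>\<sigma>\<^sub>1\<close>, \<open>\<sigma>\<^sub>3\<close>, \<open>(\<sigma>\<^sub>2\<sigma>\<^sub>3)\<^sup>3\<close>, \<open>\<sigma>\<^sub>2\<close>, \<open>(\<sigma>\<^sub>1\<sigma>\<^sub>2)\<^sup>3\<close> form a pentagon: cyclic
  neighbours commute, and high powers of any two of the others generate a free group.
  The centralizer of a hyperbolic automorphism acts on its axis by translations, so it would contain
  a free pair fixing an edge if it contained any free pair; hence the powers of these five elements
  lying in \<open>H\<close> are elliptic. Non-adjacent fixed subtrees share no edge, and a closed chain of five
  such subtrees in a tree has a common vertex, which is unique. Conjugating the pentagon by
  \<open>g \<in> B\<^sub>n\<close> gives a vertex \<open>v(g)\<close>. Every generator \<open>\<sigma>\<^sub>i\<close> commutes with two non-adjacent members, so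
  \<open>v(g\<sigma>\<^sub>i) = v(g)\<close>; thus \<open>v\<close> is constant, \<open>H\<close> fixes it, and so does \<open>G\<close>, which means that the
  splitting is trivial.\<close>

section \<open>Free pairs\<close>

text \<open>The pentagon comes from a sphere with five marked points in a circle: four punctures and
  the outside of the disc around them. Its members are half twists or full twists about curves that
  surround two consecutive marked points; cyclic neighbours belong to disjoint pairs. Since
  \<open>H\<close> may fail to be normal, conjugates of elements of \<open>H\<close> can leave it. A
  single exponent \<open>m\<close> with all \<open>m\<close>-th powers in \<open>H\<close> repairs
  this, because conjugates of powers are powers of conjugates. The exponent must be at least 2: on
  three marked strands the generators act by unit shears, which satisfy the braid relation and are
  not free, while their higher powers play ping-pong. The tree has to be extracted from a
  presentation, which yields homomorphisms but no inequalities. That an edge separates the coset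
  graph is therefore shown by a homomorphism to a semidirect product that records which edges a path
  crosses an odd number of times.\<close>

definition reduced :: "'s word \<Rightarrow> bool" where
  "reduced = successively (\<lambda>a b. b \<noteq> (fst a, \<not> snd a))"

text \<open>Stated through word values so that it can be carried along homomorphisms; the free
  subgroup that \<open>NF\<close> speaks of is built from it once, in
  \<open>free_pair_not_NF\<close>.\<close>

definition free_pair :: "('g, 'm) monoid_scheme \<Rightarrow> 'g \<Rightarrow> 'g \<Rightarrow> bool" where
  "free_pair G x y \<longleftrightarrow> x \<in> carrier G \<and> y \<in> carrier G \<and>
    (\<forall>w. reduced w \<longrightarrow> w \<noteq> [] \<longrightarrow> word_value G (\<lambda>b. if b then x else y) w \<noteq> \<one>\<^bsub>G\<^esub>)"

lemma reduced_Nil [simp]: "reduced []"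
  and reduced_single [simp]: "reduced [a]"
  and reduced_Cons_Cons [simp]:
    "reduced (a # b # w) \<longleftrightarrow> b \<noteq> (fst a, \<not> snd a) \<and> reduced (b # w)"
  by (simp_all add: reduced_def)

lemma reduced_Cons: "reduced (a # w) \<longleftrightarrow> (w = [] \<or> hd w \<noteq> (fst a, \<not> snd a)) \<and> reduced w"
  by (cases w) auto

context group
begin

lemma word_value_closed [intro]:
  assumes "f \<in> S \<rightarrow> carrier G" "w \<in> words S"
  shows "word_value G f w \<in> carrier G"
  using assms(2) by (induction w) (use assms(1) in auto)

lemma word_value_append:
  assumes f: "f \<in> S \<rightarrow> carrier G" and "u \<in> words S" "v \<in> words S"
  shows "word_value G f (u @ v) = word_value G f u \<otimes> word_value G f v"
  using assms(2)
proof (induction u)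
  case (Cons a u)
  then have "f (fst a) \<in> carrier G" using f by auto
  with Cons show ?case
    using word_value_closed[OF f, of u] word_value_closed[OF f assms(3)] by (simp add: m_assoc)
qed (use word_value_closed[OF f assms(3)] in simp)

lemma word_value_inv_word:
  assumes f: "f \<in> S \<rightarrow> carrier G" and "w \<in> words S"
  shows "word_value G f (inv_word w) = inv (word_value G f w)"
  using assms(2)
proof (induction w)
  case (Cons a w)
  obtain s b where a: "a = (s, b)" by fastforce
  have fs: "f s \<in> carrier G" using f Cons.prems a by auto
  have "inv_word (a # w) = inv_word w @ [(s, \<not> b)]"
    by (simp add: inv_word_def a)
  moreover have w: "w \<in> words S" and IH: "word_value G f (inv_word w) = inv (word_value G f w)"
    using Cons by auto
  ultimately have "word_value G f (inv_word (a # w)) =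
      inv (word_value G f w) \<otimes> word_value G f [(s, \<not> b)]"
    using word_value_append[OF f inv_word_words[OF w], of "[(s, \<not> b)]"] Cons.prems a by simp
  moreover have "word_value G f w \<in> carrier G" using word_value_closed[OF f w] .
  ultimately show ?case
    using fs by (cases b) (simp_all add: inv_mult_group a)
qed (simp add: inv_word_def)

lemma word_value_hom:
  assumes "group M" "h \<in> hom G M" "f \<in> S \<rightarrow> carrier G" "w \<in> words S"
  shows "h (word_value G f w) = word_value M (\<lambda>s. h (f s)) w"
proof -
  interpret h: group_hom G M h
    using assms by (simp add: group_hom_def group_hom_axioms_def)
  show ?thesis using assms(4)
  proof (induction w)
    case (Cons a w)
    then have "f (fst a) \<in> carrier G" "word_value G f w \<in> carrier G"
      using assms(3) word_value_closed by auto
    with Cons show ?case by simp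
  qed simp
qed

lemma word_value_subgroup:
  assumes "subgroup H G" "f \<in> S \<rightarrow> H" "w \<in> words S"
  shows "word_value (G\<lparr>carrier := H\<rparr>) f w = word_value G f w"
  using assms(3)
proof (induction w)
  case (Cons a w)
  then have "f (fst a) \<in> H" using assms(2) by auto
  with Cons show ?case using assms(1) by (simp add: m_inv_consistent)
qed simp

end

lemma words_UNIV [simp]: "w \<in> words UNIV"
  by (auto simp: words_def)

text \<open>A relation between \<open>x\<close> and \<open>y\<close> would persist between their
  images, so freeness is inherited backwards along any homomorphism. This is how freeness in braid
  groups is detected in a permutation group.\<close>

lemma free_pair_hom:
  assumes "group G" "group M" "h \<in> hom G M" "x \<in> carrier G" "y \<in> carrier G"
    and "free_pair M (h x) (h y)"
  shows "free_pair G x y"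
  unfolding free_pair_def
proof (intro conjI allI impI notI)
  interpret group G by fact
  interpret h: group_hom G M h
    using assms by (simp add: group_hom_def group_hom_axioms_def)
  fix w assume w: "reduced w" "w \<noteq> []" "word_value G (\<lambda>b. if b then x else y) w = \<one>\<^bsub>G\<^esub>"
  have "h (word_value G (\<lambda>b. if b then x else y) w) = word_value M (\<lambda>b. if b then h x else h y) w"
    using word_value_hom[OF assms(2,3), of "\<lambda>b. if b then x else y" UNIV w] assms
    by (simp add: if_distrib[of h] cong: if_cong)
  with w assms(6) show False
    unfolding free_pair_def using h.hom_one by metis
qed (use assms in auto)

lemma free_pair_inj_hom:
  assumes "group G" "group M" "h \<in> hom G M" "inj_on h (carrier G)" "free_pair G x y"
  shows "free_pair M (h x) (h y)"
  unfolding free_pair_def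
proof (intro conjI allI impI notI)
  interpret group G by fact
  interpret h: group_hom G M h
    using assms by (simp add: group_hom_def group_hom_axioms_def)
  have xy: "x \<in> carrier G" "y \<in> carrier G" using assms by (auto simp: free_pair_def)
  then show "h x \<in> carrier M" "h y \<in> carrier M" by auto
  fix w assume w: "reduced w" "w \<noteq> []" "word_value M (\<lambda>b. if b then h x else h y) w = \<one>\<^bsub>M\<^esub>"
  have "h (word_value G (\<lambda>b. if b then x else y) w) = word_value M (\<lambda>b. if b then h x else h y) w"
    using word_value_hom[OF assms(2,3), of "\<lambda>b. if b then x else y" UNIV w] xy
    by (simp add: if_distrib[of h] cong: if_cong)
  then have "h (word_value G (\<lambda>b. if b then x else y) w) = h \<one>\<^bsub>G\<^esub>"
    using w by simp
  moreover have "word_value G (\<lambda>b. if b then x else y) w \<in> carrier G"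
    by (rule word_value_closed[of _ UNIV]) (use xy in auto)
  ultimately have "word_value G (\<lambda>b. if b then x else y) w = \<one>\<^bsub>G\<^esub>"
    using inj_onD[OF assms(4)] one_closed by blast
  with w assms(5) show False unfolding free_pair_def by blast
qed

lemma free_pair_swap:
  assumes "free_pair G x y"
  shows "free_pair G y x"
  unfolding free_pair_def
proof (intro conjI allI impI notI)
  fix w :: "bool word"
  let ?w = "map (apfst Not) w"
  assume w: "reduced w" "w \<noteq> []" "word_value G (\<lambda>b. if b then y else x) w = \<one>\<^bsub>G\<^esub>"
  have "word_value G (\<lambda>b. if b then x else y) (map (apfst Not) w) =
      word_value G (\<lambda>b. if b then y else x) w" for w
    by (induction w) auto
  moreover have "reduced ?w"
    using w(1) unfolding reduced_def successively_map by (rule successively_mono) auto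
  ultimately show False
    using w assms unfolding free_pair_def by (metis map_is_Nil_conv)
qed (use assms in \<open>auto simp: free_pair_def\<close>)

text \<open>The four words \<open>comm_letter l\<close> begin with four different letters, so that substituting
  them into a reduced word produces no cancellation.\<close>

fun comm_letter :: "bool \<times> bool \<Rightarrow> bool word" where
  "comm_letter (True, True) = [(True, True), (False, True), (True, False), (False, False)]"
| "comm_letter (True, False) = [(False, True), (True, True), (False, False), (True, False)]"
| "comm_letter (False, True) = [(True, False), (False, False), (True, True), (False, True)]"
| "comm_letter (False, False) = [(False, False), (True, False), (False, True), (True, True)]"

text \<open>The last letter of a block cancels only against the first letter of the block of the
  inverse letter, and reducedness of \<open>w\<close> excludes exactly this neighbour.\<close>

lemma reduced_comm_word: "reduced w \<Longrightarrow> reduced (concat (map comm_letter w))"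
proof (induction w)
  case (Cons a w)
  show ?case
  proof (cases w)
    case Nil
    then show ?thesis by (cases a rule: comm_letter.cases) auto
  next
    case (Cons b v)
    with Cons.IH Cons.prems show ?thesis
      by (cases a rule: comm_letter.cases; cases b rule: comm_letter.cases) auto
  qed
qed simp

text \<open>Both new elements lie in the commutator subgroup, so every homomorphism to the integers
  kills them. A free pair in the centralizer of a hyperbolic element thus yields a free pair that
  does not translate along the axis.\<close>

lemma (in group) free_pair_commutators:
  assumes "free_pair G x y"
  shows "free_pair G (x \<otimes> y \<otimes> inv x \<otimes> inv y) (inv x \<otimes> inv y \<otimes> x \<otimes> y)"
    (is "free_pair G ?u ?v")
  unfolding free_pair_def
proof (intro conjI allI impI notI)
  have xy: "x \<in> carrier G" "y \<in> carrier G" using assms by (auto simp: free_pair_def)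
  then show "?u \<in> carrier G" "?v \<in> carrier G" by auto
  let ?f = "\<lambda>b. if b then x else y" and ?g = "\<lambda>b. if b then ?u else ?v"
  have f: "?f \<in> UNIV \<rightarrow> carrier G" using xy by auto
  have one: "word_value G ?f (comm_letter a) = word_value G ?g [a]" for a
    using xy by (cases a rule: comm_letter.cases) (simp_all add: inv_mult_group m_assoc)
  have eq: "word_value G ?f (concat (map comm_letter w)) = word_value G ?g w" for w
  proof (induction w)
    case (Cons a w)
    have "word_value G ?f (concat (map comm_letter (a # w))) =
        word_value G ?g [a] \<otimes> word_value G ?g w"
      using one[of a] Cons by (simp add: word_value_append[OF f])
    also have "\<dots> = word_value G ?g ([a] @ w)"
      by (rule word_value_append[symmetric, of _ UNIV]) (use xy in auto)
    finally show ?case by simp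
  qed simp
  fix w assume w: "reduced w" "w \<noteq> []" "word_value G ?g w = \<one>"
  have "concat (map comm_letter w) \<noteq> []"
    using w(2) by (cases w; cases "hd w" rule: comm_letter.cases) auto
  then show False
    using assms reduced_comm_word[OF w(1)] w(3) eq[of w] unfolding free_pair_def by metis
qed

lemma word_eq_reduced:
  assumes "w \<in> words S"
  obtains v where "word_eq S R w v" "reduced v" "v \<in> words S"
  using assms
proof (induction "length w" arbitrary: w thesis rule: less_induct)
  case less
  show ?case
  proof (cases "reduced w")
    case True
    with less.prems show ?thesis by (blast intro: word_eq.refl)
  next
    case False
    have "\<exists>u s b v. w = u @ [(s, b), (s, \<not> b)] @ v" using False
    proof (induction w)
      case (Cons a w)
      show ?case
      proof (cases "reduced w")
        case True
        then obtain b v where "w = b # v" "b = (fst a, \<not> snd a)"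
          using Cons.prems by (cases w) auto
        then have "a # w = [] @ [(fst a, snd a), (fst a, \<not> snd a)] @ v" by simp
        then show ?thesis by blast
      next
        case False
        with Cons.IH obtain u s b v where "w = u @ [(s, b), (s, \<not> b)] @ v" by blast
        then have "a # w = (a # u) @ [(s, b), (s, \<not> b)] @ v" by simp
        then show ?thesis by blast
      qed
    qed simp
    then obtain u s b v where w: "w = u @ [(s, b), (s, \<not> b)] @ v" by blast
    then have "word_eq S R w (u @ v)"
      using word_eq.cancel[of u S v s R b] less.prems by simp
    moreover obtain z where "word_eq S R (u @ v) z" "reduced z" "z \<in> words S"
      using less.hyps[of "u @ v"] w less.prems(2) by auto
    ultimately show ?thesis
      using less.prems by (blast intro: word_eq.trans)
  qed
qed

text \<open>The values of all words in \<open>x\<close> and \<open>y\<close> form a subgroup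
  \<open>H\<close>. The canonical map onto it from the group on \<open>X\<close> without relations
  is injective: if \<open>u\<close> and \<open>v\<close> have equal values, a reduced form of
  \<open>u @ inv_word v\<close> has trivial value and is therefore empty.\<close>

lemma (in group) free_pair_not_NF:
  assumes "free_pair G x y"
  shows "\<not> NF G"
proof -
  have xy: "x \<in> carrier G" "y \<in> carrier G" using assms by (auto simp: free_pair_def)
  have free: "word_value G (\<lambda>b. if b then x else y) w \<noteq> \<one>" if "reduced w" "w \<noteq> []" for w
    using assms that by (auto simp: free_pair_def)
  have "x \<noteq> y"
    using free[of "[(True, True), (False, False)]"] xy by auto
  define X where "X = {x, y}"
  define H where "H = word_value G id ` words X"
  have id: "id \<in> X \<rightarrow> carrier G" using xy by (auto simp: X_def)
  have "subgroup H G"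
  proof
    show "H \<subseteq> carrier G" using word_value_closed[OF id] by (auto simp: H_def)
    show "u \<otimes> v \<in> H" if uv: "u \<in> H" "v \<in> H" for u v
    proof -
      obtain a b where "u = word_value G id a" "v = word_value G id b" "a \<in> words X" "b \<in> words X"
        using uv by (auto simp: H_def)
      then show ?thesis
        unfolding H_def by (intro image_eqI[of _ _ "a @ b"]) (simp_all add: word_value_append[OF id])
    qed
    show "\<one> \<in> H" unfolding H_def by (rule image_eqI[of _ _ "[]"]) auto
    show "inv u \<in> H" if u: "u \<in> H" for u
    proof -
      obtain a where "u = word_value G id a" "a \<in> words X"
        using u by (auto simp: H_def)
      then show ?thesis
        unfolding H_def by (intro image_eqI[of _ _ "inv_word a"])
          (simp_all add: word_value_inv_word[OF id] inv_word_words)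
    qed
  qed
  then have "group (G\<lparr>carrier := H\<rparr>)" by (rule subgroup_imp_group)
  have mem: "x \<in> H" "y \<in> H"
  proof -
    have "word_value G id [(x, True)] \<in> H" "word_value G id [(y, True)] \<in> H"
      unfolding H_def by (rule imageI; simp add: X_def)+
    then show "x \<in> H" "y \<in> H" using xy by auto
  qed
  then have idH: "id \<in> X \<rightarrow> H" by (auto simp: X_def)
  let ?M = "G\<lparr>carrier := H\<rparr>"
  have free_X: "word_value G id w \<noteq> \<one>" if "reduced w" "w \<noteq> []" "w \<in> words X" for w
  proof -
    let ?w = "map (apfst (\<lambda>s. s = x)) w"
    have "word_value G (\<lambda>b. if b then x else y) ?w = word_value G id w"
      using that(3) by (induction w) (auto simp: X_def)
    moreover have "reduced ?w"
      using that(1,3)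
    proof (induction w)
      case (Cons a w)
      then show ?case by (cases w; cases a) (auto simp: X_def)
    qed simp
    ultimately show ?thesis using free[of ?w] that(2) by auto
  qed
  obtain \<phi> where \<phi>: "\<phi> \<in> hom (presented_group X {}) ?M"
    and val: "\<And>w. w \<in> words X \<Longrightarrow> \<phi> (word_class X {} w) = word_value ?M id w"
    using presented_group_universal[OF \<open>group ?M\<close>, of id X "{}"] idH by auto
  have val: "\<phi> (word_class X {} w) = word_value G id w" if "w \<in> words X" for w
    using val[OF that] word_value_subgroup[OF \<open>subgroup H G\<close> idH that] by simp
  have "inj_on \<phi> (carrier (presented_group X {}))"
  proof (rule inj_onI)
    fix a b assume ab: "a \<in> carrier (presented_group X {})" "b \<in> carrier (presented_group X {})"
      and eq: "\<phi> a = \<phi> b"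
    obtain u v where uv: "u \<in> words X" "a = word_class X {} u" "v \<in> words X" "b = word_class X {} v"
      using ab by (auto simp: carrier_presented_group)
    obtain r where r: "word_eq X {} (u @ inv_word v) r" "reduced r" "r \<in> words X"
      using word_eq_reduced[of "u @ inv_word v" X "{}"] uv inv_word_words by auto
    have "word_value G id r = \<phi> (word_class X {} (u @ inv_word v))"
      using r uv val word_class_eq_iff[of "u @ inv_word v" X "{}" r] inv_word_words[of v X] by auto
    also have "\<dots> = word_value G id u \<otimes> inv (word_value G id v)"
      using uv inv_word_words[of v X]
      by (simp add: val word_value_append[OF id] word_value_inv_word[OF id])
    also have "\<dots> = \<one>"
      using eq uv val word_value_closed[OF id] by (simp add: r_inv)
    finally have "r = []" using free_X r by blast
    then have "word_eq X {} (u @ inv_word v @ v) v"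
      using word_eq_append[OF r(1) word_eq.refl[OF uv(3)]] by simp
    moreover have "word_eq X {} (u @ inv_word v @ v) u"
      using word_eq_append[OF word_eq.refl[OF uv(1)] inv_word_left[OF uv(3)]] by simp
    ultimately have "word_eq X {} u v" by (blast intro: word_eq.sym word_eq.trans)
    then show "a = b" using uv by (simp add: word_class_eq_iff)
  qed
  moreover have "\<phi> ` carrier (presented_group X {}) = H"
    by (simp add: carrier_presented_group image_image val H_def cong: image_cong)
  ultimately have "\<phi> \<in> iso (presented_group X {}) ?M"
    using \<phi> by (simp add: iso_def bij_betw_def)
  moreover have "\<phi> (gen_class X {} s) = id s" if "s \<in> X" for s
    using val[of "[pos s]"] that id xy by (auto simp: X_def)
  ultimately have "presented_by ?M id X {}" by (auto simp: presented_by_def)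
  then have "free_group ?M"
    using \<open>group ?M\<close> mem unfolding free_group_def X_def
    by (intro conjI exI[of _ "{x, y}"]) auto
  moreover have "\<not> comm_group ?M"
  proof
    assume "comm_group ?M"
    then have "x \<otimes> y = y \<otimes> x"
      using comm_groupE(4)[of ?M] mem by auto
    then have "x \<otimes> (y \<otimes> (inv x \<otimes> inv y)) = \<one>"
      using xy by (metis inv_closed inv_mult_group m_assoc m_closed r_inv)
    then show False
      using free[of "[(True, True), (False, True), (True, False), (False, False)]"] xy by simp
  qed
  ultimately show ?thesis
    using \<open>subgroup H G\<close> unfolding NF_def by blast
qed

section \<open>Permutation groups and the ping-pong lemma\<close>

definition perm_group :: "('a \<Rightarrow> 'a) monoid" where
  "perm_group = \<lparr>carrier = {f. bij f}, mult = (\<circ>), one = id\<rparr>"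

lemma group_perm_group: "group (perm_group :: ('a \<Rightarrow> 'a) monoid)"
proof (rule groupI)
  fix f :: "'a \<Rightarrow> 'a" assume "f \<in> carrier perm_group"
  then show "\<exists>g\<in>carrier perm_group. g \<otimes>\<^bsub>perm_group\<^esub> f = \<one>\<^bsub>perm_group\<^esub>"
    by (intro bexI[of _ "inv_into UNIV f"]) (auto simp: perm_group_def bij_imp_bij_inv bij_is_inj)
qed (auto simp: perm_group_def bij_comp comp_assoc)

lemma inv_perm_group:
  assumes "bij f"
  shows "inv\<^bsub>perm_group\<^esub> f = inv_into UNIV f"
proof (rule group.inv_equality[OF group_perm_group])
  show "inv_into UNIV f \<otimes>\<^bsub>perm_group\<^esub> f = \<one>\<^bsub>perm_group\<^esub>"
    using assms by (simp add: perm_group_def bij_is_inj)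
qed (use assms in \<open>auto simp: perm_group_def bij_imp_bij_inv\<close>)

text \<open>Words act from the right. Starting in \<open>U l\<close>, where \<open>l\<close> is not
  inverse to the last letter, each letter moves the point into the set that bears its name, so the
  word ends in the set of its first letter.\<close>

lemma ping_pong:
  fixes f :: "bool \<Rightarrow> 'a \<Rightarrow> 'a" and U :: "bool \<times> bool \<Rightarrow> 'a set"
  assumes bij: "\<And>b. bij (f b)"
    and nonempty: "\<And>l. U l \<noteq> {}"
    and disjoint: "\<And>k l. k \<noteq> l \<Longrightarrow> U k \<inter> U l = {}"
    and pos: "\<And>b l. l \<noteq> (b, False) \<Longrightarrow> f b ` U l \<subseteq> U (b, True)"
    and neg: "\<And>b l. l \<noteq> (b, True) \<Longrightarrow> inv_into UNIV (f b) ` U l \<subseteq> U (b, False)"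
  shows "free_pair perm_group (f True) (f False)"
  unfolding free_pair_def
proof (intro conjI allI impI notI)
  show "f True \<in> carrier perm_group" "f False \<in> carrier perm_group"
    using bij by (auto simp: perm_group_def)
  have f: "(\<lambda>b. if b then f True else f False) = f"
    by (rule ext) auto
  have main: "word_value perm_group f w ` U l \<subseteq> U (hd w)"
    if "reduced w" "w \<noteq> []" "l \<noteq> (fst (last w), \<not> snd (last w))" for w l
    using that
  proof (induction w)
    case (Cons a w)
    obtain b e where a: "a = (b, e)" by fastforce
    have step: "word_value perm_group f [a] ` U k \<subseteq> U a" if "k \<noteq> (b, \<not> e)" for k
      using that pos[of k b] neg[of k b] bij[of b]
      by (cases e) (auto simp: a perm_group_def[symmetric] inv_perm_group, auto simp: perm_group_def)
    show ?case
    proof (cases "w = []")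
      case True
      with Cons.prems step[of l] show ?thesis by (simp add: a)
    next
      case False
      then have "word_value perm_group f w ` U l \<subseteq> U (hd w)"
        using Cons by (auto simp: reduced_Cons)
      moreover have "hd w \<noteq> (b, \<not> e)"
        using Cons.prems False by (auto simp: reduced_Cons a)
      ultimately show ?thesis
        using step[of "hd w"] by (fastforce simp: a perm_group_def)
    qed
  qed simp
  fix w assume w: "reduced w" "w \<noteq> []"
    "word_value perm_group (\<lambda>b. if b then f True else f False) w = \<one>\<^bsub>perm_group\<^esub>"
  \<comment> \<open>The start must avoid two of the four letters: the inverse of the last letter,
    and the first letter. A trivial word would then map \<open>U l\<close> to itself and also into
    the disjoint set \<open>U (hd w)\<close>.\<close>
  have "\<exists>l::bool \<times> bool. l \<noteq> p \<and> l \<noteq> q" for p q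
  proof (rule ccontr)
    assume "\<not> ?thesis"
    then have "UNIV \<subseteq> {p, q}" by auto
    then have "card (UNIV :: (bool \<times> bool) set) \<le> card {p, q}"
      by (intro card_mono) auto
    also have "\<dots> \<le> 2" by (simp add: card_insert_if)
    finally show False by (simp add: card_cartesian_product flip: UNIV_Times_UNIV)
  qed
  then obtain l where l: "l \<noteq> hd w" "l \<noteq> (fst (last w), \<not> snd (last w))"
    by blast
  then have "U l \<subseteq> U (hd w)"
    using main[OF w(1,2) l(2)] w(3) f by (simp add: perm_group_def)
  then show False
    using nonempty[of l] disjoint[OF l(1)] by auto
qed

section \<open>Trees as graphs and as metric spaces\<close>

text \<open>The path metric on the vertices of a tree, axiomatised so that statements on geodesics
  and subtrees become linear arithmetic. \<open>four_point\<close> is Gromov's hyperbolicity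
  condition with constant 0; \<open>even_perimeter\<close> makes branch points of geodesics
  vertices.\<close>

locale metric_tree =
  fixes V :: "'v set" and d :: "'v \<Rightarrow> 'v \<Rightarrow> nat"
  assumes dist_zero_iff: "\<lbrakk>u \<in> V; v \<in> V\<rbrakk> \<Longrightarrow> d u v = 0 \<longleftrightarrow> u = v"
    and dist_sym: "\<lbrakk>u \<in> V; v \<in> V\<rbrakk> \<Longrightarrow> d u v = d v u"
    and dist_triangle: "\<lbrakk>u \<in> V; v \<in> V; w \<in> V\<rbrakk> \<Longrightarrow> d u w \<le> d u v + d v w"
    and geodesic: "\<lbrakk>u \<in> V; v \<in> V; k \<le> d u v\<rbrakk> \<Longrightarrow> \<exists>w\<in>V. d u w = k \<and> k + d w v = d u v"
    and even_perimeter: "\<lbrakk>u \<in> V; v \<in> V; w \<in> V\<rbrakk> \<Longrightarrow> even (d u v + d v w + d u w)"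
    and four_point: "\<lbrakk>x \<in> V; y \<in> V; z \<in> V; w \<in> V\<rbrakk>
      \<Longrightarrow> d x y + d z w \<le> max (d x z + d y w) (d x w + d y z)"

text \<open>\<open>bridge\<close> expresses acyclicity by a two-colouring of the vertices that
  changes only across the given edge; for coset graphs such colourings can be written down.
  \<open>side\<close> controls the parity of distances.\<close>

locale bipartite_tree =
  fixes V :: "'v set" and adj :: "'v \<Rightarrow> 'v \<Rightarrow> bool" and side :: "'v \<Rightarrow> bool"
  assumes adj_in: "adj u v \<Longrightarrow> u \<in> V \<and> v \<in> V"
    and adj_sym: "adj u v \<Longrightarrow> adj v u"
    and adj_side: "adj u v \<Longrightarrow> side u \<noteq> side v"
    and connected: "\<lbrakk>u \<in> V; v \<in> V\<rbrakk> \<Longrightarrow> (u, v) \<in> {(u, v). adj u v}\<^sup>*"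
    and bridge: "adj x y \<Longrightarrow> \<exists>f :: 'v \<Rightarrow> bool. f x \<noteq> f y \<and>
      (\<forall>u v. adj u v \<longrightarrow> {u, v} \<noteq> {x, y} \<longrightarrow> f u = f v)"
begin

section \<open>The path metric of a bipartite tree\<close>

definition gdist :: "'v \<Rightarrow> 'v \<Rightarrow> nat" where
  "gdist u v = (LEAST n. (u, v) \<in> {(u, v). adj u v} ^^ n)"

lemma gdist_relpow:
  assumes "u \<in> V" "v \<in> V"
  shows "(u, v) \<in> {(u, v). adj u v} ^^ gdist u v"
  unfolding gdist_def using connected[OF assms] LeastI_ex[of "\<lambda>n. (u, v) \<in> {(u, v). adj u v} ^^ n"]
  by (simp add: rtrancl_is_UN_relpow)

lemma gdist_le: "(u, v) \<in> {(u, v). adj u v} ^^ n \<Longrightarrow> gdist u v \<le> n"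
  unfolding gdist_def by (rule Least_le)

lemma gdist_zero_iff:
  assumes "u \<in> V" "v \<in> V"
  shows "gdist u v = 0 \<longleftrightarrow> u = v"
  using gdist_relpow[OF assms] gdist_le[of u v 0] by auto

lemma gdist_self [simp]: "gdist u u = 0"
  using gdist_le[of u u 0] by simp

lemma relpow_sym: "(u, v) \<in> {(u, v). adj u v} ^^ n \<Longrightarrow> (v, u) \<in> {(u, v). adj u v} ^^ n"
proof (induction n arbitrary: v)
  case (Suc n)
  then obtain w where "(u, w) \<in> {(u, v). adj u v} ^^ n" "adj w v" by auto
  with Suc.IH show ?case
    by (intro relpow_Suc_I2[of _ w]) (auto intro: adj_sym)
qed simp

lemma gdist_sym:
  assumes "u \<in> V" "v \<in> V"
  shows "gdist u v = gdist v u"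
  using gdist_le[OF relpow_sym[OF gdist_relpow[OF assms(1,2)]]]
    gdist_le[OF relpow_sym[OF gdist_relpow[OF assms(2,1)]]] by simp

lemma gdist_triangle:
  assumes "u \<in> V" "v \<in> V" "w \<in> V"
  shows "gdist u w \<le> gdist u v + gdist v w"
  using gdist_relpow[OF assms(1,2)] gdist_relpow[OF assms(2,3)]
  by (intro gdist_le) (auto simp: relpow_add)

lemma adj_neq: "adj u v \<Longrightarrow> u \<noteq> v"
  using adj_side by auto

lemma gdist_adj: "adj u v \<Longrightarrow> gdist u v = 1"
  using gdist_le[of u v 1] gdist_zero_iff[of u v] adj_in[of u v] adj_neq[of u v] by fastforce

lemma gdist_step:
  assumes "u \<in> V" "v \<in> V" "u \<noteq> v"
  obtains w where "adj u w" "gdist u v = Suc (gdist w v)"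
proof -
  obtain n where n: "gdist u v = Suc n"
    using gdist_zero_iff[OF assms(1,2)] assms(3) by (cases "gdist u v") auto
  then obtain w where w: "adj u w" "(w, v) \<in> {(u, v). adj u v} ^^ n"
    using relpow_Suc_D2[of u v n "{(u, v). adj u v}"] gdist_relpow[OF assms(1,2)] n by auto
  then have "gdist w v \<le> n" by (simp add: gdist_le)
  moreover have "Suc n \<le> Suc (gdist w v)"
    using gdist_triangle[of u w v] gdist_adj[OF w(1)] adj_in[OF w(1)] assms n by simp
  ultimately show thesis using that[of w] w n by simp
qed

lemma even_gdist:
  assumes "u \<in> V" "v \<in> V"
  shows "even (gdist u v) \<longleftrightarrow> side u = side v"
proof -
  have "even n \<longleftrightarrow> side u = side v" if "(u, v) \<in> {(u, v). adj u v} ^^ n" for n v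
    using that
  proof (induction n arbitrary: v)
    case (Suc n)
    then obtain w where "(u, w) \<in> {(u, v). adj u v} ^^ n" "adj w v" by auto
    with Suc.IH[of w] adj_side[of w v] show ?case by auto
  qed simp
  then show ?thesis using gdist_relpow[OF assms] by blast
qed

lemma gdist_adj_cases:
  assumes "adj u w" "v \<in> V"
  shows "gdist w v = Suc (gdist u v) \<or> gdist u v = Suc (gdist w v)"
proof -
  have "gdist w v \<noteq> gdist u v"
    using even_gdist[of w v] even_gdist[of u v] adj_side[OF assms(1)] adj_in[OF assms(1)] assms(2)
    by metis
  moreover have "gdist w v \<le> gdist u v + 1" "gdist u v \<le> gdist w v + 1"
    using gdist_triangle[of w u v] gdist_triangle[of u w v] gdist_adj[OF assms(1)]
      gdist_adj[OF adj_sym[OF assms(1)]] adj_in[OF assms(1)] assms(2) by auto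
  ultimately show ?thesis by linarith
qed

text \<open>From any vertex nearer to \<open>v\<close> than \<open>x\<close>, a geodesic to
  \<open>v\<close> avoids \<open>x\<close>, so the colouring that cuts the edge \<open>x y\<close>
  is constant on these vertices. A second neighbour \<open>z\<close> of this kind would force
  \<open>f x = f z = f v = f y\<close>.\<close>

lemma parent_unique:
  assumes xy: "adj x y" and xz: "adj x z" and v: "v \<in> V"
    and "gdist y v < gdist x v" "gdist z v < gdist x v"
  shows "y = z"
proof (rule ccontr)
  assume "y \<noteq> z"
  obtain f :: "'v \<Rightarrow> bool" where f: "f x \<noteq> f y"
    and same: "\<And>a b. adj a b \<Longrightarrow> {a, b} \<noteq> {x, y} \<Longrightarrow> f a = f b"
    using bridge[OF xy] by blast
  have "f u = f v" if "u \<in> V" "gdist u v < gdist x v" for u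
    using that
  proof (induction "gdist u v" arbitrary: u)
    case 0
    then show ?case using gdist_zero_iff[of u v] v by simp
  next
    case (Suc n)
    then have "u \<noteq> v" by auto
    then obtain w where w: "adj u w" "gdist u v = Suc (gdist w v)"
      using gdist_step[OF Suc.prems(1) v] by blast
    then have "x \<notin> {u, w}" using Suc.prems by auto
    then have "{u, w} \<noteq> {x, y}" by blast
    then have "f u = f w" using same w by blast
    moreover have "f w = f v"
      using Suc.hyps(1)[of w] Suc.hyps(2) Suc.prems(2) w(2) adj_in[OF w(1)] by simp
    ultimately show ?case by simp
  qed
  then have "f y = f v" "f z = f v"
    using assms(4,5) adj_in[OF xy] adj_in[OF xz] by blast+
  moreover have "f x = f z"
    using same[OF xz] \<open>y \<noteq> z\<close> by (metis doubleton_eq_iff)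
  ultimately show False using f by simp
qed

text \<open>The neighbour \<open>a\<close> is not the one that leads to \<open>z\<close>, so it is
  one step farther from \<open>z\<close> than \<open>x\<close> is. The induction moves
  \<open>x\<close> to \<open>a\<close>, where the directions to \<open>y\<close> and
  \<open>z\<close> differ again.\<close>

lemma gdist_concat:
  assumes "adj x a" "adj x b" "a \<noteq> b" "y \<in> V" "z \<in> V"
    and "gdist x y = Suc (gdist a y)" "gdist x z = Suc (gdist b z)"
  shows "gdist y z = gdist x y + gdist x z"
  using assms
proof (induction "gdist x y" arbitrary: x a b)
  case 0
  then show ?case by simp
next
  case (Suc n)
  have "gdist a z \<noteq> gdist x z - 1"
    using parent_unique[of x a b z] Suc.prems by auto
  then have az: "gdist a z = Suc (gdist x z)"
    using gdist_adj_cases[of x a z] Suc.prems by auto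
  show ?case
  proof (cases "a = y")
    case True
    then show ?thesis using az Suc.prems by simp
  next
    case False
    then obtain c where c: "adj a c" "gdist a y = Suc (gdist c y)"
      using gdist_step[of a y] Suc.prems adj_in by metis
    then have "c \<noteq> x" using Suc.prems by auto
    then have "gdist y z = gdist a y + gdist a z"
      using Suc.hyps(1)[of a c x] c az Suc.hyps(2) Suc.prems adj_sym by simp
    then show ?thesis using az Suc.prems by simp
  qed
qed

text \<open>Compare the first edges from \<open>x\<close> towards \<open>y\<close>, \<open>z\<close>
  and \<open>w\<close>. If all agree, the inequality at the common neighbour suffices; otherwise
  \<open>gdist_concat\<close> makes enough of the distances sums of legs at
  \<open>x\<close>.\<close>

lemma gdist_four_point:
  assumes "x \<in> V" "y \<in> V" "z \<in> V" "w \<in> V"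
  shows "gdist x y + gdist z w \<le> max (gdist x z + gdist y w) (gdist x w + gdist y z)"
  using assms(1)
proof (induction "gdist x y" arbitrary: x)
  case 0
  then have "x = y" using gdist_zero_iff[of x y] assms(2) by simp
  moreover have "gdist z w \<le> gdist y z + gdist y w"
    using gdist_triangle[OF assms(3,2,4)] gdist_sym[OF assms(3,2)] by linarith
  ultimately show ?case by (simp add: max_def)
next
  case (Suc n)
  note tri = gdist_triangle and sym = gdist_sym
  show ?case
  proof (cases "x = z \<or> x = w")
    case True
    then show ?thesis
    proof
      assume "x = z"
      then show ?thesis using sym[OF assms(2,3)] by simp
    next
      assume "x = w"
      then show ?thesis using sym[OF assms(2,4)] sym[OF assms(3,4)] by simp
    qed
  next
    case False
    have "x \<noteq> y" using Suc.hyps by auto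
    obtain a where a: "adj x a" "gdist x y = Suc (gdist a y)"
      using gdist_step[OF Suc.prems assms(2) \<open>x \<noteq> y\<close>] by blast
    obtain b where b: "adj x b" "gdist x z = Suc (gdist b z)"
      using gdist_step[OF Suc.prems assms(3)] False by blast
    obtain c where c: "adj x c" "gdist x w = Suc (gdist c w)"
      using gdist_step[OF Suc.prems assms(4)] False by blast
    have ab: "a \<noteq> b \<Longrightarrow> gdist y z = gdist x y + gdist x z"
      and bc: "b \<noteq> c \<Longrightarrow> gdist z w = gdist x z + gdist x w"
      and ac: "a \<noteq> c \<Longrightarrow> gdist y w = gdist x y + gdist x w"
      using gdist_concat a b c assms by blast+
    have "gdist z w \<le> gdist x z + gdist x w"
      using tri[OF assms(3) Suc.prems assms(4)] sym[OF assms(3) Suc.prems] by linarith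
    moreover have "gdist a y + gdist z w \<le> max (gdist a z + gdist y w) (gdist a w + gdist y z)"
      using Suc.hyps(1)[of a] Suc.hyps(2) a adj_in[OF a(1)] by simp
    ultimately show ?thesis
      using ab bc ac a b c by (cases "a = b"; cases "b = c"; cases "a = c") auto
  qed
qed

sublocale metric_tree V gdist
proof
  fix u v w assume "u \<in> V" "v \<in> V" "w \<in> V"
  then show "even (gdist u v + gdist v w + gdist u w)"
    using even_gdist[of u v] even_gdist[of v w] even_gdist[of u w] by auto
next
  fix u v k assume "u \<in> V" "v \<in> V" "k \<le> gdist u v"
  then show "\<exists>w\<in>V. gdist u w = k \<and> k + gdist w v = gdist u v"
  proof (induction k)
    case 0
    then show ?case by (intro bexI[of _ u]) auto
  next
    case (Suc k)
    then obtain w where w: "w \<in> V" "gdist u w = k" "k + gdist w v = gdist u v" by auto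
    then have "w \<noteq> v" using Suc.prems by auto
    then obtain z where z: "adj w z" "gdist w v = Suc (gdist z v)"
      using gdist_step w Suc.prems by metis
    then have "z \<in> V" using adj_in by auto
    moreover have "gdist u z \<le> Suc k"
      using gdist_triangle[of u w z] gdist_adj[OF z(1)] w Suc.prems \<open>z \<in> V\<close> by simp
    moreover have "gdist u v \<le> gdist u z + gdist z v"
      using gdist_triangle \<open>z \<in> V\<close> Suc.prems by blast
    ultimately show ?case using w z by (intro bexI[of _ z]) auto
  qed
qed (fact gdist_zero_iff gdist_sym gdist_triangle gdist_four_point)+

end

section \<open>Elliptic elements\<close>

context metric_tree
begin

lemma dist_self [simp]: "u \<in> V \<Longrightarrow> d u u = 0"
  using dist_zero_iff by blast

lemma between_unique:
  assumes V: "u \<in> V" "v \<in> V" "z \<in> V" "w \<in> V"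
    and "d u z + d z v = d u v" "d u w + d w v = d u v" "d u z = d u w"
  shows "z = w"
proof -
  have "d z w = 0"
    using four_point[OF V(3,4,1,2)] dist_sym[OF V(1,3)] dist_sym[OF V(1,4)] assms(5-7) by linarith
  then show ?thesis using dist_zero_iff V by blast
qed

lemma between_order:
  assumes V: "u \<in> V" "v \<in> V" "z \<in> V" "w \<in> V"
    and "d u z + d z v = d u v" "d u w + d w v = d u v" "d u z \<le> d u w"
  shows "d u z + d z w = d u w"
  using four_point[OF V(3,4,1,2)] dist_sym[OF V(1,3)] dist_sym[OF V(1,4)] assms(5-7)
    dist_triangle[OF V(1,3,4)] by linarith

text \<open>In the four-point inequality \<open>d a c + d b e\<close> exceeds
  \<open>d a b + d c e\<close> by \<open>2 * d b c > 0\<close>, so it is bounded by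
  \<open>d a e + d b c\<close>. Two geodesics that overlap in a proper segment thus join to a
  geodesic.\<close>

lemma between_concat:
  assumes V: "a \<in> V" "b \<in> V" "c \<in> V" "e \<in> V"
    and "d a b + d b c = d a c" "d b c + d c e = d b e" "b \<noteq> c"
  shows "d a e = d a b + d b c + d c e"
proof -
  have "d b c > 0" using dist_zero_iff V assms(7) by blast
  then show ?thesis
    using four_point[OF V(1,3,2,4)] dist_sym[OF V(2,3)] assms(5,6)
      dist_triangle[OF V(1,2,4)] by linarith
qed

lemma median:
  assumes V: "x \<in> V" "y \<in> V" "z \<in> V"
  obtains m where "m \<in> V" "d x m + d m y = d x y" "d y m + d m z = d y z" "d x m + d m z = d x z"
proof -
  \<comment> \<open>The Gromov product of \<open>y\<close> and \<open>z\<close> at \<open>x\<close>: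
    the length of the common part of the geodesics from \<open>x\<close>. The triangle inequalities
    in \<open>le\<close> keep the natural subtraction exact, and parity makes the division
    exact.\<close>
  define k where "k = (d x y + d x z - d y z) div 2"
  have le: "d y z \<le> d x y + d x z" "d x z \<le> d x y + d y z" "d x y \<le> d x z + d y z"
    using dist_triangle[OF V(2,1,3)] dist_sym[OF V(1,2)] dist_triangle[OF V] 
      dist_triangle[OF V(1,3,2)] dist_sym[OF V(2,3)] by linarith+
  have "even (d x y + d x z - d y z)"
    using even_perimeter[OF V] le by presburger
  then have k: "2 * k = d x y + d x z - d y z"
    unfolding k_def by simp
  then have "k \<le> d x y" using le by linarith
  then obtain m where m: "m \<in> V" "d x m = k" "k + d m y = d x y"
    using geodesic V by blast
  have "d m z \<le> d x z - k"
    using four_point[OF m(1) V(3,1,2)] dist_sym[OF m(1) V(1)] dist_sym[OF V(2,3)]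
      dist_sym[OF V(1,3)] m k le by linarith
  then show thesis
    using that[of m] m k le dist_triangle[OF V(1) m(1) V(3)] dist_sym[OF m(1) V(2)] by linarith
qed

text \<open>Of the three ways to pair four points, the two with the largest sums have equal sums.
  The hypothesis says that the pairing \<open>p q\<close>, \<open>x y\<close> is not among these
  two.\<close>

lemma far_differences_eq:
  assumes V: "p \<in> V" "q \<in> V" "x \<in> V" "y \<in> V"
    and "d p q + d x y < d p x + d q y"
  shows "d p x + d q y = d p y + d q x"
  using four_point[OF V(1,3,2,4)] four_point[OF V(1,4,2,3)] dist_sym[OF V(2,3)]
    dist_sym[OF V(2,4)] dist_sym[OF V(3,4)] assms(5) by linarith

end

text \<open>\<open>fixed_unique\<close> says that edge stabilizers contain no free pair: an
  automorphism that fixes two vertices fixes the geodesic between them.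
  \<open>even_displacement\<close> places the midpoint of \<open>v\<close> and
  \<open>act g v\<close> at a vertex.\<close>

locale tree_action = group G + metric_tree V d
  for G (structure) and V :: "'v set" and d +
  fixes act :: "'a \<Rightarrow> 'v \<Rightarrow> 'v"
  assumes V_nonempty: "V \<noteq> {}"
    and act_closed: "\<lbrakk>g \<in> carrier G; v \<in> V\<rbrakk> \<Longrightarrow> act g v \<in> V"
    and act_one: "v \<in> V \<Longrightarrow> act \<one> v = v"
    and act_mult: "\<lbrakk>g \<in> carrier G; h \<in> carrier G; v \<in> V\<rbrakk> \<Longrightarrow> act (g \<otimes> h) v = act g (act h v)"
    and dist_act: "\<lbrakk>g \<in> carrier G; u \<in> V; v \<in> V\<rbrakk> \<Longrightarrow> d (act g u) (act g v) = d u v"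
    and even_displacement: "\<lbrakk>g \<in> carrier G; v \<in> V\<rbrakk> \<Longrightarrow> even (d v (act g v))"
    and fixed_unique: "\<lbrakk>free_pair G x y; u \<in> V; v \<in> V; act x u = u; act y u = u; act x v = v; act y v = v\<rbrakk>
      \<Longrightarrow> u = v"
begin

lemma act_inj: "\<lbrakk>g \<in> carrier G; u \<in> V; v \<in> V; act g u = act g v\<rbrakk> \<Longrightarrow> u = v"
  by (metis act_mult act_one inv_closed l_inv)

lemma fixed_between:
  assumes "g \<in> carrier G" "u \<in> V" "v \<in> V" "m \<in> V" "act g u = u" "act g v = v"
    and m: "d u m + d m v = d u v"
  shows "act g m = m"
proof (rule between_unique[OF assms(2,3)])
  show "d u (act g m) + d (act g m) v = d u v" "d u (act g m) = d u m"
    using dist_act[OF assms(1,2,4)] dist_act[OF assms(1,4,3)] assms by simp_all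
qed (use assms act_closed in auto)

text \<open>The geodesics from the fixed vertex \<open>q\<close> to \<open>p\<close> and to
  \<open>act h p\<close> pass through \<open>m\<close>. Both \<open>m\<close> and
  \<open>act h m\<close> therefore lie on the second one, at the same distance from
  \<open>q\<close>.\<close>

lemma midpoint_fixed:
  assumes h: "h \<in> carrier G" and V: "q \<in> V" "p \<in> V" "m \<in> V" and "act h q = q"
    and m: "d p m = d m (act h p)" "d p m + d m (act h p) = d p (act h p)"
  shows "act h m = m"
proof -
  let ?p = "act h p"
  have V': "?p \<in> V" "act h m \<in> V" using act_closed h V by auto
  have qp: "d q ?p = d q p" using dist_act[OF h V(1,2)] assms by simp
  have "d q m + d m p = d q p"
    using four_point[OF V(1,3,2) V'(1)] dist_triangle[OF V(1,3,2)] dist_sym[OF V(2,3)] m qp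
    by linarith
  moreover have "d q (act h m) = d q m" "d (act h m) ?p = d m p"
    using dist_act[OF h V(1,3)] dist_act[OF h V(3,2)] assms by simp_all
  ultimately show ?thesis
    using between_unique[OF V(1) V'(1,2) V(3)] m qp dist_sym[OF V(2,3)] by simp
qed

text \<open>Since \<open>g\<close> and \<open>h\<close> commute, \<open>g\<close> fixes both
  \<open>u\<close> and \<open>act h u\<close>, hence their midpoint, which the elliptic element
  \<open>h\<close> fixes as well.\<close>

lemma commuting_fixed:
  assumes g: "g \<in> carrier G" and h: "h \<in> carrier G" and gh: "g \<otimes> h = h \<otimes> g"
    and V: "u \<in> V" "q \<in> V" and "act g u = u" "act h q = q"
  obtains v where "v \<in> V" "act g v = v" "act h v = v"
proof -
  have hu: "act h u \<in> V" using act_closed h V by auto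
  have "act g (act h u) = act h u"
    using act_mult[OF g h V(1)] act_mult[OF h g V(1)] gh assms by simp
  moreover obtain k where k: "d u (act h u) = 2 * k"
    using even_displacement[OF h V(1)] by blast
  obtain m where m: "m \<in> V" "d u m = k" "k + d m (act h u) = d u (act h u)"
    using geodesic[OF V(1) hu, of k] k by auto
  ultimately have "act g m = m"
    using fixed_between[OF g V(1) hu m(1)] assms by simp
  moreover have "act h m = m"
    using midpoint_fixed[OF h V(2,1) m(1)] m k assms by simp
  ultimately show thesis using that m by blast
qed

text \<open>The median of the three pairwise common vertices lies on a geodesic inside each of the
  three fixed subtrees.\<close>

lemma helly:
  assumes G: "a \<in> carrier G" "b \<in> carrier G" "c \<in> carrier G" and V: "u \<in> V" "v \<in> V" "w \<in> V"
    and "act a u = u" "act b u = u" "act b v = v" "act c v = v" "act a w = w" "act c w = w"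
  obtains m where "m \<in> V" "act a m = m" "act b m = m" "act c m = m"
proof -
  obtain m where m: "m \<in> V" "d u m + d m v = d u v" "d v m + d m w = d v w" "d u m + d m w = d u w"
    using median[OF V] by blast
  then show thesis
    using that[of m] fixed_between[OF G(1) V(1,3) m(1)] fixed_between[OF G(2) V(1,2) m(1)]
      fixed_between[OF G(3) V(2,3) m(1)] assms by simp
qed

text \<open>\<open>u\<close> and \<open>w\<close> are the ends of a segment inside the fixed tree of
  \<open>a\<^sub>2\<close>, leading from the fixed tree of \<open>a\<^sub>1\<close> to that of
  \<open>a\<^sub>3\<close>. It lies on the geodesic from \<open>p\<close> to \<open>q\<close>, which
  is covered by the fixed trees of \<open>a\<^sub>5\<close> and \<open>a\<^sub>4\<close>. As neither
  may share an edge with the fixed tree of \<open>a\<^sub>2\<close>, the segment is a point.\<close>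

lemma pentagon_diagonal:
  assumes G: "a\<^sub>1 \<in> carrier G" "a\<^sub>2 \<in> carrier G" "a\<^sub>3 \<in> carrier G" "a\<^sub>4 \<in> carrier G" "a\<^sub>5 \<in> carrier G"
    and V: "x \<in> V" "y \<in> V" "q \<in> V" "r \<in> V" "p \<in> V"
    and x: "act a\<^sub>1 x = x" "act a\<^sub>2 x = x" and y: "act a\<^sub>2 y = y" "act a\<^sub>3 y = y"
    and q: "act a\<^sub>3 q = q" "act a\<^sub>4 q = q" and r: "act a\<^sub>4 r = r" "act a\<^sub>5 r = r"
    and p: "act a\<^sub>5 p = p" "act a\<^sub>1 p = p"
    and free: "free_pair G a\<^sub>2 a\<^sub>5" "free_pair G a\<^sub>2 a\<^sub>4"
  obtains v where "v \<in> V" "act a\<^sub>1 v = v" "act a\<^sub>3 v = v"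
proof -
  obtain u where u: "u \<in> V" "d x u + d u p = d x p" "d p u + d u y = d p y" "d x u + d u y = d x y"
    using median[OF V(1,5,2)] by blast
  obtain w where w: "w \<in> V" "d y w + d w q = d y q" "d q w + d w u = d q u" "d y w + d w u = d y u"
    using median[OF V(2,3) u(1)] by blast
  have fixed: "act a\<^sub>1 u = u" "act a\<^sub>2 u = u" "act a\<^sub>2 w = w" "act a\<^sub>3 w = w"
    using fixed_between[OF G(1) V(1,5) u(1)] fixed_between[OF G(2) V(1,2) u(1)]
      fixed_between[OF G(2) V(2) u(1) w(1)] fixed_between[OF G(3) V(2,3) w(1)] x y q p u w by blast+
  have "u = w"
  proof (rule ccontr)
    assume "u \<noteq> w"
    note sym = dist_sym[OF V(2) w(1)] dist_sym[OF V(2) u(1)] dist_sym[OF V(3) w(1)]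
      dist_sym[OF V(3) u(1)] dist_sym[OF u(1) w(1)] dist_sym[OF V(5) u(1)] dist_sym[OF V(5) w(1)]
      dist_sym[OF V(5,3)]
    have pw: "d p u + d u w = d p w"
      using dist_triangle[OF V(5) w(1) V(2)] dist_triangle[OF V(5) u(1) w(1)] u w sym by linarith
    then have pq: "d p q = d p u + d u w + d w q"
      using between_concat[OF V(5) u(1) w(1) V(3)] w sym \<open>u \<noteq> w\<close> by simp
    have uq: "d p u + d u q = d p q" and wq: "d p w + d w q = d p q"
      using pq pw w sym by linarith+
    \<comment> \<open>The route from \<open>p\<close> to \<open>q\<close> through \<open>r\<close>
      leaves the geodesic at \<open>m\<close>: up to \<open>m\<close> the geodesic is fixed by
      \<open>a\<^sub>5\<close>, from \<open>m\<close> on by \<open>a\<^sub>4\<close>.\<close>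
    obtain m where m: "m \<in> V" "d p m + d m q = d p q" "d q m + d m r = d q r" "d p m + d m r = d p r"
      using median[OF V(5,3,4)] by blast
    have m45: "act a\<^sub>4 m = m" "act a\<^sub>5 m = m"
      using fixed_between[OF G(4) V(3,4) m(1)] fixed_between[OF G(5) V(5,4) m(1)] m p q r by blast+
    note sym' = dist_sym[OF V(3) m(1)] dist_sym[OF V(5) m(1)] dist_sym[OF w(1) m(1)]
    have fix5: "act a\<^sub>5 z = z" if "z \<in> V" "d p z + d z q = d p q" "d p z \<le> d p m" for z
      using between_order[OF V(5,3) that(1) m(1)] that m m45 p
        fixed_between[OF G(5) V(5) m(1) that(1)] by blast
    have fix4: "act a\<^sub>4 z = z" if z: "z \<in> V" "d p z + d z q = d p q" "d p z \<ge> d p m" for z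
    proof -
      have "d m z + d z q = d m q"
        using between_order[OF V(5,3) m(1) z(1)] z m by linarith
      then show ?thesis using m45 q fixed_between[OF G(4) m(1) V(3) z(1)] by blast
    qed
    \<comment> \<open>Depending on the position of \<open>m\<close>, the segment from
      \<open>u\<close> to \<open>w\<close> is fixed by \<open>a\<^sub>5\<close>, is fixed by
      \<open>a\<^sub>4\<close>, or has the proper initial part from \<open>u\<close> to
      \<open>m\<close> fixed by \<open>a\<^sub>5\<close>.\<close>
    consider "d p w \<le> d p m" | "d p m \<le> d p u" | "d p u < d p m" "d p m < d p w"
      by linarith
    then show False
    proof cases
      case 1
      then have "act a\<^sub>5 u = u" "act a\<^sub>5 w = w"
        using fix5[OF u(1) uq] fix5[OF w(1) wq] pw by linarith+
      then show False using fixed_unique[OF free(1) u(1) w(1)] fixed \<open>u \<noteq> w\<close> by blast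
    next
      case 2
      then have "act a\<^sub>4 u = u" "act a\<^sub>4 w = w"
        using fix4[OF u(1) uq] fix4[OF w(1) wq] pw by linarith+
      then show False using fixed_unique[OF free(2) u(1) w(1)] fixed \<open>u \<noteq> w\<close> by blast
    next
      case 3
      have "d u m + d m w = d u w"
        using between_order[OF V(5,3) u(1) m(1)] between_order[OF V(5,3) m(1) w(1)] 3 uq wq m pw
        by linarith
      then have "act a\<^sub>2 m = m" using fixed_between[OF G(2) u(1) w(1) m(1)] fixed by blast
      moreover have "act a\<^sub>5 u = u" using fix5[OF u(1) uq] 3 by linarith
      ultimately have "u = m" using fixed_unique[OF free(1) u(1) m(1)] fixed m45 by blast
      then show False using 3 by blast
    qed
  qed
  then show thesis using that fixed u by blast
qed

text \<open>Rotating \<open>pentagon_diagonal\<close> gives common vertices for the non-adjacent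
  pairs. In a triple such as \<open>a\<^sub>1\<close>, \<open>a\<^sub>3\<close>,
  \<open>a\<^sub>4\<close> the fixed trees now meet pairwise, hence all at once, and each free pair
  in the triple has only one fixed vertex; so the vertices of its diagonals coincide.\<close>

lemma pentagon_fixed:
  assumes G: "a\<^sub>1 \<in> carrier G" "a\<^sub>2 \<in> carrier G" "a\<^sub>3 \<in> carrier G" "a\<^sub>4 \<in> carrier G" "a\<^sub>5 \<in> carrier G"
    and comm: "a\<^sub>1 \<otimes> a\<^sub>2 = a\<^sub>2 \<otimes> a\<^sub>1" "a\<^sub>2 \<otimes> a\<^sub>3 = a\<^sub>3 \<otimes> a\<^sub>2" "a\<^sub>3 \<otimes> a\<^sub>4 = a\<^sub>4 \<otimes> a\<^sub>3"
      "a\<^sub>4 \<otimes> a\<^sub>5 = a\<^sub>5 \<otimes> a\<^sub>4" "a\<^sub>5 \<otimes> a\<^sub>1 = a\<^sub>1 \<otimes> a\<^sub>5"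
    and free: "free_pair G a\<^sub>1 a\<^sub>3" "free_pair G a\<^sub>1 a\<^sub>4" "free_pair G a\<^sub>2 a\<^sub>4" "free_pair G a\<^sub>2 a\<^sub>5"
      "free_pair G a\<^sub>3 a\<^sub>5"
    and elliptic: "\<And>a. a \<in> {a\<^sub>1, a\<^sub>2, a\<^sub>3, a\<^sub>4, a\<^sub>5} \<Longrightarrow> \<exists>v\<in>V. act a v = v"
  obtains v where "v \<in> V" "act a\<^sub>1 v = v" "act a\<^sub>2 v = v" "act a\<^sub>3 v = v" "act a\<^sub>4 v = v" "act a\<^sub>5 v = v"
proof -
  have pair: "\<exists>v\<in>V. act a v = v \<and> act b v = v"
    if ab: "a \<in> {a\<^sub>1, a\<^sub>2, a\<^sub>3, a\<^sub>4, a\<^sub>5}" "b \<in> {a\<^sub>1, a\<^sub>2, a\<^sub>3, a\<^sub>4, a\<^sub>5}" "a \<otimes> b = b \<otimes> a" for a b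
  proof -
    obtain u v where "u \<in> V" "act a u = u" "v \<in> V" "act b v = v"
      using elliptic[OF ab(1)] elliptic[OF ab(2)] by blast
    moreover have "a \<in> carrier G" "b \<in> carrier G" using ab(1,2) G by auto
    ultimately show ?thesis using commuting_fixed[of a b u v] ab(3) by blast
  qed
  obtain v\<^sub>12 where v12: "v\<^sub>12 \<in> V" "act a\<^sub>1 v\<^sub>12 = v\<^sub>12" "act a\<^sub>2 v\<^sub>12 = v\<^sub>12"
    using pair[OF _ _ comm(1)] by auto
  obtain v\<^sub>23 where v23: "v\<^sub>23 \<in> V" "act a\<^sub>2 v\<^sub>23 = v\<^sub>23" "act a\<^sub>3 v\<^sub>23 = v\<^sub>23"
    using pair[OF _ _ comm(2)] by auto
  obtain v\<^sub>34 where v34: "v\<^sub>34 \<in> V" "act a\<^sub>3 v\<^sub>34 = v\<^sub>34" "act a\<^sub>4 v\<^sub>34 = v\<^sub>34"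
    using pair[OF _ _ comm(3)] by auto
  obtain v\<^sub>45 where v45: "v\<^sub>45 \<in> V" "act a\<^sub>4 v\<^sub>45 = v\<^sub>45" "act a\<^sub>5 v\<^sub>45 = v\<^sub>45"
    using pair[OF _ _ comm(4)] by auto
  obtain v\<^sub>51 where v51: "v\<^sub>51 \<in> V" "act a\<^sub>5 v\<^sub>51 = v\<^sub>51" "act a\<^sub>1 v\<^sub>51 = v\<^sub>51"
    using pair[OF _ _ comm(5)] by auto
  note free' = free[THEN free_pair_swap]
  obtain v\<^sub>13 where v13: "v\<^sub>13 \<in> V" "act a\<^sub>1 v\<^sub>13 = v\<^sub>13" "act a\<^sub>3 v\<^sub>13 = v\<^sub>13"
    using pentagon_diagonal[OF G v12(1) v23(1) v34(1) v45(1) v51(1) v12(2,3) v23(2,3) v34(2,3)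
        v45(2,3) v51(2,3) free(4,3)] by blast
  obtain v\<^sub>24 where v24: "v\<^sub>24 \<in> V" "act a\<^sub>2 v\<^sub>24 = v\<^sub>24" "act a\<^sub>4 v\<^sub>24 = v\<^sub>24"
    using pentagon_diagonal[OF G(2,3,4,5,1) v23(1) v34(1) v45(1) v51(1) v12(1) v23(2,3) v34(2,3)
        v45(2,3) v51(2,3) v12(2,3) free'(1) free(5)] by blast
  obtain v\<^sub>35 where v35: "v\<^sub>35 \<in> V" "act a\<^sub>3 v\<^sub>35 = v\<^sub>35" "act a\<^sub>5 v\<^sub>35 = v\<^sub>35"
    using pentagon_diagonal[OF G(3,4,5,1,2) v34(1) v45(1) v51(1) v12(1) v23(1) v34(2,3) v45(2,3)
        v51(2,3) v12(2,3) v23(2,3) free'(3,2)] by blast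
  obtain v\<^sub>14 where v14: "v\<^sub>14 \<in> V" "act a\<^sub>4 v\<^sub>14 = v\<^sub>14" "act a\<^sub>1 v\<^sub>14 = v\<^sub>14"
    using pentagon_diagonal[OF G(4,5,1,2,3) v45(1) v51(1) v12(1) v23(1) v34(1) v45(2,3) v51(2,3)
        v12(2,3) v23(2,3) v34(2,3) free'(5,4)] by blast
  obtain v\<^sub>25 where v25: "v\<^sub>25 \<in> V" "act a\<^sub>5 v\<^sub>25 = v\<^sub>25" "act a\<^sub>2 v\<^sub>25 = v\<^sub>25"
    using pentagon_diagonal[OF G(5,1,2,3,4) v51(1) v12(1) v23(1) v34(1) v45(1) v51(2,3) v12(2,3)
        v23(2,3) v34(2,3) v45(2,3) free(2,1)] by blast
  have "v\<^sub>13 = v\<^sub>14"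
    using helly[OF G(1,3,4) v13(1) v34(1) v14(1) v13(2,3) v34(2,3) v14(3,2)]
      fixed_unique[OF free(1) v13(1)] fixed_unique[OF free(2) v14(1)] v13 v14 by metis
  moreover have "v\<^sub>14 = v\<^sub>24"
    using helly[OF G(1,2,4) v12(1) v24(1) v14(1) v12(2,3) v24(2,3) v14(3,2)]
      fixed_unique[OF free(2) v14(1)] fixed_unique[OF free(3) v24(1)] v14 v24 by metis
  moreover have "v\<^sub>24 = v\<^sub>25"
    using helly[OF G(2,4,5) v24(1) v45(1) v25(1) v24(2,3) v45(2,3) v25(3,2)]
      fixed_unique[OF free(3) v24(1)] fixed_unique[OF free(4) v25(1)] v24 v25 by metis
  ultimately show thesis using that[of v\<^sub>13] v13 v14 v24 v25 by simp
qed

end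

section \<open>Hyperbolic elements\<close>

text \<open>Only the forward half of the axis is recorded, as the orbit of \<open>v\<close> under
  natural powers of \<open>g\<close>. It determines the attracting end, from which the Busemann
  function is defined.\<close>

locale tree_axis = tree_action G V d act
  for G (structure) and V :: "'v set" and d and act :: "'a \<Rightarrow> 'v \<Rightarrow> 'v" +
  fixes g :: 'a and v :: 'v and L :: nat
  assumes g: "g \<in> carrier G" and v: "v \<in> V" and L: "L > 0"
    and axis: "\<And>k::nat. d v (act (g [^] k) v) = k * L"
begin

definition orbit :: "nat \<Rightarrow> 'v" where
  "orbit k = act (g [^] k) v"

definition centralizer :: "'a set" where
  "centralizer = {h \<in> carrier G. g \<otimes> h = h \<otimes> g}"

text \<open>The Busemann function of the attracting end of \<open>g\<close>: the difference of the
  distances to a far point of the orbit. In a tree it is eventually constant, and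
  \<open>SOME\<close> picks the eventual value.\<close>

definition busemann :: "'v \<Rightarrow> 'v \<Rightarrow> int" where
  "busemann p q = (SOME c. \<forall>\<^sub>F k in sequentially. int (d p (orbit k)) - int (d q (orbit k)) = c)"

lemma orbit_in [simp]: "orbit k \<in> V"
  unfolding orbit_def using act_closed g v by simp

lemma dist_orbit_ge: "p \<in> V \<Longrightarrow> k \<le> d v p + d p (orbit k)"
  using dist_triangle[OF v _ orbit_in[of k], of p] axis[of k] L unfolding orbit_def
  by (metis Suc_leI le_trans mult.right_neutral mult_le_mono2 One_nat_def)

lemma orbit_add: "act (g [^] j) (orbit k) = orbit (j + k)"
  unfolding orbit_def using act_mult[of "g [^] j" "g [^] k" v] g v by (simp add: nat_pow_mult)

lemma dist_orbit: "d (orbit j) (orbit (j + k)) = k * L"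
  using dist_act[of "g [^] j" v "orbit k"] g v axis[of k] orbit_in[of k]
  unfolding orbit_add[symmetric] by (simp add: orbit_def)

lemma busemann_ex:
  assumes p: "p \<in> V" and q: "q \<in> V"
  shows "\<exists>c. \<forall>\<^sub>F k in sequentially. int (d p (orbit k)) - int (d q (orbit k)) = c"
proof -
  \<comment> \<open>Beyond \<open>N\<close> the distance from \<open>p\<close> to the orbit point
    exceeds \<open>d p q + L\<close>, the strict inequality that \<open>far_differences_eq\<close>
    asks for when passing to the next orbit point.\<close>
  define N where "N = d p q + L + d v p + 1"
  let ?f = "\<lambda>k. int (d p (orbit k)) - int (d q (orbit k))"
  have "?f k = ?f N" if "k \<ge> N" for k
    using that
  proof (induction k rule: nat_induct_at_least)
    case (Suc k)
    have "d p q + d (orbit k) (orbit (Suc k)) < d p (orbit k) + d q (orbit (Suc k))"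
      using dist_orbit_ge[OF p, of k] dist_orbit[of k 1] Suc.hyps unfolding N_def by simp
    then have "d p (orbit k) + d q (orbit (Suc k)) = d p (orbit (Suc k)) + d q (orbit k)"
      by (rule far_differences_eq[OF p q orbit_in orbit_in])
    then show ?case using Suc.IH by linarith
  qed simp
  then show ?thesis
    by (auto simp: eventually_sequentially)
qed

lemma busemann:
  assumes "p \<in> V" "q \<in> V"
  shows "\<forall>\<^sub>F k in sequentially. int (d p (orbit k)) - int (d q (orbit k)) = busemann p q"
  unfolding busemann_def by (rule someI_ex[OF busemann_ex[OF assms]])

lemma busemann_eqI:
  assumes "p \<in> V" "q \<in> V" "\<forall>\<^sub>F k in sequentially. int (d p (orbit k)) - int (d q (orbit k)) = c"
  shows "busemann p q = c"
proof -
  have "\<forall>\<^sub>F k in sequentially. busemann p q = c"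
    using busemann[OF assms(1,2)] assms(3) by eventually_elim simp
  then show ?thesis by simp
qed

lemma busemann_add:
  assumes "p \<in> V" "q \<in> V" "r \<in> V"
  shows "busemann p r = busemann p q + busemann q r"
proof (rule busemann_eqI[OF assms(1,3)])
  show "\<forall>\<^sub>F k in sequentially.
      int (d p (orbit k)) - int (d r (orbit k)) = busemann p q + busemann q r"
    using busemann[OF assms(1,2)] busemann[OF assms(2,3)] by eventually_elim simp
qed

lemma centralizer_orbit:
  assumes "h \<in> centralizer"
  shows "act h (orbit k) = act (g [^] k) (act h v)"
proof -
  have h: "h \<in> carrier G" "g [^] k \<otimes> h = h \<otimes> g [^] k"
    using assms g by (auto simp: centralizer_def group_commutes_pow)
  then show ?thesis
    unfolding orbit_def using act_mult[of h "g [^] k" v] act_mult[of "g [^] k" h v] g v by simp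
qed

lemma busemann_act:
  assumes h: "h \<in> centralizer" and p: "p \<in> V" and q: "q \<in> V"
  shows "busemann (act h p) (act h q) = busemann p q"
proof (rule busemann_eqI)
  have hG: "h \<in> carrier G" using h by (auto simp: centralizer_def)
  then show "act h p \<in> V" "act h q \<in> V" using act_closed p q by auto
  have hv: "act h v \<in> V" using act_closed hG v by simp
  have "\<forall>\<^sub>F k in sequentially. k > d p q + d v (act h v) + d v p"
    by (rule eventually_gt_at_top)
  then show "\<forall>\<^sub>F k in sequentially.
      int (d (act h p) (orbit k)) - int (d (act h q) (orbit k)) = busemann p q"
    using busemann[OF p q]
  proof eventually_elim
    case (elim k)
    \<comment> \<open>The preimage of the orbit point under \<open>h\<close> stays within the
      constant distance \<open>d v (act h v)\<close> of that point, because \<open>h\<close>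
      commutes with \<open>g\<close>. Seen from \<open>p\<close> and \<open>q\<close>, the two are
      therefore interchangeable.\<close>
    define y where "y = act (inv h) (orbit k)"
    have y: "y \<in> V" "act h y = orbit k"
      unfolding y_def using act_closed hG act_mult[of h "inv h" "orbit k"] act_one by auto
    have eq: "d (act h z) (orbit k) = d z y" if "z \<in> V" for z
      using dist_act[OF hG that y(1)] y(2) by simp
    have "d (orbit k) y = d (act h (orbit k)) (orbit k)"
      using eq[of "orbit k"] by simp
    also have "\<dots> = d (act h v) v"
      unfolding centralizer_orbit[OF h] unfolding orbit_def using dist_act g hv v by simp
    finally have "d p q + d (orbit k) y < d p (orbit k) + d q y"
      using elim(1) dist_orbit_ge[OF p, of k] dist_sym[OF hv v] by linarith
    then have "d p (orbit k) + d q y = d p y + d q (orbit k)"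
      by (rule far_differences_eq[OF p q orbit_in y(1)])
    then show ?case using elim(2) eq[OF p] eq[OF q] by linarith
  qed
qed

text \<open>The signed amount by which \<open>h\<close> moves towards the attracting end, negative
  in the direction of \<open>g\<close>; on the centralizer it is a homomorphism to the
  integers.\<close>

definition translation :: "'a \<Rightarrow> int" where
  "translation h = busemann (act h v) v"

lemma translation_mult:
  assumes "h \<in> centralizer" "k \<in> centralizer"
  shows "translation (h \<otimes> k) = translation h + translation k"
proof -
  have hk: "h \<in> carrier G" "k \<in> carrier G" using assms by (auto simp: centralizer_def)
  then show ?thesis
    unfolding translation_def
    using busemann_add[of "act h (act k v)" "act h v" v] busemann_act[OF assms(1), of "act k v" v]
      act_mult[of h k v] act_closed v by simp
qed

lemma subgroup_centralizer: "subgroup centralizer G"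
proof
  show "h \<otimes> k \<in> centralizer" if "h \<in> centralizer" "k \<in> centralizer" for h k
    using that g unfolding centralizer_def by (auto simp: m_assoc) (metis m_assoc)
  show "inv h \<in> centralizer" if "h \<in> centralizer" for h
    using that g unfolding centralizer_def by (auto simp: inv_solve_left inv_solve_right m_assoc)
      (metis inv_closed inv_solve_left' inv_solve_right m_assoc m_closed)
qed (use g in \<open>auto simp: centralizer_def\<close>)

lemma translation_inv:
  assumes "h \<in> centralizer"
  shows "translation (inv h) = - translation h"
proof -
  interpret subgroup centralizer G by (rule subgroup_centralizer)
  have "translation \<one> = 0"
    using translation_mult[of \<one> \<one>] by simp
  then show ?thesis
    using translation_mult[OF assms m_inv_closed[OF assms]] assms by simp
qed

lemma fixed_if_translation_zero:
  assumes h: "h \<in> centralizer" and "translation h = 0"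
  shows "act h v = v"
proof -
  have hG: "h \<in> carrier G" using h by (auto simp: centralizer_def)
  define w where "w = act h v"
  have w: "w \<in> V" using act_closed hG v by (simp add: w_def)
  have "\<forall>\<^sub>F k in sequentially. int (d w (orbit k)) - int (d v (orbit k)) = 0"
    using busemann[OF w v] assms(2) by (simp add: translation_def w_def)
  then obtain M where M: "\<And>k. k \<ge> M \<Longrightarrow> d w (orbit k) = d v (orbit k)"
    by (auto simp: eventually_sequentially)
  \<comment> \<open>The rays from \<open>v\<close> and \<open>w\<close> to the same end start at the
    same level, so they have merged after \<open>d v w\<close> steps. Since \<open>L\<close> is
    positive, \<open>j\<close> orbit steps suffice: \<open>?P\<close> and \<open>?Q\<close> will
    coincide, and applying the inverse of \<open>g [^] j\<close> gives \<open>v = w\<close>.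
    \<open>M\<close> makes the distances to \<open>?o\<close> agree.\<close>
  define j where "j = d v w"
  let ?P = "orbit j" and ?Q = "act h (orbit j)" and ?o = "orbit (j + M)"
  have Q: "?Q \<in> V" "?Q = act (g [^] j) w"
    by (rule act_closed[OF hG orbit_in]) (simp add: centralizer_orbit[OF h] w_def)
  have eqs: "d v ?P = j * L" "d v ?o = (j + M) * L" "d ?P ?o = M * L"
    using axis by (simp_all add: dist_orbit) (simp_all add: orbit_def)
  have wo: "d w ?o = (j + M) * L"
    using M[of "j + M"] eqs by simp
  have wQ: "d w ?Q = j * L"
    using dist_act[OF hG v orbit_in[of j]] eqs by (simp add: w_def)
  have "d ?Q ?o = d w (orbit M)"
    unfolding Q(2) orbit_add[symmetric] using dist_act w g by simp
  then have Qo: "d ?Q ?o = M * L"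
    using M[of M] axis[of M] by (simp add: orbit_def)
  have "d v w \<le> j * L" using L by (simp add: j_def)
  moreover have "(j + M) * L = j * L + M * L" by (simp add: algebra_simps)
  ultimately have "d ?P w \<le> j * L"
    using four_point[OF orbit_in w v orbit_in, of j "j + M"] eqs wo
      dist_sym[OF orbit_in v, of j] dist_sym[OF w v] by linarith
  then have "d ?P ?Q = 0"
    using four_point[OF orbit_in Q(1) w orbit_in, of j "j + M"] eqs wo wQ Qo dist_sym[OF w Q(1)]
      \<open>(j + M) * L = j * L + M * L\<close> by linarith
  then have "act (g [^] j) v = act (g [^] j) w"
    using dist_zero_iff[OF orbit_in Q(1)] Q(2) by (simp add: orbit_def)
  then show ?thesis
    using act_inj[of "g [^] j" v w] g v w by (simp add: w_def)
qed

text \<open>Commutators have translation 0, so the free pair of commutators fixes \<open>v\<close>.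
  Commuting with \<open>g\<close>, it also fixes the next orbit vertex, against
  \<open>fixed_unique\<close>.\<close>

lemma no_free_pair_centralizer:
  assumes "x \<in> centralizer" "y \<in> centralizer"
  shows "\<not> free_pair G x y"
proof
  assume "free_pair G x y"
  then have free: "free_pair G (x \<otimes> y \<otimes> inv x \<otimes> inv y) (inv x \<otimes> inv y \<otimes> x \<otimes> y)"
    by (rule free_pair_commutators)
  interpret C: subgroup centralizer G by (rule subgroup_centralizer)
  have fix_v: "act h v = v" and fix_gv: "act h (orbit 1) = orbit 1"
    if "h \<in> centralizer" "translation h = 0" for h
    using fixed_if_translation_zero[OF that] centralizer_orbit[OF that(1), of 1]
    by (simp_all add: orbit_def)
  have "x \<otimes> y \<otimes> inv x \<otimes> inv y \<in> centralizer" "translation (x \<otimes> y \<otimes> inv x \<otimes> inv y) = 0"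
    "inv x \<otimes> inv y \<otimes> x \<otimes> y \<in> centralizer" "translation (inv x \<otimes> inv y \<otimes> x \<otimes> y) = 0"
    using assms by (simp_all add: translation_mult translation_inv)
  then have "v = orbit 1"
    using fixed_unique[OF free v orbit_in[of 1]] fix_v fix_gv by blast
  moreover have "d v (orbit 1) > 0"
    using axis[of 1] L by (simp add: orbit_def)
  ultimately show False using v by simp
qed

end

context tree_action
begin

text \<open>Take a vertex \<open>v\<close> of least displacement \<open>L\<close>; by parity
  \<open>L\<close> is at least 2. Minimality prevents the path through \<open>v\<close>,
  \<open>act g v\<close> and its next image from turning back, and \<open>between_concat\<close>
  makes the local geodesic global.\<close>

lemma axis_exists:
  assumes g: "g \<in> carrier G" and hyp: "\<And>v. v \<in> V \<Longrightarrow> act g v \<noteq> v"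
  obtains v L where "v \<in> V" "L > 0" "\<And>k::nat. d v (act (g [^] k) v) = k * L"
proof -
  obtain v\<^sub>0 where "v\<^sub>0 \<in> V" using V_nonempty by blast
  then obtain v where v: "v \<in> V" and min: "\<And>w. w \<in> V \<Longrightarrow> d v (act g v) \<le> d w (act g w)"
    using ex_has_least_nat[of "\<lambda>v. v \<in> V" v\<^sub>0 "\<lambda>v. d v (act g v)"] by blast
  define L where "L = d v (act g v)"
  define b where "b = act g v"
  define c where "c = act g b"
  have V: "b \<in> V" "c \<in> V" using act_closed g v by (auto simp: b_def c_def)
  have "L \<noteq> 0" using hyp[OF v] dist_zero_iff[OF v V(1)] by (simp add: L_def b_def)
  then have L2: "L \<ge> 2" using even_displacement[OF g v] L_def by (cases "L = 1") auto
  have vb: "d v b = L" and bc: "d b c = L"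
    using dist_act[OF g v V(1)] by (simp_all add: L_def b_def c_def)
  have vc: "d v c = 2 * L"
  proof (rule ccontr)
    assume neq: "d v c \<noteq> 2 * L"
    obtain m where m: "m \<in> V" "d v m + d m b = d v b" "d b m + d m c = d b c" "d v m + d m c = d v c"
      using median[OF v V] by blast
    have mb: "d b m = d m b" using dist_sym V m by blast
    then have m1: "d b m \<ge> 1" using neq m vb bc by linarith
    \<comment> \<open>\<open>z\<close> follows \<open>v\<close> and \<open>y\<close> precedes
      \<open>b\<close> on the geodesic from \<open>v\<close> to \<open>b\<close>. If the path turns
      back at \<open>b\<close>, it leaves \<open>b\<close> through \<open>y\<close>; it also leaves
      through \<open>act g z\<close>. Then \<open>g\<close> moves \<open>z\<close> to
      \<open>y\<close>, a distance of only \<open>L - 2\<close>.\<close>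
    obtain z where z: "z \<in> V" "d v z = 1" "1 + d z b = d v b"
      using geodesic[OF v V(1), of 1] L2 vb by auto
    obtain y where y: "y \<in> V" "d b y = 1" "1 + d y v = d b v"
      using geodesic[OF V(1) v, of 1] L2 vb dist_sym[OF v V(1)] by auto
    have gz: "act g z \<in> V" "d b (act g z) = 1" "d (act g z) c = L - 1"
      using act_closed[OF g z(1)] dist_act[OF g v z(1)] dist_act[OF g z(1) V(1)] z vb
      by (simp_all add: b_def c_def)
    have sym: "d b v = d v b" "d y v = d v y" "d y b = d b y" "d m v = d v m"
      using dist_sym v V y m by blast+
    have "d b y + d y m = d b m"
      using between_order[OF V(1) v y(1) m(1)] y m m1 mb sym by linarith
    then have "d b y + d y c = d b c"
      using m dist_triangle[OF V(1) y(1) V(2)] dist_triangle[OF y(1) m(1) V(2)] by linarith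
    then have "y = act g z"
      using between_unique[OF V(1,2) y(1) gz(1)] gz y bc L2 by simp
    moreover have "d v z + d z y = d v y"
      using between_order[OF v V(1) z(1) y(1)] z y sym vb L2 by linarith
    then have "d z y < L"
      using z y sym vb L2 by linarith
    ultimately show False using min[OF z(1)] L_def by simp
  qed
  let ?x = "\<lambda>k::nat. act (g [^] k) v"
  have x: "?x k \<in> V" for k using act_closed g v by simp
  have x_Suc: "?x (Suc k) = act (g [^] k) b" "?x (Suc (Suc k)) = act (g [^] k) c" for k
    using act_mult g v V by (simp_all add: b_def c_def nat_pow_Suc m_assoc)
  have "d v (?x k) = k * L \<and> d v (?x (Suc k)) = Suc k * L" for k
  proof (induction k)
    case 0
    then show ?case using vb act_one v g by (simp add: b_def)
  next
    case (Suc k)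
    have "d (?x k) (?x (Suc k)) = L" "d (?x (Suc k)) (?x (Suc (Suc k))) = L"
      "d (?x k) (?x (Suc (Suc k))) = 2 * L"
      unfolding x_Suc[of k]
      using dist_act[of "g [^] k"] g v V vb bc vc by simp_all
    moreover from this have "?x k \<noteq> ?x (Suc k)" using L2 x[of k] by auto
    ultimately show ?case
      using between_concat[OF v x[of k] x[of "Suc k"] x[of "Suc (Suc k)"]] Suc.IH by simp
  qed
  then show thesis using that[of v L] v L2 by simp
qed

lemma elliptic_if_free_centralizer:
  assumes "g \<in> carrier G" "free_pair G x y" "g \<otimes> x = x \<otimes> g" "g \<otimes> y = y \<otimes> g"
  shows "\<exists>v\<in>V. act g v = v"
proof (rule ccontr)
  assume "\<not> ?thesis"
  then obtain v L where "v \<in> V" "L > 0" "\<And>k::nat. d v (act (g [^] k) v) = k * L"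
    using axis_exists[OF assms(1)] by metis
  then interpret tree_axis G V d act g v L
    by unfold_locales (use assms in auto)
  have "x \<in> centralizer" "y \<in> centralizer"
    using assms by (auto simp: centralizer_def free_pair_def)
  then show False using no_free_pair_centralizer assms by blast
qed

end

section \<open>Cocycles from presentations\<close>

lemma presented_by_word_value:
  assumes "group G" "\<phi> \<in> iso (presented_group S R) G" "\<And>s. s \<in> S \<Longrightarrow> \<phi> (gen_class S R s) = f s"
    and "w \<in> words S"
  shows "\<phi> (word_class S R w) = word_value G f w"
proof -
  interpret group G by fact
  interpret P: group "presented_group S R" by (rule group_presented_group)
  interpret \<phi>: group_hom "presented_group S R" G \<phi>
    using assms(2) by (simp add: group_hom_def group_hom_axioms_def iso_def P.is_group)
  show ?thesis using assms(4)
  proof (induction w)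
    case Nil
    then show ?case using \<phi>.hom_one by (simp add: one_presented_group)
  next
    case (Cons a w)
    obtain s b where a: "a = (s, b)" by fastforce
    have s: "s \<in> S" "w \<in> words S" using Cons.prems a by auto
    have mem: "word_class S R v \<in> carrier (presented_group S R)" if "v \<in> words S" for v
      using that by (simp add: carrier_presented_group)
    have "word_class S R [neg s] \<otimes>\<^bsub>presented_group S R\<^esub> gen_class S R s = \<one>\<^bsub>presented_group S R\<^esub>"
      using s inv_word_left[of "[pos s]" S R]
      by (simp add: mult_word_class one_presented_group word_class_eq_iff inv_word_def)
    then have "word_class S R [neg s] = inv\<^bsub>presented_group S R\<^esub> gen_class S R s"
      using P.inv_equality mem s by (metis fst_conv words_Cons words_Nil)
    then have "\<phi> (word_class S R [a]) = (if b then f s else inv\<^bsub>G\<^esub> f s)"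
      using assms(3)[OF s(1)] mem[of "[pos s]"] s by (cases b) (simp_all add: a)
    moreover have "word_class S R (a # w) =
        word_class S R [a] \<otimes>\<^bsub>presented_group S R\<^esub> word_class S R w"
      using s mult_word_class[of "[a]" S w R] a by simp
    ultimately show ?case
      using Cons mem[of "[a]"] mem[of w] s a by simp
  qed
qed

lemma presented_by_extend:
  assumes "group G" "presented_by G f S R" "group M" "k \<in> S \<rightarrow> carrier M"
    and "\<And>l r. (l, r) \<in> R \<Longrightarrow> word_value M k l = word_value M k r"
  obtains \<psi> where "\<psi> \<in> hom G M" "\<And>s. s \<in> S \<Longrightarrow> \<psi> (f s) = k s"
proof -
  obtain \<phi> where \<phi>: "\<phi> \<in> iso (presented_group S R) G" "\<And>s. s \<in> S \<Longrightarrow> \<phi> (gen_class S R s) = f s"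
    using assms(2) by (auto simp: presented_by_def)
  obtain \<chi> where \<chi>: "\<chi> \<in> hom (presented_group S R) M"
    "\<And>w. w \<in> words S \<Longrightarrow> \<chi> (word_class S R w) = word_value M k w"
    using presented_group_universal[OF assms(3,4,5)] by blast
  let ?\<phi>' = "inv_into (carrier (presented_group S R)) \<phi>"
  have "?\<phi>' \<in> iso G (presented_group S R)"
    using group.iso_set_sym[OF group_presented_group \<phi>(1)] .
  then have "\<chi> \<circ> ?\<phi>' \<in> hom G M"
    using \<chi>(1) by (intro hom_compose) (auto simp: iso_def)
  moreover have "(\<chi> \<circ> ?\<phi>') (f s) = k s" if "s \<in> S" for s
  proof -
    have "?\<phi>' (\<phi> (gen_class S R s)) = gen_class S R s"
      using \<phi>(1) that by (intro inv_into_f_f) (auto simp: iso_def bij_betw_def carrier_presented_group)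
    then show ?thesis
      using \<phi>(2)[OF that] \<chi>(2)[of "[pos s]"] that assms(3,4)
      by (auto simp: Pi_iff group.is_monoid)
  qed
  ultimately show thesis using that by blast
qed

lemma presented_by_induct:
  assumes "group G" "presented_by G f S R" "f \<in> S \<rightarrow> carrier G" "x \<in> carrier G"
    and "Q \<one>\<^bsub>G\<^esub>"
    and "\<And>s y. \<lbrakk>s \<in> S; y \<in> carrier G; Q y\<rbrakk> \<Longrightarrow> Q (f s \<otimes>\<^bsub>G\<^esub> y) \<and> Q (inv\<^bsub>G\<^esub> f s \<otimes>\<^bsub>G\<^esub> y)"
  shows "Q x"
proof -
  interpret group G by fact
  obtain \<phi> where \<phi>: "\<phi> \<in> iso (presented_group S R) G" "\<And>s. s \<in> S \<Longrightarrow> \<phi> (gen_class S R s) = f s"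
    using assms(2) by (auto simp: presented_by_def)
  have "x \<in> \<phi> ` carrier (presented_group S R)"
    using \<phi>(1) assms(4) by (auto simp: iso_def bij_betw_def)
  then obtain w where w: "w \<in> words S" "x = word_value G f w"
    using presented_by_word_value[OF assms(1) \<phi>] by (auto simp: carrier_presented_group)
  have "Q (word_value G f w)" using w(1)
  proof (induction w)
    case (Cons a w)
    then show ?case
      using assms(6)[of "fst a" "word_value G f w"] word_value_closed[OF assms(3), of w] by simp
  qed (use assms(5) in simp)
  then show ?thesis using w by simp
qed

lemma presented_by_relation:
  assumes "group G" "presented_by G f S R" "(l, r) \<in> R" "l \<in> words S" "r \<in> words S"
  shows "word_value G f l = word_value G f r"
proof -
  obtain \<phi> where \<phi>: "\<phi> \<in> iso (presented_group S R) G" "\<And>s. s \<in> S \<Longrightarrow> \<phi> (gen_class S R s) = f s"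
    using assms(2) by (auto simp: presented_by_def)
  have "word_eq S R l r"
    using word_eq.rel[of "[]" S "[]" l r R] assms by simp
  then have "word_class S R l = word_class S R r"
    using word_class_eq_iff assms(4) by blast
  then show ?thesis
    using presented_by_word_value[OF assms(1) \<phi>] assms(4,5) by metis
qed

text \<open>The semidirect product of \<open>G\<close> with its subsets under symmetric difference: a homomorphism
  from \<open>G\<close> into it over the identity of \<open>G\<close> is a 1-cocycle with values in the subsets.\<close>

definition subset_semidirect :: "('g, 'm) monoid_scheme \<Rightarrow> ('g set \<times> 'g) monoid" where
  "subset_semidirect G = \<lparr>carrier = Pow (carrier G) \<times> carrier G,
     mult = (\<lambda>(D, g) (E, h). (sym_diff D (g <#\<^bsub>G\<^esub> E), g \<otimes>\<^bsub>G\<^esub> h)), one = ({}, \<one>\<^bsub>G\<^esub>)\<rparr>"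

context group
begin

lemma mem_l_coset_iff:
  assumes "D \<subseteq> carrier G" "g \<in> carrier G"
  shows "x \<in> g <# D \<longleftrightarrow> x \<in> carrier G \<and> inv g \<otimes> x \<in> D"
proof
  assume "x \<in> g <# D"
  then obtain y where "y \<in> D" "x = g \<otimes> y" by (auto simp: l_coset_def)
  then show "x \<in> carrier G \<and> inv g \<otimes> x \<in> D"
    using assms by (auto simp: m_assoc[symmetric])
next
  assume "x \<in> carrier G \<and> inv g \<otimes> x \<in> D"
  then show "x \<in> g <# D"
    using assms by (auto simp: l_coset_def m_assoc[symmetric] intro!: bexI[of _ "inv g \<otimes> x"])
qed

lemma l_coset_sym_diff:
  assumes "D \<subseteq> carrier G" "E \<subseteq> carrier G" "g \<in> carrier G"
  shows "g <# sym_diff D E = sym_diff (g <# D) (g <# E)"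
proof -
  have "sym_diff D E \<subseteq> carrier G" using assms by auto
  then show ?thesis
    using assms(3) mem_l_coset_iff[OF assms(1,3)] mem_l_coset_iff[OF assms(2,3)]
      mem_l_coset_iff[of "sym_diff D E" g] by blast
qed

lemma l_coset_empty [simp]: "g <# {} = {}"
  by (simp add: l_coset_def)

lemma mult_subset_semidirect:
  "(D, g) \<otimes>\<^bsub>subset_semidirect G\<^esub> (E, h) = (sym_diff D (g <# E), g \<otimes> h)"
  by (simp add: subset_semidirect_def)

lemma carrier_subset_semidirect: "carrier (subset_semidirect G) = Pow (carrier G) \<times> carrier G"
  by (simp add: subset_semidirect_def)

lemma one_subset_semidirect: "\<one>\<^bsub>subset_semidirect G\<^esub> = ({}, \<one>)"
  by (simp add: subset_semidirect_def)

lemma subset_semidirect_l_inv: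
  assumes "D \<subseteq> carrier G" "g \<in> carrier G"
  shows "(inv g <# D, inv g) \<otimes>\<^bsub>subset_semidirect G\<^esub> (D, g) = \<one>\<^bsub>subset_semidirect G\<^esub>"
  using assms by (simp add: mult_subset_semidirect one_subset_semidirect)

lemma group_subset_semidirect: "group (subset_semidirect G)"
proof (rule groupI)
  fix x y assume *: "x \<in> carrier (subset_semidirect G)" "y \<in> carrier (subset_semidirect G)"
  obtain D g E h where xy: "x = (D, g)" "y = (E, h)" by fastforce
  have "sym_diff D (g <# E) \<subseteq> carrier G"
    using * l_coset_subset_G[of E g] unfolding xy carrier_subset_semidirect by blast
  then show "x \<otimes>\<^bsub>subset_semidirect G\<^esub> y \<in> carrier (subset_semidirect G)"
    using * by (simp add: xy mult_subset_semidirect carrier_subset_semidirect)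
next
  fix x y z
  assume *: "x \<in> carrier (subset_semidirect G)" "y \<in> carrier (subset_semidirect G)"
    "z \<in> carrier (subset_semidirect G)"
  obtain D g E h F k where xyz: "x = (D, g)" "y = (E, h)" "z = (F, k)" by (cases x; cases y; cases z) blast
  then have c: "D \<subseteq> carrier G" "g \<in> carrier G" "E \<subseteq> carrier G" "h \<in> carrier G"
    "F \<subseteq> carrier G" "k \<in> carrier G"
    using * by (auto simp: subset_semidirect_def)
  have "g <# sym_diff E (h <# F) = sym_diff (g <# E) ((g \<otimes> h) <# F)"
    using l_coset_sym_diff[OF c(3) l_coset_subset_G[OF c(5,4)] c(2)] lcos_m_assoc[OF c(5,2,4)] by simp
  then show "x \<otimes>\<^bsub>subset_semidirect G\<^esub> y \<otimes>\<^bsub>subset_semidirect G\<^esub> z =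
      x \<otimes>\<^bsub>subset_semidirect G\<^esub> (y \<otimes>\<^bsub>subset_semidirect G\<^esub> z)"
    using c by (simp add: mult_subset_semidirect xyz m_assoc) blast
next
  fix x assume "x \<in> carrier (subset_semidirect G)"
  then show "\<one>\<^bsub>subset_semidirect G\<^esub> \<otimes>\<^bsub>subset_semidirect G\<^esub> x = x"
    by (auto simp: subset_semidirect_def lcos_mult_one)
next
  fix x assume "x \<in> carrier (subset_semidirect G)"
  then obtain D g where x: "x = (D, g)" "D \<subseteq> carrier G" "g \<in> carrier G"
    by (auto simp: subset_semidirect_def)
  then show "\<exists>y\<in>carrier (subset_semidirect G).
      y \<otimes>\<^bsub>subset_semidirect G\<^esub> x = \<one>\<^bsub>subset_semidirect G\<^esub>"
    using subset_semidirect_l_inv[OF x(2,3)] l_coset_subset_G[OF x(2), of "inv g"]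
    by (intro bexI[of _ "(inv g <# D, inv g)"]) (simp_all add: carrier_subset_semidirect)
qed (simp add: subset_semidirect_def)

lemma inv_subset_semidirect:
  assumes "D \<subseteq> carrier G" "g \<in> carrier G"
  shows "inv\<^bsub>subset_semidirect G\<^esub> (D, g) = (inv g <# D, inv g)"
  by (rule group.inv_equality[OF group_subset_semidirect subset_semidirect_l_inv[OF assms]])
    (use assms l_coset_subset_G[of D "inv g"] in \<open>simp_all add: carrier_subset_semidirect\<close>)

text \<open>Each generator is sent to a pair in the semidirect product. If the relations hold there,
  a homomorphism results; its second component is the identity, so its first component satisfies the
  cocycle rule.\<close>

lemma presented_by_cocycle:
  assumes "presented_by G f S R" "f \<in> S \<rightarrow> carrier G" "D \<in> S \<rightarrow> Pow (carrier G)"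
    and "\<And>l r. (l, r) \<in> R \<Longrightarrow> word_value (subset_semidirect G) (\<lambda>s. (D s, f s)) l =
      word_value (subset_semidirect G) (\<lambda>s. (D s, f s)) r"
  obtains \<delta> where "\<And>g. g \<in> carrier G \<Longrightarrow> \<delta> g \<subseteq> carrier G"
    "\<And>g h. \<lbrakk>g \<in> carrier G; h \<in> carrier G\<rbrakk> \<Longrightarrow> \<delta> (g \<otimes> h) = sym_diff (\<delta> g) (g <# \<delta> h)"
    "\<And>s. s \<in> S \<Longrightarrow> \<delta> (f s) = D s"
proof -
  let ?M = "subset_semidirect G"
  have "(\<lambda>s. (D s, f s)) \<in> S \<rightarrow> carrier ?M"
    using assms(2,3) by (auto simp: subset_semidirect_def)
  then obtain \<psi> where \<psi>: "\<psi> \<in> hom G ?M" "\<And>s. s \<in> S \<Longrightarrow> \<psi> (f s) = (D s, f s)"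
    by (rule presented_by_extend[OF is_group assms(1) group_subset_semidirect _ assms(4)]) blast+
  interpret \<psi>: group_hom G ?M \<psi>
    using \<psi>(1) group_subset_semidirect by (simp add: group_hom_def group_hom_axioms_def is_group)
  have snd_mult: "snd (\<psi> (g \<otimes> h)) = snd (\<psi> g) \<otimes> snd (\<psi> h)" if "g \<in> carrier G" "h \<in> carrier G" for g h
    using that by (cases "\<psi> g"; cases "\<psi> h") (simp add: mult_subset_semidirect)
  have snd: "snd (\<psi> g) = g" if "g \<in> carrier G" for g
  proof (rule presented_by_induct[OF is_group assms(1,2) that])
    show "snd (\<psi> \<one>) = \<one>"
      by (simp add: one_subset_semidirect)
    fix s y assume *: "s \<in> S" "y \<in> carrier G" "snd (\<psi> y) = y"
    then have fs: "f s \<in> carrier G" "D s \<subseteq> carrier G" using assms(2,3) by auto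
    then have "snd (\<psi> (f s)) = f s" "snd (\<psi> (inv f s)) = inv f s"
      using * \<psi>(2) by (simp_all add: inv_subset_semidirect)
    then show "snd (\<psi> (f s \<otimes> y)) = f s \<otimes> y \<and> snd (\<psi> (inv f s \<otimes> y)) = inv f s \<otimes> y"
      using * fs(1) snd_mult[of "f s" y] snd_mult[of "inv f s" y] by simp
  qed
  show thesis
  proof (rule that[of "\<lambda>g. fst (\<psi> g)"])
    show "fst (\<psi> g) \<subseteq> carrier G" if "g \<in> carrier G" for g
      using \<psi>.hom_closed[OF that] by (auto simp: carrier_subset_semidirect)
    show "fst (\<psi> (g \<otimes> h)) = sym_diff (fst (\<psi> g)) (g <# fst (\<psi> h))"
      if "g \<in> carrier G" "h \<in> carrier G" for g h
      using snd[OF that(1)] that by (cases "\<psi> g"; cases "\<psi> h") (simp add: mult_subset_semidirect)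
    show "fst (\<psi> (f s)) = D s" if "s \<in> S" for s using \<psi>(2)[OF that] by simp
  qed
qed

lemma l_coset_eq_subgroup:
  assumes "subgroup H G" "h \<in> H"
  shows "h <# H = H"
  using assms by (simp add: coset_join3 subgroup.mem_carrier)

text \<open>An edge of the future tree is a coset \<open>g <# C\<close>, from \<open>g <# A\<close>
  to \<open>g <# B\<close>, and \<open>\<delta> g\<close> is the union of the edges crossed an odd
  number of times on a path from \<open>A\<close> to \<open>g <# A\<close>. For \<open>b\<close> in
  \<open>B\<close> the path turns at \<open>B\<close>, crossing \<open>C\<close> and
  \<open>b <# C\<close>. For \<open>c\<close> in \<open>C\<close> both prescriptions are empty,
  which gives the gluing relation.\<close>

lemma amalgam_cocycle:
  assumes "is_amalgamated_product G A C B"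
  obtains \<delta> where "\<And>g. g \<in> carrier G \<Longrightarrow> \<delta> g \<subseteq> carrier G"
    "\<And>g h. \<lbrakk>g \<in> carrier G; h \<in> carrier G\<rbrakk> \<Longrightarrow> \<delta> (g \<otimes> h) = sym_diff (\<delta> g) (g <# \<delta> h)"
    "\<And>a. a \<in> A \<Longrightarrow> \<delta> a = {}" "\<And>b. b \<in> B \<Longrightarrow> \<delta> b = sym_diff (b <# C) C"
    "\<And>Q x. \<lbrakk>x \<in> carrier G; Q \<one>; \<And>s y. \<lbrakk>s \<in> A \<union> B; y \<in> carrier G; Q y\<rbrakk>
      \<Longrightarrow> Q (s \<otimes> y) \<and> Q (inv s \<otimes> y)\<rbrakk> \<Longrightarrow> Q x"
proof -
  have sub: "subgroup A G" "subgroup B G" "subgroup C G" "C \<subseteq> A" "C \<subseteq> B"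
    and pres: "presented_by G (case_sum id id) (A <+> B) (amalgam_relations G A C B)"
    using assms by (auto simp: is_amalgamated_product_def)
  note mem = sub(1-3)[THEN subgroup.mem_carrier] and CG = subgroup.subset[OF sub(3)]
  let ?D = "case_sum (\<lambda>a. {}) (\<lambda>b. sym_diff (b <# C) C)"
  let ?f = "\<lambda>s. (?D s, case_sum id id s)"
  let ?M = "subset_semidirect G"
  have DB: "sym_diff (b <# C) C \<subseteq> carrier G" if "b \<in> B" for b
    using CG l_coset_subset_G[OF CG mem(2)[OF that]] by blast
  have letter: "word_value ?M ?f [pos s] = ?f s" if "s \<in> A <+> B" for s
  proof -
    have "?f s \<in> carrier ?M"
      using that mem(1,2) DB subsetD[OF CG]
      by (cases s) (auto simp: carrier_subset_semidirect simp del: Un_subset_iff)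
    then show ?thesis
      using group_subset_semidirect by (simp add: group.is_monoid)
  qed
  have two: "word_value ?M ?f [pos s, pos t] = ?f s \<otimes>\<^bsub>?M\<^esub> ?f t" if "t \<in> A <+> B" for s t
    using letter[OF that] by simp
  have B: "sym_diff (sym_diff (b <# C) C) (b <# sym_diff (b' <# C) C) = sym_diff ((b \<otimes> b') <# C) C"
    if "b \<in> B" "b' \<in> B" for b b'
    using l_coset_sym_diff[OF l_coset_subset_G[OF CG] CG] lcos_m_assoc[OF CG] mem(2) that by auto
  have C: "c <# C = C" if "c \<in> C" for c
    using l_coset_eq_subgroup sub that by blast
  have rel: "word_value ?M ?f l = word_value ?M ?f r" if lr: "(l, r) \<in> amalgam_relations G A C B" for l r
  proof -
    consider a b where "a \<in> A" "b \<in> A" "l = [pos (Inl a), pos (Inl b)]" "r = [pos (Inl (a \<otimes> b))]"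
      | a b where "a \<in> B" "b \<in> B" "l = [pos (Inr a), pos (Inr b)]" "r = [pos (Inr (a \<otimes> b))]"
      | c where "c \<in> C" "l = [pos (Inl c)]" "r = [pos (Inr c)]"
      using lr by (auto simp: amalgam_relations_def mult_table_def)
    then show ?thesis
    proof cases
      case 1
      then show ?thesis
        using two[OF InlI, of b "Inl a"] letter[OF InlI, of "a \<otimes> b"] subgroup.m_closed[OF sub(1)]
        by (simp add: mult_subset_semidirect del: word_value.simps)
    next
      case 2
      then show ?thesis
        using two[OF InrI, of b "Inr a"] letter[OF InrI, of "a \<otimes> b"] subgroup.m_closed[OF sub(2)] B[of a b]
        by (simp add: mult_subset_semidirect del: word_value.simps)
    next
      case 3
      then have "c \<in> A" "c \<in> B" using sub by blast+
      with 3 show ?thesis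
        using letter[OF InlI, of c] letter[OF InrI, of c] sub C[of c]
        by (auto simp del: word_value.simps)
    qed
  qed
  have fS: "case_sum id id \<in> A <+> B \<rightarrow> carrier G"
    using mem by auto
  have DS: "?D \<in> A <+> B \<rightarrow> Pow (carrier G)"
    using subsetD[OF l_coset_subset_G[OF CG mem(2)]] subsetD[OF CG] by auto
  show thesis
  proof (rule presented_by_cocycle[OF pres fS DS rel])
    fix \<delta> assume \<delta>: "\<And>g. g \<in> carrier G \<Longrightarrow> \<delta> g \<subseteq> carrier G"
      "\<And>g h. \<lbrakk>g \<in> carrier G; h \<in> carrier G\<rbrakk> \<Longrightarrow> \<delta> (g \<otimes> h) = sym_diff (\<delta> g) (g <# \<delta> h)"
      "\<And>s. s \<in> A <+> B \<Longrightarrow> \<delta> (case_sum id id s) = ?D s"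
    show thesis
    proof (rule that[of \<delta>, OF \<delta>(1,2)])
      show "\<delta> a = {}" if "a \<in> A" for a using \<delta>(3)[OF InlI[OF that]] by simp
      show "\<delta> b = sym_diff (b <# C) C" if "b \<in> B" for b using \<delta>(3)[OF InrI[OF that]] by simp
      show "Q x" if "x \<in> carrier G" "Q \<one>"
        "\<And>s y. \<lbrakk>s \<in> A \<union> B; y \<in> carrier G; Q y\<rbrakk> \<Longrightarrow> Q (s \<otimes> y) \<and> Q (inv s \<otimes> y)" for Q x
        by (rule presented_by_induct[OF is_group pres fS that(1), of Q]) (use that(2,3) in auto)
    qed
  qed
qed

text \<open>Here \<open>g <# C\<close> is an edge between \<open>g <# A\<close> and
  \<open>(g \<otimes> inv t) <# A\<close>. The edge joining \<open>A\<close> to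
  \<open>t <# A\<close> is therefore \<open>t <# C\<close>, which dictates
  \<open>\<delta> t\<close>.\<close>

lemma hnn_cocycle:
  assumes "is_hnn_extension G A C"
  obtains \<delta> t where "t \<in> carrier G" "\<And>c. c \<in> C \<Longrightarrow> t \<otimes> c \<otimes> inv t \<in> A"
    "\<And>g. g \<in> carrier G \<Longrightarrow> \<delta> g \<subseteq> carrier G"
    "\<And>g h. \<lbrakk>g \<in> carrier G; h \<in> carrier G\<rbrakk> \<Longrightarrow> \<delta> (g \<otimes> h) = sym_diff (\<delta> g) (g <# \<delta> h)"
    "\<And>a. a \<in> A \<Longrightarrow> \<delta> a = {}" "\<delta> t = t <# C"
    "\<And>Q x. \<lbrakk>x \<in> carrier G; Q \<one>; \<And>s y. \<lbrakk>s \<in> insert t A; y \<in> carrier G; Q y\<rbrakk>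
      \<Longrightarrow> Q (s \<otimes> y) \<and> Q (inv s \<otimes> y)\<rbrakk> \<Longrightarrow> Q x"
proof -
  obtain \<theta> t where sub: "subgroup A G" "subgroup C G" "C \<subseteq> A"
    and \<theta>: "\<theta> \<in> hom (G\<lparr>carrier := C\<rparr>) (G\<lparr>carrier := A\<rparr>)" and t: "t \<in> carrier G"
    and pres: "presented_by G (case_option t id) (insert None (Some ` A)) (hnn_relations G A C \<theta>)"
    using assms by (auto simp: is_hnn_extension_def)
  note mem = sub(1,2)[THEN subgroup.mem_carrier] and CG = subgroup.subset[OF sub(2)]
  have \<theta>A: "\<theta> c \<in> A" if "c \<in> C" for c
    using \<theta> that by (auto simp: hom_def)
  have conj: "t \<otimes> c \<otimes> inv t = \<theta> c" if "c \<in> C" for c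
  proof -
    have "word_value G (case_option t id) [pos None, pos (Some c), neg None] =
        word_value G (case_option t id) [pos (Some (\<theta> c))]"
      by (rule presented_by_relation[OF is_group pres])
        (use that sub \<theta>A in \<open>auto simp: hnn_relations_def\<close>)
    then show ?thesis using that t mem sub \<theta>A by (auto simp: m_assoc)
  qed
  let ?D = "case_option (t <# C) (\<lambda>a. {})"
  let ?f = "\<lambda>s. (?D s, case_option t id s)"
  let ?M = "subset_semidirect G"
  interpret M: group ?M by (rule group_subset_semidirect)
  have f: "?f \<in> insert None (Some ` A) \<rightarrow> carrier ?M"
    using t mem CG l_coset_subset_G by (auto simp: carrier_subset_semidirect)
  have rel: "word_value ?M ?f l = word_value ?M ?f r" if lr: "(l, r) \<in> hnn_relations G A C \<theta>" for l r
  proof -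
    consider a b where "a \<in> A" "b \<in> A" "l = [pos (Some a), pos (Some b)]" "r = [pos (Some (a \<otimes> b))]"
      | c where "c \<in> C" "l = [pos None, pos (Some c), neg None]" "r = [pos (Some (\<theta> c))]"
      using lr by (auto simp: hnn_relations_def mult_table_def)
    then show ?thesis
    proof cases
      case 1
      then show ?thesis
        using mem subgroup.m_closed[OF sub(1)]
        by (simp add: mult_subset_semidirect one_subset_semidirect)
    next
      case 2
      have c: "c \<in> carrier G" "c \<in> A" "\<theta> c \<in> carrier G" using 2 sub \<theta>A mem by auto
      have inv: "inv\<^bsub>?M\<^esub> (t <# C, t) = (C, inv t)"
        using t CG l_coset_subset_G by (simp add: inv_subset_semidirect lcos_m_assoc lcos_mult_one)
      have "t <# (c <# C) = t <# C"
        using l_coset_eq_subgroup[OF sub(2) 2(1)] by simp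
      then show ?thesis
        using 2 c t CG conj[OF 2(1)]
        by (simp add: mult_subset_semidirect one_subset_semidirect inv l_coset_sym_diff m_assoc)
    qed
  qed
  have val: "case_option t id \<in> insert None (Some ` A) \<rightarrow> carrier G"
    "?D \<in> insert None (Some ` A) \<rightarrow> Pow (carrier G)"
    using t mem CG l_coset_subset_G by auto
  show thesis
  proof (rule presented_by_cocycle[OF pres val rel])
    fix \<delta> assume \<delta>: "\<And>g. g \<in> carrier G \<Longrightarrow> \<delta> g \<subseteq> carrier G"
      "\<And>g h. \<lbrakk>g \<in> carrier G; h \<in> carrier G\<rbrakk> \<Longrightarrow> \<delta> (g \<otimes> h) = sym_diff (\<delta> g) (g <# \<delta> h)"
      "\<And>s. s \<in> insert None (Some ` A) \<Longrightarrow> \<delta> (case_option t id s) = ?D s"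
    show thesis
    proof (rule that[of t \<delta>, OF t _ \<delta>(1,2)])
      show "t \<otimes> c \<otimes> inv t \<in> A" if "c \<in> C" for c using conj[OF that] \<theta>A[OF that] by simp
      show "\<delta> a = {}" if "a \<in> A" for a using \<delta>(3)[of "Some a"] that by simp
      show "\<delta> t = t <# C" using \<delta>(3)[of None] by simp
      show "Q x" if "x \<in> carrier G" "Q \<one>"
        "\<And>s y. \<lbrakk>s \<in> insert t A; y \<in> carrier G; Q y\<rbrakk> \<Longrightarrow> Q (s \<otimes> y) \<and> Q (inv s \<otimes> y)" for Q x
        by (rule presented_by_induct[OF is_group pres val(1) that(1), of Q]) (use that(2,3) in auto)
    qed
  qed
qed

end

section \<open>The tree of a splitting\<close>

text \<open>The Boolean marks the type of a vertex. It keeps the two kinds of cosets apart even when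
  they are equal sets, as for an HNN-extension with \<open>C = A\<close>.\<close>

definition (in monoid) translate :: "'a \<Rightarrow> bool \<times> 'a set \<Rightarrow> bool \<times> 'a set" where
  "translate g v = (fst v, g <# snd v)"

context group
begin

lemma fst_translate [simp]: "fst (translate g v) = fst v"
  and snd_translate [simp]: "snd (translate g v) = g <# snd v"
  and translate_Pair [simp]: "translate g (s, X) = (s, g <# X)"
  by (simp_all add: translate_def)

lemma translate_one: "snd v \<subseteq> carrier G \<Longrightarrow> translate \<one> v = v"
  by (simp add: translate_def lcos_mult_one)

lemma translate_mult:
  "\<lbrakk>g \<in> carrier G; h \<in> carrier G; snd v \<subseteq> carrier G\<rbrakk> \<Longrightarrow> translate (g \<otimes> h) v = translate g (translate h v)"
  by (simp add: translate_def lcos_m_assoc)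

lemma l_coset_eq_iff:
  assumes "subgroup H G" "g \<in> carrier G" "h \<in> carrier G"
  shows "g <# H = h <# H \<longleftrightarrow> inv g \<otimes> h \<in> H"
proof
  note H = subgroup.subset[OF assms(1)]
  have "h \<in> h <# H"
    using mem_l_coset_iff[OF H assms(3)] assms subgroup.one_closed by auto
  then show "inv g \<otimes> h \<in> H" if "g <# H = h <# H"
    using that mem_l_coset_iff[OF H assms(2)] by simp
  show "g <# H = h <# H" if "inv g \<otimes> h \<in> H"
  proof -
    have "h = g \<otimes> (inv g \<otimes> h)" using assms by (simp add: m_assoc[symmetric])
    then have "h <# H = g <# ((inv g \<otimes> h) <# H)"
      using lcos_m_assoc[OF H assms(2), of "inv g \<otimes> h"] assms by simp
    then show ?thesis using l_coset_eq_subgroup[OF assms(1) that] by simp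
  qed
qed

lemma l_coset_bex_const:
  assumes "subgroup H G" "\<And>a. a \<in> H \<Longrightarrow> P (g \<otimes> a) \<longleftrightarrow> Q"
  shows "(\<exists>k\<in>g <# H. P k) \<longleftrightarrow> Q"
  using assms subgroup.one_closed[OF assms(1)] by (auto simp: l_coset_def)

text \<open>The stabilizer of \<open>g <# H\<close> is the conjugate of \<open>H\<close> by
  \<open>g\<close>; if it is everything, so is \<open>H\<close>.\<close>

lemma proper_coset_moved:
  assumes "subgroup H G" "H \<noteq> carrier G" "g \<in> carrier G"
  shows "\<exists>x\<in>carrier G. x <# (g <# H) \<noteq> g <# H"
proof (rule ccontr)
  assume fixed: "\<not> ?thesis"
  note H = subgroup.subset[OF assms(1)]
  have "y \<in> H" if y: "y \<in> carrier G" for y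
  proof -
    let ?x = "g \<otimes> y \<otimes> inv g"
    have "g <# H = (?x \<otimes> g) <# H"
      using fixed lcos_m_assoc[OF H, of ?x g] y assms(3) by auto
    then have "inv g \<otimes> (?x \<otimes> g) \<in> H"
      using l_coset_eq_iff[OF assms(1,3), of "?x \<otimes> g"] y assms(3) by simp
    then show "y \<in> H" using y assms(3) by (simp add: m_assoc) (simp add: m_assoc[symmetric])
  qed
  then show False using assms(2) H by blast
qed

lemma translate_rtrancl:
  assumes "\<And>u v. adj u v \<Longrightarrow> adj (translate g u) (translate g v)"
    and "(u, v) \<in> {(u, v). adj u v}\<^sup>*"
  shows "(translate g u, translate g v) \<in> {(u, v). adj u v}\<^sup>*"
  using assms(2) by induction (auto intro: rtrancl_into_rtrancl assms(1))

text \<open>If \<open>v\<close> is joined to its translate by each generator, translating these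
  paths joins \<open>v\<close> to all of its translates, letter by letter along a word.\<close>

lemma translates_reachable:
  assumes adj: "\<And>g u v. g \<in> carrier G \<Longrightarrow> adj u v \<Longrightarrow> adj (translate g u) (translate g v)"
    and sym: "\<And>u v. adj u v \<Longrightarrow> adj v u"
    and v: "snd v \<subseteq> carrier G"
    and gens: "\<And>s. s \<in> S \<Longrightarrow> s \<in> carrier G \<and> (v, translate s v) \<in> {(u, v). adj u v}\<^sup>*"
    and induct: "\<And>Q x. \<lbrakk>x \<in> carrier G; Q \<one>; \<And>s y. \<lbrakk>s \<in> S; y \<in> carrier G; Q y\<rbrakk>
      \<Longrightarrow> Q (s \<otimes> y) \<and> Q (inv s \<otimes> y)\<rbrakk> \<Longrightarrow> Q x"
    and g: "g \<in> carrier G"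
  shows "(v, translate g v) \<in> {(u, v). adj u v}\<^sup>*" (is "_ \<in> ?R\<^sup>*")
proof (rule induct[OF g])
  show "(v, translate \<one> v) \<in> ?R\<^sup>*" using v by (simp add: translate_one)
next
  fix s y assume s: "s \<in> S" and y: "y \<in> carrier G" and IH: "(v, translate y v) \<in> ?R\<^sup>*"
  have sG: "s \<in> carrier G" using gens s by blast
  have tr: "(translate g a, translate g b) \<in> ?R\<^sup>*" if "g \<in> carrier G" "(a, b) \<in> ?R\<^sup>*" for g a b
    using translate_rtrancl[of adj g a b] adj[OF that(1)] that(2) by blast
  have "sym (?R\<^sup>*)" using sym by (intro sym_rtrancl symI) auto
  moreover have "translate (inv s) (translate s v) = v"
    using translate_mult[of "inv s" s v] v sG by (simp add: translate_one)
  ultimately have "(v, translate (inv s) v) \<in> ?R\<^sup>*"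
    using tr[of "inv s" v "translate s v"] gens[OF s] sG by (auto dest: symD)
  moreover have "(translate x v, translate (x \<otimes> y) v) \<in> ?R\<^sup>*" if "x \<in> carrier G" for x
    using tr[OF that IH] translate_mult[OF that y v] by simp
  ultimately show "(v, translate (s \<otimes> y) v) \<in> ?R\<^sup>* \<and> (v, translate (inv s \<otimes> y) v) \<in> ?R\<^sup>*"
    using gens[OF s] sG by (meson inv_closed rtrancl_trans)
qed

lemma free_pair_conj:
  assumes "free_pair G x y" "g \<in> carrier G"
  shows "free_pair G (inv g \<otimes> x \<otimes> g) (inv g \<otimes> y \<otimes> g)"
proof (rule free_pair_inj_hom[OF is_group is_group, where h = "\<lambda>x. inv g \<otimes> x \<otimes> g"])
  have "inv g \<otimes> (a \<otimes> b) \<otimes> g = inv g \<otimes> a \<otimes> g \<otimes> (inv g \<otimes> b \<otimes> g)"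
    if "a \<in> carrier G" "b \<in> carrier G" for a b
  proof -
    have "g \<otimes> (inv g \<otimes> (b \<otimes> g)) = b \<otimes> g"
      using that assms(2) by (simp add: m_assoc[symmetric])
    then show ?thesis using that assms(2) by (simp add: m_assoc)
  qed
  then show "(\<lambda>x. inv g \<otimes> x \<otimes> g) \<in> hom G G"
    using assms(2) by (auto simp: hom_def)
  show "inj_on (\<lambda>x. inv g \<otimes> x \<otimes> g) (carrier G)"
    using assms(2) by (auto simp: inj_on_def m_assoc)
qed fact

lemma free_pair_subgroup:
  assumes "subgroup H G" "free_pair G x y" "x \<in> H" "y \<in> H"
  shows "free_pair (G\<lparr>carrier := H\<rparr>) x y"
  by (rule free_pair_hom[OF subgroup_imp_group[OF assms(1)] is_group, where h = id])
    (use assms subgroup.mem_carrier[OF assms(1)] in \<open>auto simp: hom_def\<close>)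

text \<open>The hypothesis \<open>edge\<close> says that every edge stabilizer is conjugate into
  \<open>C\<close>. As \<open>C\<close> contains no free pair, neither does the stabilizer of two
  distinct vertices, since it fixes the first edge between them.\<close>

lemma tree_actionI:
  assumes T: "bipartite_tree V adj fst" and "V \<noteq> {}"
    and V: "\<And>u. u \<in> V \<Longrightarrow> snd u \<subseteq> carrier G"
      "\<And>g u. \<lbrakk>g \<in> carrier G; u \<in> V\<rbrakk> \<Longrightarrow> translate g u \<in> V"
    and adj: "\<And>g u v. \<lbrakk>g \<in> carrier G; adj u v\<rbrakk> \<Longrightarrow> adj (translate g u) (translate g v)"
    and edge: "\<And>u v. adj u v \<Longrightarrow> \<exists>g\<in>carrier G. \<forall>x\<in>carrier G.
      translate x u = u \<longrightarrow> translate x v = v \<longrightarrow> inv g \<otimes> x \<otimes> g \<in> C"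
    and C: "subgroup C G" "NF (G\<lparr>carrier := C\<rparr>)"
  shows "tree_action G V (bipartite_tree.gdist adj) translate"
proof -
  interpret T: bipartite_tree V adj fst by fact
  let ?R = "{(u, v). adj u v}"
  have relpow: "(translate g u, translate g v) \<in> ?R ^^ n" if "g \<in> carrier G" "(u, v) \<in> ?R ^^ n" for g u v n
    using that(2)
  proof (induction n arbitrary: v)
    case (Suc n)
    then obtain w where "(u, w) \<in> ?R ^^ n" "adj w v" by auto
    then have "(translate g u, translate g w) \<in> ?R ^^ n" "(translate g w, translate g v) \<in> ?R"
      using Suc.IH adj[OF that(1)] by auto
    then show ?case by (rule relpow_Suc_I)
  qed simp
  have le: "T.gdist (translate g u) (translate g v) \<le> T.gdist u v"
    if "g \<in> carrier G" "u \<in> V" "v \<in> V" for g u v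
    using T.gdist_le relpow[OF that(1)] T.gdist_relpow[OF that(2,3)] by blast
  have isom: "T.gdist (translate g u) (translate g v) = T.gdist u v"
    if "g \<in> carrier G" "u \<in> V" "v \<in> V" for g u v
  proof -
    have "translate (inv g) (translate g w) = w" if "w \<in> V" for w
      using translate_mult[of "inv g" g w] \<open>g \<in> carrier G\<close> V(1)[OF that] by (simp add: translate_one)
    then have "T.gdist u v \<le> T.gdist (translate g u) (translate g v)"
      using le[of "inv g" "translate g u" "translate g v"] that V(2) by simp
    then show ?thesis using le[OF that] by simp
  qed
  show ?thesis
  proof
    show "even (T.gdist v (translate g v))" if "g \<in> carrier G" "v \<in> V" for g v
      using T.even_gdist[of v "translate g v"] that V(2) by simp
    show "u = v" if free: "free_pair G x y" and uv: "u \<in> V" "v \<in> V"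
      and fixed: "translate x u = u" "translate y u = u" "translate x v = v" "translate y v = v" for x y u v
    proof (rule ccontr)
      assume "u \<noteq> v"
      have xy: "x \<in> carrier G" "y \<in> carrier G" using free by (auto simp: free_pair_def)
      obtain w where w: "adj u w" "T.gdist u v = Suc (T.gdist w v)"
        using T.gdist_step[OF uv \<open>u \<noteq> v\<close>] by blast
      have wV: "w \<in> V" using T.adj_in[OF w(1)] by blast
      \<comment> \<open>The translate of \<open>w\<close> is again a neighbour of \<open>u\<close>
        one step nearer to \<open>v\<close>, and there is only one.\<close>
      have fix_w: "translate z w = w" if z: "z \<in> carrier G" "translate z u = u" "translate z v = v" for z
        using T.parent_unique[of u w "translate z w" v] w adj[OF z(1) w(1)] isom[OF z(1) wV uv(2)] z uv
        by simp
      obtain g where g: "g \<in> carrier G" "\<And>z. \<lbrakk>z \<in> carrier G; translate z u = u; translate z w = w\<rbrakk>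
          \<Longrightarrow> inv g \<otimes> z \<otimes> g \<in> C"
        using edge[OF w(1)] by blast
      have "inv g \<otimes> x \<otimes> g \<in> C" "inv g \<otimes> y \<otimes> g \<in> C"
        using g(2) fix_w fixed xy by blast+
      then have "free_pair (G\<lparr>carrier := C\<rparr>) (inv g \<otimes> x \<otimes> g) (inv g \<otimes> y \<otimes> g)"
        using free_pair_subgroup[OF C(1) free_pair_conj[OF free g(1)]] by blast
      then show False
        using group.free_pair_not_NF[OF subgroup_imp_group[OF C(1)]] C(2) by blast
    qed
  qed (use \<open>V \<noteq> {}\<close> V isom in \<open>auto simp: translate_one translate_mult\<close>)
qed

lemma amalgam_tree:
  assumes split: "is_amalgamated_product G A C B" "carrier G \<noteq> A" "carrier G \<noteq> B"
    and NF: "NF (G\<lparr>carrier := C\<rparr>)"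
  shows "\<exists>V d. tree_action G V d translate \<and> (\<forall>v\<in>V. \<exists>g\<in>carrier G. translate g v \<noteq> v)"
proof -
  have sub: "subgroup A G" "subgroup B G" "subgroup C G" "C \<subseteq> A" "C \<subseteq> B"
    using split by (auto simp: is_amalgamated_product_def)
  note mem = sub(1-3)[THEN subgroup.mem_carrier] and CG = subgroup.subset[OF sub(3)]
    and AG = subgroup.subset[OF sub(1)] and BG = subgroup.subset[OF sub(2)]
  show ?thesis
  proof (rule amalgam_cocycle[OF split(1)])
    fix \<delta>
    assume \<delta>G: "\<And>g. g \<in> carrier G \<Longrightarrow> \<delta> g \<subseteq> carrier G"
      and \<delta>: "\<And>g h. \<lbrakk>g \<in> carrier G; h \<in> carrier G\<rbrakk> \<Longrightarrow> \<delta> (g \<otimes> h) = sym_diff (\<delta> g) (g <# \<delta> h)"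
      and \<delta>A: "\<And>a. a \<in> A \<Longrightarrow> \<delta> a = {}" and \<delta>B: "\<And>b. b \<in> B \<Longrightarrow> \<delta> b = sym_diff (b <# C) C"
      and induct: "\<And>Q x. \<lbrakk>x \<in> carrier G; Q \<one>; \<And>s y. \<lbrakk>s \<in> A \<union> B; y \<in> carrier G; Q y\<rbrakk>
        \<Longrightarrow> Q (s \<otimes> y) \<and> Q (inv s \<otimes> y)\<rbrakk> \<Longrightarrow> Q x"
    define V where "V = (\<lambda>g. (True, g <# A)) ` carrier G \<union> (\<lambda>g. (False, g <# B)) ` carrier G"
    define adj where "adj u v \<longleftrightarrow> (\<exists>g\<in>carrier G. {u, v} = {(True, g <# A), (False, g <# B)})" for u v
    \<comment> \<open>The colour of a vertex tells whether the edge \<open>h <# C\<close> is crossed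
      an odd number of times on a path to it from \<open>A\<close>; reaching \<open>g <# B\<close>
      from \<open>g <# A\<close> crosses \<open>g <# C\<close> once more. Any representative of the
      coset may be used, by the cocycle rule.\<close>
    define f where "f h v \<longleftrightarrow> (\<exists>g\<in>snd v. (h \<in> \<delta> g) \<noteq> (\<not> fst v \<and> h \<in> g <# C))" for h v
    have f_A: "f h (True, g <# A) \<longleftrightarrow> h \<in> \<delta> g" if "g \<in> carrier G" for g h
    proof -
      have "\<delta> (g \<otimes> a) = \<delta> g" if "a \<in> A" for a
        using \<delta>[OF \<open>g \<in> carrier G\<close> mem(1)[OF that]] \<delta>A[OF that] by simp
      then show ?thesis
        unfolding f_def snd_conv by (intro l_coset_bex_const[OF sub(1)]) simp
    qed
    have f_B: "f h (False, g <# B) \<longleftrightarrow> (h \<in> \<delta> g) \<noteq> (h \<in> g <# C)" if g: "g \<in> carrier G" for g h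
    proof -
      have "(h \<in> \<delta> (g \<otimes> b)) \<noteq> (h \<in> (g \<otimes> b) <# C) \<longleftrightarrow> (h \<in> \<delta> g) \<noteq> (h \<in> g <# C)" if b: "b \<in> B" for b
      proof -
        have "g <# \<delta> b = sym_diff ((g \<otimes> b) <# C) (g <# C)"
          using \<delta>B[OF b] l_coset_sym_diff[OF l_coset_subset_G[OF CG mem(2)[OF b]] CG g]
            lcos_m_assoc[OF CG g mem(2)[OF b]] by simp
        then show ?thesis using \<delta>[OF g mem(2)[OF b]] by auto
      qed
      then show ?thesis
        unfolding f_def snd_conv by (intro l_coset_bex_const[OF sub(2)]) simp
    qed
    have self: "g \<in> g <# C" if "g \<in> carrier G" for g
      using that mem_l_coset_iff[OF CG that] subgroup.one_closed[OF sub(3)] by simp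
    have adj_translate: "adj (translate g u) (translate g v)"
      if g: "g \<in> carrier G" and uv: "adj u v" for g u v
    proof -
      obtain h where h: "h \<in> carrier G" "{u, v} = {(True, h <# A), (False, h <# B)}"
        using uv by (auto simp: adj_def)
      then have "translate g ` {u, v} = translate g ` {(True, h <# A), (False, h <# B)}" by simp
      then show ?thesis
        unfolding adj_def using g h(1)
        by (intro bexI[of _ "g \<otimes> h"]) (simp_all add: lcos_m_assoc[OF AG] lcos_m_assoc[OF BG])
    qed
    have adj_sym: "adj v u" if "adj u v" for u v
      using that by (simp add: adj_def insert_commute)
    have VG: "snd u \<subseteq> carrier G" if "u \<in> V" for u
    proof -
      from that consider g where "g \<in> carrier G" "u = (True, g <# A)"
        | g where "g \<in> carrier G" "u = (False, g <# B)" by (auto simp: V_def)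
      then show ?thesis by cases (simp_all add: l_coset_subset_G AG BG)
    qed
    let ?R = "{(u, v). adj u v}" and ?o = "(True, A)"
    have edge_adj: "adj (True, g <# A) (False, g <# B)" if "g \<in> carrier G" for g
      using that by (auto simp: adj_def)
    have reach_A: "(?o, (True, g <# A)) \<in> ?R\<^sup>*" if g: "g \<in> carrier G" for g
    proof -
      have "s \<in> carrier G \<and> (?o, translate s ?o) \<in> ?R\<^sup>*" if s: "s \<in> A \<union> B" for s
      proof (cases "s \<in> A")
        case True
        then show ?thesis using l_coset_eq_subgroup[OF sub(1)] mem by simp
      next
        case False
        then have "s \<in> B" using s by simp
        then have "s <# B = B" "s \<in> carrier G" using l_coset_eq_subgroup[OF sub(2)] mem by blast+
        then have "adj (False, B) (True, s <# A)" "adj (True, A) (False, B)"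
          using edge_adj[of s] edge_adj[of \<one>] adj_sym AG BG by (auto simp: lcos_mult_one)
        then show ?thesis using \<open>s \<in> carrier G\<close> by (auto intro: converse_rtrancl_into_rtrancl)
      qed
      note gens = this
      have "(?o, translate g ?o) \<in> ?R\<^sup>*"
      proof (rule translates_reachable[where adj = adj and S = "A \<union> B", OF adj_translate adj_sym])
        show "Q x" if "x \<in> carrier G" "Q \<one>"
          "\<And>s y. \<lbrakk>s \<in> A \<union> B; y \<in> carrier G; Q y\<rbrakk> \<Longrightarrow> Q (s \<otimes> y) \<and> Q (inv s \<otimes> y)" for Q x
          by (rule induct[where Q = Q and x = x]) (fact that)+
      qed (use AG gens g in simp_all)
      then show ?thesis by simp
    qed
    have reach: "(?o, v) \<in> ?R\<^sup>*" if "v \<in> V" for v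
    proof -
      from that consider g where "g \<in> carrier G" "v = (True, g <# A)"
        | g where "g \<in> carrier G" "v = (False, g <# B)" by (auto simp: V_def)
      then show ?thesis
        by cases (auto intro: reach_A rtrancl_into_rtrancl[OF reach_A] edge_adj)
    qed
    have "bipartite_tree V adj fst"
    proof
      fix u v assume uv: "adj u v"
      then obtain h where h: "h \<in> carrier G" "{u, v} = {(True, h <# A), (False, h <# B)}"
        by (auto simp: adj_def)
      then show "u \<in> V \<and> v \<in> V" "fst u \<noteq> fst v"
        by (auto simp: V_def doubleton_eq_iff)
      show "adj v u" by (rule adj_sym[OF uv])
      show "\<exists>f::bool \<times> 'a set \<Rightarrow> bool. f u \<noteq> f v \<and>
          (\<forall>a b. adj a b \<longrightarrow> {a, b} \<noteq> {u, v} \<longrightarrow> f a = f b)"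
      proof (intro exI[of _ "f h"] conjI allI impI)
        show "f h u \<noteq> f h v"
          using h f_A[of h h] f_B[of h h] self[of h] by (auto simp: doubleton_eq_iff)
        fix a b assume ab: "adj a b" "{a, b} \<noteq> {u, v}"
        then obtain g where g: "g \<in> carrier G" "{a, b} = {(True, g <# A), (False, g <# B)}"
          by (auto simp: adj_def)
        have "h \<notin> g <# C"
        proof
          assume "h \<in> g <# C"
          then have "inv g \<otimes> h \<in> C" using mem_l_coset_iff[OF CG g(1)] by simp
          then have "g <# A = h <# A" "g <# B = h <# B"
            using l_coset_eq_iff[OF sub(1) g(1) h(1)] l_coset_eq_iff[OF sub(2) g(1) h(1)] sub by blast+
          then show False using ab(2) g(2) h(2) by simp
        qed
        then show "f h a = f h b"
          using g f_A[of g h] f_B[of g h] by (auto simp: doubleton_eq_iff)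
      qed
    next
      fix u v assume "u \<in> V" "v \<in> V"
      moreover have "sym (?R\<^sup>*)" using adj_sym by (intro sym_rtrancl symI) auto
      ultimately show "(u, v) \<in> ?R\<^sup>*" using reach by (meson rtrancl_trans symD)
    qed
    then have "tree_action G V (bipartite_tree.gdist adj) translate"
    proof (rule tree_actionI[where V = V and adj = adj and C = C, OF _ _ VG _ adj_translate _ sub(3) NF])
      show "V \<noteq> {}" by (auto simp: V_def)
      show "translate g u \<in> V" if "g \<in> carrier G" "u \<in> V" for g u
        using that by (auto simp: V_def image_iff lcos_m_assoc[OF AG] lcos_m_assoc[OF BG])
      fix u v assume "adj u v"
      then obtain g where g: "g \<in> carrier G" "{u, v} = {(True, g <# A), (False, g <# B)}"
        by (auto simp: adj_def)
      show "\<exists>g\<in>carrier G. \<forall>x\<in>carrier G. translate x u = u \<longrightarrow> translate x v = v \<longrightarrow> inv g \<otimes> x \<otimes> g \<in> C"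
      proof (intro bexI[of _ g] ballI impI g)
        fix x assume x: "x \<in> carrier G" "translate x u = u" "translate x v = v"
        have "translate x (True, g <# A) = (True, g <# A)" "translate x (False, g <# B) = (False, g <# B)"
          using g(2) x(2,3) by (auto simp: doubleton_eq_iff)
        then have fixed: "(x \<otimes> g) <# A = g <# A" "(x \<otimes> g) <# B = g <# B"
          using x(1) g(1) by (simp_all add: lcos_m_assoc[OF AG] lcos_m_assoc[OF BG])
        \<comment> \<open>If \<open>x\<close> fixes both ends, the edges \<open>g <# C\<close> and
          \<open>(x \<otimes> g) <# C\<close> have the same ends. These get different colours from
          \<open>f g\<close>, which changes only across \<open>g <# C\<close>, so the two edges are
          equal.\<close>
        have "f g (True, g <# A) \<noteq> f g (False, g <# B)"
          using f_A[OF g(1)] f_B[OF g(1)] self[OF g(1)] by simp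
        then have "g \<in> (x \<otimes> g) <# C"
          using f_A[of "x \<otimes> g" g] f_B[of "x \<otimes> g" g] x(1) g(1) unfolding fixed by auto
        then have "inv (x \<otimes> g) \<otimes> g \<in> C" using mem_l_coset_iff[OF CG] x(1) g(1) by simp
        then have "inv (inv (x \<otimes> g) \<otimes> g) \<in> C" by (rule subgroup.m_inv_closed[OF sub(3)])
        then show "inv g \<otimes> x \<otimes> g \<in> C" using x(1) g(1) by (simp add: inv_mult_group m_assoc)
      qed
    qed
    moreover have "\<exists>g\<in>carrier G. translate g v \<noteq> v" if "v \<in> V" for v
      using that proper_coset_moved[OF sub(1)] proper_coset_moved[OF sub(2)] split(2,3)
      by (auto simp: V_def)
    ultimately show ?thesis by blast
  qed
qed

text \<open>The Bass-Serre tree is subdivided: cosets of \<open>C\<close> serve as midpoints of its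
  edges, which makes the graph bipartite and the displacements even.\<close>

lemma hnn_tree:
  assumes split: "is_hnn_extension G A C" "carrier G \<noteq> A"
    and NF: "NF (G\<lparr>carrier := C\<rparr>)"
  shows "\<exists>V d. tree_action G V d translate \<and> (\<forall>v\<in>V. \<exists>g\<in>carrier G. translate g v \<noteq> v)"
proof -
  have sub: "subgroup A G" "subgroup C G" "C \<subseteq> A"
    using split by (auto simp: is_hnn_extension_def)
  note mem = sub(1,2)[THEN subgroup.mem_carrier] and CG = subgroup.subset[OF sub(2)]
    and AG = subgroup.subset[OF sub(1)]
  show ?thesis
  proof (rule hnn_cocycle[OF split(1)])
    fix \<delta> t
    assume t: "t \<in> carrier G" and conj: "\<And>c. c \<in> C \<Longrightarrow> t \<otimes> c \<otimes> inv t \<in> A"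
      and \<delta>G: "\<And>g. g \<in> carrier G \<Longrightarrow> \<delta> g \<subseteq> carrier G"
      and \<delta>: "\<And>g h. \<lbrakk>g \<in> carrier G; h \<in> carrier G\<rbrakk> \<Longrightarrow> \<delta> (g \<otimes> h) = sym_diff (\<delta> g) (g <# \<delta> h)"
      and \<delta>A: "\<And>a. a \<in> A \<Longrightarrow> \<delta> a = {}" and \<delta>t: "\<delta> t = t <# C"
      and induct: "\<And>Q x. \<lbrakk>x \<in> carrier G; Q \<one>; \<And>s y. \<lbrakk>s \<in> insert t A; y \<in> carrier G; Q y\<rbrakk>
        \<Longrightarrow> Q (s \<otimes> y) \<and> Q (inv s \<otimes> y)\<rbrakk> \<Longrightarrow> Q x"
    \<comment> \<open>The two halves of the edge with midpoint \<open>g <# C\<close>: the one with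
      \<open>b\<close> leads to \<open>(g \<otimes> inv t) <# A\<close>, the other to
      \<open>g <# A\<close>.\<close>
    define e where "e b g = {(True, (if b then g \<otimes> inv t else g) <# A), (False, g <# C)}" for b g
    define V where "V = (\<lambda>g. (True, g <# A)) ` carrier G \<union> (\<lambda>g. (False, g <# C)) ` carrier G"
    define adj where "adj u v \<longleftrightarrow> (\<exists>b. \<exists>g\<in>carrier G. {u, v} = e b g)" for u v
    \<comment> \<open>A colouring that changes only across the half-edge \<open>e b h\<close>. A
      midpoint takes the colour of the end that the uncut half leads to: \<open>g <# A\<close> if
      \<open>b\<close> holds, and \<open>(g \<otimes> inv t) <# A\<close> otherwise.\<close>
    define f where "f b h v \<longleftrightarrow> (\<exists>g\<in>snd v. h \<in> \<delta> (if fst v \<or> b then g else g \<otimes> inv t))" for b h v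
    have \<delta>s: "\<delta> (g \<otimes> inv t) = sym_diff (\<delta> g) (g <# C)" if g: "g \<in> carrier G" for g
    proof -
      have "\<delta> \<one> = {}" using \<delta>A subgroup.one_closed[OF sub(1)] by blast
      then have "sym_diff (\<delta> (inv t)) (inv t <# (t <# C)) = {}"
        using \<delta>[of "inv t" t] \<delta>t t by simp
      then have "\<delta> (inv t) = C" using t CG by (auto simp: lcos_m_assoc lcos_mult_one)
      then show ?thesis using \<delta>[OF g, of "inv t"] t by simp
    qed
    have \<delta>_A: "\<delta> (g \<otimes> a) = \<delta> g" if "g \<in> carrier G" "a \<in> A" for g a
      using \<delta>[OF that(1) mem(1)[OF that(2)]] \<delta>A[OF that(2)] by simp
    have f_A: "f b h (True, g <# A) \<longleftrightarrow> h \<in> \<delta> g" if "g \<in> carrier G" for g h b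
      unfolding f_def snd_conv by (intro l_coset_bex_const[OF sub(1)]) (simp add: \<delta>_A[OF that])
    have f_C: "f b h (False, g <# C) \<longleftrightarrow> h \<in> \<delta> (if b then g else g \<otimes> inv t)"
      if g: "g \<in> carrier G" for g h b
      unfolding f_def snd_conv
    proof (intro l_coset_bex_const[OF sub(2)])
      fix c assume c: "c \<in> C"
      then have "c \<in> A" "c <# C = C" using sub l_coset_eq_subgroup[OF sub(2)] by blast+
      then have "\<delta> (g \<otimes> c) = \<delta> g" "(g \<otimes> c) <# C = g <# C"
        using \<delta>_A[OF g] lcos_m_assoc[OF CG g mem(2)[OF c]] by simp_all
      then show "(h \<in> \<delta> (if fst (False, g <# C) \<or> b then g \<otimes> c else g \<otimes> c \<otimes> inv t)) \<longleftrightarrow>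
          h \<in> \<delta> (if b then g else g \<otimes> inv t)"
        using \<delta>s g mem(2)[OF c] by simp
    qed
    have self: "g \<in> g <# C" if "g \<in> carrier G" for g
      using that mem_l_coset_iff[OF CG that] subgroup.one_closed[OF sub(2)] by simp
    have e_eq: "e b g = e b h" if gh: "g \<in> carrier G" "h \<in> carrier G" "h \<in> g <# C" for b g h
    proof -
      have c: "inv g \<otimes> h \<in> C" (is "?c \<in> C") using mem_l_coset_iff[OF CG gh(1)] gh(3) by simp
      have "inv (g \<otimes> inv t) \<otimes> (h \<otimes> inv t) = t \<otimes> ?c \<otimes> inv t"
        using gh t by (simp add: inv_mult_group m_assoc)
      then have "(g \<otimes> inv t) <# A = (h \<otimes> inv t) <# A"
        using l_coset_eq_iff[OF sub(1), of "g \<otimes> inv t" "h \<otimes> inv t"] conj[OF c] gh t by simp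
      moreover have "g <# A = h <# A" "g <# C = h <# C"
        using l_coset_eq_iff[OF sub(1) gh(1,2)] l_coset_eq_iff[OF sub(2) gh(1,2)] c sub by blast+
      ultimately show ?thesis by (simp add: e_def)
    qed
    have e_translate: "translate g ` e b h = e b (g \<otimes> h)" if "g \<in> carrier G" "h \<in> carrier G" for b g h
      using that t by (simp add: e_def lcos_m_assoc[OF AG] lcos_m_assoc[OF CG] m_assoc)
    have adj_translate: "adj (translate g u) (translate g v)"
      if g: "g \<in> carrier G" and uv: "adj u v" for g u v
    proof -
      obtain b h where h: "h \<in> carrier G" "{u, v} = e b h"
        using uv by (auto simp: adj_def)
      then have "{translate g u, translate g v} = e b (g \<otimes> h)"
        using e_translate[OF g h(1), of b] by (simp flip: h(2))
      then show ?thesis unfolding adj_def using g h(1) by blast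
    qed
    have adj_sym: "adj v u" if "adj u v" for u v
      using that by (simp add: adj_def insert_commute)
    have VG: "snd u \<subseteq> carrier G" if "u \<in> V" for u
    proof -
      from that consider g where "g \<in> carrier G" "u = (True, g <# A)"
        | g where "g \<in> carrier G" "u = (False, g <# C)" by (auto simp: V_def)
      then show ?thesis by cases (simp_all add: l_coset_subset_G AG CG)
    qed
    let ?R = "{(u, v). adj u v}" and ?o = "(True, A)"
    have edge_adj: "adj (True, g <# A) (False, g <# C)" "adj (True, (g \<otimes> inv t) <# A) (False, g <# C)"
      if "g \<in> carrier G" for g
    proof -
      show "adj (True, g <# A) (False, g <# C)"
        unfolding adj_def e_def using that by (intro exI[of _ False]) auto
      show "adj (True, (g \<otimes> inv t) <# A) (False, g <# C)"
        unfolding adj_def e_def using that by (intro exI[of _ True]) auto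
    qed
    have reach_A: "(?o, (True, g <# A)) \<in> ?R\<^sup>*" if g: "g \<in> carrier G" for g
    proof -
      have "s \<in> carrier G \<and> (?o, translate s ?o) \<in> ?R\<^sup>*" if s: "s \<in> insert t A" for s
      proof (cases "s \<in> A")
        case True
        then show ?thesis using l_coset_eq_subgroup[OF sub(1)] mem by simp
      next
        case False
        then have "s = t" using s by simp
        moreover have "adj (False, t <# C) (True, t <# A)" "adj (True, A) (False, t <# C)"
          using edge_adj[OF t] adj_sym t AG by (auto simp: lcos_mult_one)
        ultimately show ?thesis using t by (auto intro: converse_rtrancl_into_rtrancl)
      qed
      note gens = this
      have "(?o, translate g ?o) \<in> ?R\<^sup>*"
      proof (rule translates_reachable[where adj = adj and S = "insert t A", OF adj_translate adj_sym])
        show "Q x" if "x \<in> carrier G" "Q \<one>"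
          "\<And>s y. \<lbrakk>s \<in> insert t A; y \<in> carrier G; Q y\<rbrakk> \<Longrightarrow> Q (s \<otimes> y) \<and> Q (inv s \<otimes> y)" for Q x
          by (rule induct[where Q = Q and x = x]) (fact that)+
      qed (use AG gens g in simp_all)
      then show ?thesis by simp
    qed
    have reach: "(?o, v) \<in> ?R\<^sup>*" if "v \<in> V" for v
    proof -
      from that consider g where "g \<in> carrier G" "v = (True, g <# A)"
        | g where "g \<in> carrier G" "v = (False, g <# C)" by (auto simp: V_def)
      then show ?thesis
        by cases (auto intro: reach_A rtrancl_into_rtrancl[OF reach_A] edge_adj)
    qed
    have "bipartite_tree V adj fst"
    proof
      fix u v assume uv: "adj u v"
      then obtain b h where h: "h \<in> carrier G" "{u, v} = e b h"
        by (auto simp: adj_def)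
      then show "u \<in> V \<and> v \<in> V" "fst u \<noteq> fst v"
        using t by (auto simp: V_def e_def doubleton_eq_iff)
      show "adj v u" by (rule adj_sym[OF uv])
      show "\<exists>f::bool \<times> 'a set \<Rightarrow> bool. f u \<noteq> f v \<and>
          (\<forall>a b. adj a b \<longrightarrow> {a, b} \<noteq> {u, v} \<longrightarrow> f a = f b)"
      proof (intro exI[of _ "f b h"] conjI allI impI)
        have f_e: "f b h x \<noteq> f b h y \<longleftrightarrow> b = b' \<and> h \<in> g <# C"
          if g: "g \<in> carrier G" and "{x, y} = e b' g" for x y b' g
        proof -
          have "f b h x \<noteq> f b h y \<longleftrightarrow>
              f b h (True, (if b' then g \<otimes> inv t else g) <# A) \<noteq> f b h (False, g <# C)"
            using that(2) by (auto simp: e_def doubleton_eq_iff)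
          also have "\<dots> \<longleftrightarrow> b = b' \<and> h \<in> g <# C"
            using f_A[of "if b' then g \<otimes> inv t else g" b h] f_C[OF g, of b h] \<delta>s[OF g] g t
            by (cases b; cases b') auto
          finally show ?thesis .
        qed
        show "f b h u \<noteq> f b h v"
          using f_e[OF h] self[OF h(1)] by simp
        fix x y assume xy: "adj x y" "{x, y} \<noteq> {u, v}"
        then obtain b' g where g: "g \<in> carrier G" "{x, y} = e b' g"
          by (auto simp: adj_def)
        then show "f b h x = f b h y"
          using f_e[OF g] e_eq[OF g(1) h(1), of b] xy(2) h(2) by auto
      qed
    next
      fix u v assume "u \<in> V" "v \<in> V"
      moreover have "sym (?R\<^sup>*)" using adj_sym by (intro sym_rtrancl symI) auto
      ultimately show "(u, v) \<in> ?R\<^sup>*" using reach by (meson rtrancl_trans symD)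
    qed
    then have "tree_action G V (bipartite_tree.gdist adj) translate"
    proof (rule tree_actionI[where V = V and adj = adj and C = C, OF _ _ VG _ adj_translate _ sub(2) NF])
      show "V \<noteq> {}" by (auto simp: V_def)
      show "translate g u \<in> V" if "g \<in> carrier G" "u \<in> V" for g u
        using that by (auto simp: V_def image_iff lcos_m_assoc[OF AG] lcos_m_assoc[OF CG])
      fix u v assume "adj u v"
      then obtain b g where g: "g \<in> carrier G" "{u, v} = e b g"
        by (auto simp: adj_def)
      show "\<exists>g\<in>carrier G. \<forall>x\<in>carrier G. translate x u = u \<longrightarrow> translate x v = v \<longrightarrow> inv g \<otimes> x \<otimes> g \<in> C"
      proof (intro bexI[of _ g] ballI impI g)
        fix x assume x: "x \<in> carrier G" "translate x u = u" "translate x v = v"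
        have "translate x (False, g <# C) = (False, g <# C)"
          using g(2) x(2,3) by (auto simp: e_def doubleton_eq_iff)
        then have "g <# C = (x \<otimes> g) <# C"
          using x(1) g(1) by (simp add: lcos_m_assoc[OF CG])
        then show "inv g \<otimes> x \<otimes> g \<in> C"
          using l_coset_eq_iff[OF sub(2) g(1), of "x \<otimes> g"] x(1) g(1) by (simp add: m_assoc)
      qed
    qed
    moreover have "C \<noteq> carrier G" using split(2) sub(3) AG by blast
    then have "\<exists>g\<in>carrier G. translate g v \<noteq> v" if "v \<in> V" for v
      using that proper_coset_moved[OF sub(1)] proper_coset_moved[OF sub(2)] split(2)
      by (auto simp: V_def)
    ultimately show ?thesis by blast
  qed
qed

lemma splitting_tree:
  assumes "splits_nontrivially_over G C" "NF (G\<lparr>carrier := C\<rparr>)"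
  shows "\<exists>V d. tree_action G V d translate \<and> (\<forall>v\<in>V. \<exists>g\<in>carrier G. translate g v \<noteq> v)"
  using assms amalgam_tree hnn_tree unfolding splits_nontrivially_over_def by meson

end

section \<open>Finite index subgroups\<close>

lemma (in group) finite_index_power:
  assumes H: "subgroup H G" and fin: "finite (rcosets H)"
  obtains m :: nat where "m \<ge> 2" "\<And>g. g \<in> carrier G \<Longrightarrow> g [^] m \<in> H"
\<comment> \<open>Two of the powers of \<open>g\<close> with exponents from 0 to the index share a
  coset, so a power with a positive exponent at most the index lies in \<open>H\<close>. The
  factorial is a multiple of all such exponents, whichever \<open>g\<close> is chosen; the factor 2
  secures \<open>m \<ge> 2\<close>.\<close>
proof (rule that[of "2 * fact (card (rcosets H)) :: nat"])
  let ?N = "card (rcosets H)"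
  show "(2::nat) \<le> 2 * fact ?N" using fact_ge_1[of ?N, where ?'a = nat] by linarith
  fix g assume g: "g \<in> carrier G"
  have "\<not> inj_on (\<lambda>i::nat. H #> g [^] i) {0..?N}"
  proof
    assume "inj_on (\<lambda>i::nat. H #> g [^] i) {0..?N}"
    then have "card {0..?N} \<le> ?N"
      by (rule card_inj_on_le[OF _ _ fin]) (use g subgroup.subset[OF H] in \<open>auto intro: rcosetsI\<close>)
    then show False by simp
  qed
  then obtain i j where ij: "i < j" "j \<le> ?N" "H #> g [^] i = H #> g [^] j"
    unfolding inj_on_def by (metis atLeastAtMost_iff linorder_neqE_nat)
  have "g [^] j \<in> H #> g [^] i"
    using ij(3) rcos_self[of "g [^] j" H] H g by simp
  then obtain h where h: "h \<in> H" "g [^] j = h \<otimes> g [^] i"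
    by (auto simp: r_coset_def)
  moreover have "g [^] j = g [^] (j - i) \<otimes> g [^] i"
    using g ij(1) by (simp add: nat_pow_mult)
  ultimately have "g [^] (j - i) \<in> H"
    using g subgroup.mem_carrier[OF H] by simp
  moreover have "(j - i) dvd 2 * fact ?N"
    using ij dvd_fact[of "j - i" ?N] by simp
  then obtain k where "(2 * fact ?N :: nat) = (j - i) * k" by (auto elim: dvdE)
  moreover have "h [^] k \<in> H" if "h \<in> H" for h and k :: nat
    using that subgroup.one_closed[OF H] subgroup.m_closed[OF H]
    by (induction k) auto
  ultimately show "g [^] (2 * fact ?N :: nat) \<in> H"
    using g by (metis nat_pow_pow)
qed

lemma (in group) hom_conj:
  assumes "g \<in> carrier G"
  shows "(\<lambda>x. g \<otimes> x \<otimes> inv g) \<in> hom G G"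
proof -
  have "inv g \<otimes> (g \<otimes> z) = z" if "z \<in> carrier G" for z
    using that assms by (simp add: m_assoc[symmetric])
  then show ?thesis using assms by (simp add: hom_def m_assoc)
qed

lemma (in group) conj_pow:
  assumes "g \<in> carrier G" "x \<in> carrier G"
  shows "(g \<otimes> x \<otimes> inv g) [^] (k::nat) = g \<otimes> x [^] k \<otimes> inv g"
  using hom_nat_pow[OF hom_conj[OF assms(1)] assms(2) is_group is_group, of k] by simp

context tree_action
begin

text \<open>\<open>b g x\<close> is the action of the \<open>m\<close>-th power of \<open>x\<close>
  conjugated by \<open>g\<close>; such a power lies in \<open>H\<close> for every \<open>g\<close>,
  so the pentagon can be moved by the whole group although only \<open>H\<close> acts.\<close>

lemma pentagon_group_fixes:
  fixes \<Gamma> :: "('c, 'm) monoid_scheme" and \<phi> :: "'c \<Rightarrow> 'a"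
  assumes \<Gamma>: "group \<Gamma>" and H: "subgroup H \<Gamma>" and \<phi>: "\<phi> \<in> hom (\<Gamma>\<lparr>carrier := H\<rparr>) G" "inj_on \<phi> H"
    and power: "\<And>g. g \<in> carrier \<Gamma> \<Longrightarrow> g [^]\<^bsub>\<Gamma>\<^esub> (m::nat) \<in> H"
    and gen: "presented_by \<Gamma> f S R" "f \<in> S \<rightarrow> carrier \<Gamma>"
    and a: "a\<^sub>1 \<in> carrier \<Gamma>" "a\<^sub>2 \<in> carrier \<Gamma>" "a\<^sub>3 \<in> carrier \<Gamma>" "a\<^sub>4 \<in> carrier \<Gamma>" "a\<^sub>5 \<in> carrier \<Gamma>"
    and comm: "a\<^sub>1 \<otimes>\<^bsub>\<Gamma>\<^esub> a\<^sub>2 = a\<^sub>2 \<otimes>\<^bsub>\<Gamma>\<^esub> a\<^sub>1" "a\<^sub>2 \<otimes>\<^bsub>\<Gamma>\<^esub> a\<^sub>3 = a\<^sub>3 \<otimes>\<^bsub>\<Gamma>\<^esub> a\<^sub>2"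
      "a\<^sub>3 \<otimes>\<^bsub>\<Gamma>\<^esub> a\<^sub>4 = a\<^sub>4 \<otimes>\<^bsub>\<Gamma>\<^esub> a\<^sub>3" "a\<^sub>4 \<otimes>\<^bsub>\<Gamma>\<^esub> a\<^sub>5 = a\<^sub>5 \<otimes>\<^bsub>\<Gamma>\<^esub> a\<^sub>4" "a\<^sub>5 \<otimes>\<^bsub>\<Gamma>\<^esub> a\<^sub>1 = a\<^sub>1 \<otimes>\<^bsub>\<Gamma>\<^esub> a\<^sub>5"
    and free: "\<And>x y. (x, y) \<in> {(a\<^sub>1, a\<^sub>3), (a\<^sub>1, a\<^sub>4), (a\<^sub>2, a\<^sub>4), (a\<^sub>2, a\<^sub>5), (a\<^sub>3, a\<^sub>5)} \<Longrightarrow>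
      free_pair \<Gamma> (x [^]\<^bsub>\<Gamma>\<^esub> m) (y [^]\<^bsub>\<Gamma>\<^esub> m)"
    and link: "\<And>s. s \<in> S \<Longrightarrow> \<exists>(x, y) \<in> {(a\<^sub>1, a\<^sub>3), (a\<^sub>1, a\<^sub>4), (a\<^sub>2, a\<^sub>4), (a\<^sub>2, a\<^sub>5), (a\<^sub>3, a\<^sub>5)}.
      f s \<otimes>\<^bsub>\<Gamma>\<^esub> x = x \<otimes>\<^bsub>\<Gamma>\<^esub> f s \<and> f s \<otimes>\<^bsub>\<Gamma>\<^esub> y = y \<otimes>\<^bsub>\<Gamma>\<^esub> f s"
  shows "\<exists>v\<in>V. \<forall>h\<in>H. act (\<phi> h) v = v"
proof -
  interpret \<Gamma>: group \<Gamma> by fact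
  interpret H: subgroup H \<Gamma> by fact
  interpret HG: group "\<Gamma>\<lparr>carrier := H\<rparr>" by (rule \<Gamma>.subgroup_imp_group[OF H])
  interpret \<phi>: group_hom "\<Gamma>\<lparr>carrier := H\<rparr>" G \<phi>
    using \<phi>(1) by (simp add: group_hom_def group_hom_axioms_def HG.is_group is_group)
  have \<phi>_mult: "\<phi> (x \<otimes>\<^bsub>\<Gamma>\<^esub> y) = \<phi> x \<otimes> \<phi> y" if "x \<in> H" "y \<in> H" for x y
    using \<phi>.hom_mult that by simp
  let ?A = "{a\<^sub>1, a\<^sub>2, a\<^sub>3, a\<^sub>4, a\<^sub>5}" and
    ?P = "{(a\<^sub>1, a\<^sub>3), (a\<^sub>1, a\<^sub>4), (a\<^sub>2, a\<^sub>4), (a\<^sub>2, a\<^sub>5), (a\<^sub>3, a\<^sub>5)}"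
  have A: "x \<in> carrier \<Gamma>" if "x \<in> ?A" for x using that a by auto
  have PA: "x \<in> ?A" "y \<in> ?A" if "(x, y) \<in> ?P" for x y using that by auto
  define conj where "conj g x = g \<otimes>\<^bsub>\<Gamma>\<^esub> x \<otimes>\<^bsub>\<Gamma>\<^esub> inv\<^bsub>\<Gamma>\<^esub> g" for g x
  define p where "p x = x [^]\<^bsub>\<Gamma>\<^esub> m" for x
  define b where "b g x = \<phi> (conj g (p x))" for g x
  have p: "p x \<in> carrier \<Gamma>" if "x \<in> carrier \<Gamma>" for x using that by (simp add: p_def)
  have conj_hom: "conj g \<in> hom \<Gamma> \<Gamma>" if "g \<in> carrier \<Gamma>" for g
    using \<Gamma>.hom_conj[OF that] by (simp add: conj_def[abs_def])
  have conj_mult: "conj g (x \<otimes>\<^bsub>\<Gamma>\<^esub> y) = conj g x \<otimes>\<^bsub>\<Gamma>\<^esub> conj g y"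
    if "g \<in> carrier \<Gamma>" "x \<in> carrier \<Gamma>" "y \<in> carrier \<Gamma>" for g x y
    using hom_mult[OF conj_hom[OF that(1)] that(2,3)] .
  have conj_in: "conj g (p x) \<in> H" if "g \<in> carrier \<Gamma>" "x \<in> carrier \<Gamma>" for g x
    using power[of "conj g x"] \<Gamma>.conj_pow[OF that, of m] that by (simp add: conj_def p_def)
  have b_in: "b g x \<in> carrier G" if "g \<in> carrier \<Gamma>" "x \<in> carrier \<Gamma>" for g x
    using \<phi>.hom_closed conj_in[OF that] by (simp add: b_def)
  have p_comm: "p x \<otimes>\<^bsub>\<Gamma>\<^esub> y = y \<otimes>\<^bsub>\<Gamma>\<^esub> p x"
    if "x \<in> carrier \<Gamma>" "y \<in> carrier \<Gamma>" "x \<otimes>\<^bsub>\<Gamma>\<^esub> y = y \<otimes>\<^bsub>\<Gamma>\<^esub> x" for x y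
    using \<Gamma>.group_commutes_pow[OF that(3,1,2)] by (simp add: p_def)
  have b_comm: "b g x \<otimes> b g y = b g y \<otimes> b g x"
    if "g \<in> carrier \<Gamma>" "x \<in> carrier \<Gamma>" "y \<in> carrier \<Gamma>" "x \<otimes>\<^bsub>\<Gamma>\<^esub> y = y \<otimes>\<^bsub>\<Gamma>\<^esub> x" for g x y
  proof -
    have "p x \<otimes>\<^bsub>\<Gamma>\<^esub> p y = p y \<otimes>\<^bsub>\<Gamma>\<^esub> p x"
      using p_comm[OF that(2) p[OF that(3)]] p_comm[OF that(3,2)] that(4) by simp
    then show ?thesis
      using \<phi>_mult[OF conj_in[OF that(1,2)] conj_in[OF that(1,3)]]
        \<phi>_mult[OF conj_in[OF that(1,3)] conj_in[OF that(1,2)]]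
        conj_mult[OF that(1) p[OF that(2)] p[OF that(3)]]
        conj_mult[OF that(1) p[OF that(3)] p[OF that(2)]] by (simp add: b_def)
  qed
  have b_free: "free_pair G (b g x) (b g y)" if g: "g \<in> carrier \<Gamma>" and xy: "(x, y) \<in> ?P" for g x y
  proof -
    have "inj_on (conj g) (carrier \<Gamma>)"
      using g by (auto simp: inj_on_def conj_def)
    then have "free_pair \<Gamma> (conj g (p x)) (conj g (p y))"
      using free_pair_inj_hom[OF \<Gamma> \<Gamma> conj_hom[OF g]] free[OF xy] by (simp add: p_def)
    then have "free_pair (\<Gamma>\<lparr>carrier := H\<rparr>) (conj g (p x)) (conj g (p y))"
      using \<Gamma>.free_pair_subgroup[OF H] conj_in[OF g] A PA[OF xy] by blast
    then show ?thesis
      unfolding b_def using free_pair_inj_hom[OF HG.is_group is_group \<phi>(1)] \<phi>(2) by simp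
  qed
  have fixed_ex: "\<exists>v\<in>V. \<forall>x\<in>?A. act (b g x) v = v" if g: "g \<in> carrier \<Gamma>" for g
  proof -
    \<comment> \<open>The two cyclic neighbours of \<open>c\<close> commute with it and are not
      adjacent to each other, so they form a free pair.\<close>
    have "\<exists>x y. free_pair G x y \<and> b g c \<otimes> x = x \<otimes> b g c \<and> b g c \<otimes> y = y \<otimes> b g c"
      if c: "c \<in> ?A" for c
    proof -
      consider "c = a\<^sub>1" | "c = a\<^sub>2" | "c = a\<^sub>3" | "c = a\<^sub>4" | "c = a\<^sub>5" using c by blast
      then show ?thesis
      proof cases
        case 1
        then show ?thesis
          using b_free[OF g, of a\<^sub>2 a\<^sub>5, simplified] b_comm[OF g a(1,2) comm(1)] b_comm[OF g a(5,1) comm(5)] by metis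
      next
        case 2
        then show ?thesis
          using b_free[OF g, of a\<^sub>1 a\<^sub>3, simplified] b_comm[OF g a(1,2) comm(1)] b_comm[OF g a(2,3) comm(2)] by metis
      next
        case 3
        then show ?thesis
          using b_free[OF g, of a\<^sub>2 a\<^sub>4, simplified] b_comm[OF g a(2,3) comm(2)] b_comm[OF g a(3,4) comm(3)] by metis
      next
        case 4
        then show ?thesis
          using b_free[OF g, of a\<^sub>3 a\<^sub>5, simplified] b_comm[OF g a(3,4) comm(3)] b_comm[OF g a(4,5) comm(4)] by metis
      next
        case 5
        then show ?thesis
          using b_free[OF g, of a\<^sub>1 a\<^sub>4, simplified] b_comm[OF g a(4,5) comm(4)] b_comm[OF g a(5,1) comm(5)] by metis
      qed
    qed
    then have elliptic: "\<exists>v\<in>V. act (b g c) v = v" if "c \<in> ?A" for c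
      using elliptic_if_free_centralizer[OF b_in[OF g A[OF that]]] that by blast
    obtain v where "v \<in> V" "act (b g a\<^sub>1) v = v" "act (b g a\<^sub>2) v = v" "act (b g a\<^sub>3) v = v"
      "act (b g a\<^sub>4) v = v" "act (b g a\<^sub>5) v = v"
    proof (rule pentagon_fixed[of "b g a\<^sub>1" "b g a\<^sub>2" "b g a\<^sub>3" "b g a\<^sub>4" "b g a\<^sub>5"])
      show "\<exists>v\<in>V. act c v = v" if "c \<in> {b g a\<^sub>1, b g a\<^sub>2, b g a\<^sub>3, b g a\<^sub>4, b g a\<^sub>5}" for c
        using elliptic that by blast
    qed (use b_in[OF g] a b_comm[OF g] comm b_free[OF g] in auto)
    then show ?thesis by blast
  qed
  have fixed_eq: "u = v"
    if "g \<in> carrier \<Gamma>" "(x, y) \<in> ?P" "u \<in> V" "v \<in> V" "act (b g x) u = u" "act (b g y) u = u"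
      "act (b g x) v = v" "act (b g y) v = v" for g x y u v
    using fixed_unique[OF b_free] that by blast
  \<comment> \<open>As \<open>s\<close> commutes with \<open>x\<close> and \<open>y\<close>, the
    pentagons at \<open>g\<close> and at \<open>g\<close> times \<open>s\<close> share two
    non-adjacent members, and these already determine the vertex.\<close>
  have step: "\<forall>x\<in>?A. act (b (g \<otimes>\<^bsub>\<Gamma>\<^esub> s) x) v = v"
    if g: "g \<in> carrier \<Gamma>" and s: "s \<in> carrier \<Gamma>" and v: "v \<in> V" "\<forall>x\<in>?A. act (b g x) v = v"
      and xy: "(x, y) \<in> ?P" "s \<otimes>\<^bsub>\<Gamma>\<^esub> x = x \<otimes>\<^bsub>\<Gamma>\<^esub> s" "s \<otimes>\<^bsub>\<Gamma>\<^esub> y = y \<otimes>\<^bsub>\<Gamma>\<^esub> s" for g s v x y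
  proof -
    have xA: "x \<in> carrier \<Gamma>" "y \<in> carrier \<Gamma>" using PA[OF xy(1)] A by blast+
    have same: "b (g \<otimes>\<^bsub>\<Gamma>\<^esub> s) z = b g z" if z: "z \<in> carrier \<Gamma>" "s \<otimes>\<^bsub>\<Gamma>\<^esub> z = z \<otimes>\<^bsub>\<Gamma>\<^esub> s" for z
    proof -
      have "s \<otimes>\<^bsub>\<Gamma>\<^esub> (p z \<otimes>\<^bsub>\<Gamma>\<^esub> inv\<^bsub>\<Gamma>\<^esub> s) = p z \<otimes>\<^bsub>\<Gamma>\<^esub> s \<otimes>\<^bsub>\<Gamma>\<^esub> inv\<^bsub>\<Gamma>\<^esub> s"
        using p_comm[OF z(1) s z(2)[symmetric]] s p[OF z(1)] by (simp add: \<Gamma>.m_assoc[symmetric])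
      also have "\<dots> = p z"
        using s p[OF z(1)] by (simp add: \<Gamma>.m_assoc)
      finally have "s \<otimes>\<^bsub>\<Gamma>\<^esub> (p z \<otimes>\<^bsub>\<Gamma>\<^esub> inv\<^bsub>\<Gamma>\<^esub> s) = p z" .
      then have "conj (g \<otimes>\<^bsub>\<Gamma>\<^esub> s) (p z) = conj g (p z)"
        using g s p[OF z(1)] unfolding conj_def
        by (simp add: \<Gamma>.inv_mult_group \<Gamma>.m_assoc) (simp add: \<Gamma>.m_assoc[symmetric])
      then show ?thesis by (simp add: b_def)
    qed
    obtain w where w: "w \<in> V" "\<forall>x\<in>?A. act (b (g \<otimes>\<^bsub>\<Gamma>\<^esub> s) x) w = w"
      using fixed_ex[of "g \<otimes>\<^bsub>\<Gamma>\<^esub> s"] g s by blast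
    have "act (b g x) w = w" "act (b g y) w = w" "act (b g x) v = v" "act (b g y) v = v"
      using w(2) v(2) PA[OF xy(1)] same[OF xA(1) xy(2)] same[OF xA(2) xy(3)] by metis+
    then have "w = v" using fixed_eq[OF g xy(1) w(1) v(1)] by blast
    then show ?thesis using w by blast
  qed
  \<comment> \<open>The quantifier over \<open>g\<close> is inside the induction: a letter added on
    the left of \<open>h\<close> is absorbed into \<open>g\<close>.\<close>
  have all: "\<forall>g\<in>carrier \<Gamma>. \<forall>v\<in>V. (\<forall>x\<in>?A. act (b g x) v = v) \<longrightarrow>
      (\<forall>x\<in>?A. act (b (g \<otimes>\<^bsub>\<Gamma>\<^esub> h) x) v = v)" if h: "h \<in> carrier \<Gamma>" for h
  proof (rule presented_by_induct[OF \<Gamma> gen h])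
    show "\<forall>g\<in>carrier \<Gamma>. \<forall>v\<in>V. (\<forall>x\<in>?A. act (b g x) v = v) \<longrightarrow>
        (\<forall>x\<in>?A. act (b (g \<otimes>\<^bsub>\<Gamma>\<^esub> \<one>\<^bsub>\<Gamma>\<^esub>) x) v = v)" by simp
    fix s y
    let ?Q = "\<lambda>y. \<forall>g\<in>carrier \<Gamma>. \<forall>v\<in>V. (\<forall>x\<in>?A. act (b g x) v = v) \<longrightarrow>
        (\<forall>x\<in>?A. act (b (g \<otimes>\<^bsub>\<Gamma>\<^esub> y) x) v = v)"
    assume s: "s \<in> S" and y: "y \<in> carrier \<Gamma>" and IH: "?Q y"
    have fs: "f s \<in> carrier \<Gamma>" using gen(2) s by auto
    obtain x z where xz: "(x, z) \<in> ?P" "f s \<otimes>\<^bsub>\<Gamma>\<^esub> x = x \<otimes>\<^bsub>\<Gamma>\<^esub> f s" "f s \<otimes>\<^bsub>\<Gamma>\<^esub> z = z \<otimes>\<^bsub>\<Gamma>\<^esub> f s"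
      using link[OF s] by blast
    have "?Q (t \<otimes>\<^bsub>\<Gamma>\<^esub> y)"
      if t: "t \<in> carrier \<Gamma>" "t \<otimes>\<^bsub>\<Gamma>\<^esub> x = x \<otimes>\<^bsub>\<Gamma>\<^esub> t" "t \<otimes>\<^bsub>\<Gamma>\<^esub> z = z \<otimes>\<^bsub>\<Gamma>\<^esub> t" for t
    proof (intro ballI impI)
      fix g v c assume g: "g \<in> carrier \<Gamma>" and v: "v \<in> V" "\<forall>x\<in>?A. act (b g x) v = v" and c: "c \<in> ?A"
      have "\<forall>x\<in>?A. act (b (g \<otimes>\<^bsub>\<Gamma>\<^esub> t) x) v = v"
        by (rule step[OF g t(1) v xz(1) t(2,3)])
      then have "act (b (g \<otimes>\<^bsub>\<Gamma>\<^esub> t \<otimes>\<^bsub>\<Gamma>\<^esub> y) c) v = v"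
        using IH \<Gamma>.m_closed[OF g t(1)] v(1) c by blast
      then show "act (b (g \<otimes>\<^bsub>\<Gamma>\<^esub> (t \<otimes>\<^bsub>\<Gamma>\<^esub> y)) c) v = v"
        using g t(1) y by (simp add: \<Gamma>.m_assoc)
    qed
    moreover have "inv\<^bsub>\<Gamma>\<^esub> f s \<otimes>\<^bsub>\<Gamma>\<^esub> c = c \<otimes>\<^bsub>\<Gamma>\<^esub> inv\<^bsub>\<Gamma>\<^esub> f s"
      if c: "c \<in> carrier \<Gamma>" "f s \<otimes>\<^bsub>\<Gamma>\<^esub> c = c \<otimes>\<^bsub>\<Gamma>\<^esub> f s" for c
    proof -
      have "inv\<^bsub>\<Gamma>\<^esub> f s \<otimes>\<^bsub>\<Gamma>\<^esub> (f s \<otimes>\<^bsub>\<Gamma>\<^esub> c) \<otimes>\<^bsub>\<Gamma>\<^esub> inv\<^bsub>\<Gamma>\<^esub> f s =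
          inv\<^bsub>\<Gamma>\<^esub> f s \<otimes>\<^bsub>\<Gamma>\<^esub> (c \<otimes>\<^bsub>\<Gamma>\<^esub> f s) \<otimes>\<^bsub>\<Gamma>\<^esub> inv\<^bsub>\<Gamma>\<^esub> f s" using c(2) by simp
      moreover have "inv\<^bsub>\<Gamma>\<^esub> f s \<otimes>\<^bsub>\<Gamma>\<^esub> (f s \<otimes>\<^bsub>\<Gamma>\<^esub> c) = c"
        using fs c(1) by (simp add: \<Gamma>.m_assoc[symmetric])
      ultimately show ?thesis using fs c(1) by (simp add: \<Gamma>.m_assoc)
    qed
    moreover have "x \<in> carrier \<Gamma>" "z \<in> carrier \<Gamma>" using PA[OF xz(1)] A by blast+
    ultimately show "?Q (f s \<otimes>\<^bsub>\<Gamma>\<^esub> y) \<and> ?Q (inv\<^bsub>\<Gamma>\<^esub> f s \<otimes>\<^bsub>\<Gamma>\<^esub> y)"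
      using fs xz(2,3) by simp
  qed
  obtain v where v: "v \<in> V" "\<forall>x\<in>?A. act (b \<one>\<^bsub>\<Gamma>\<^esub> x) v = v"
    using fixed_ex by blast
  have "act (\<phi> h) v = v" if h: "h \<in> H" for h
  proof -
    have \<phi>h: "\<phi> h \<in> carrier G" using \<phi>.hom_closed h by simp
    \<comment> \<open>The element \<open>\<phi> h\<close> carries vertices fixed by the pentagon at
      the identity to vertices fixed by the pentagon at \<open>h\<close>. Both pentagons fix
      \<open>v\<close>, so the preimage \<open>w\<close> is fixed by the former and equals
      \<open>v\<close> by uniqueness.\<close>
    define w where "w = act (inv (\<phi> h)) v"
    have w: "w \<in> V" "act (\<phi> h) w = v"
      using act_closed \<phi>h v(1) act_mult[of "\<phi> h" "inv (\<phi> h)" v] act_one by (auto simp: w_def)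
    have "act (b \<one>\<^bsub>\<Gamma>\<^esub> x) w = w" if x: "x \<in> ?A" for x
    proof -
      have xG: "x \<in> carrier \<Gamma>" using A x by blast
      have "act (b (\<one>\<^bsub>\<Gamma>\<^esub> \<otimes>\<^bsub>\<Gamma>\<^esub> h) x) v = v"
        using all[OF H.mem_carrier[OF h]] v \<Gamma>.one_closed x by blast
      then have "act (b h x) v = v" using H.mem_carrier[OF h] by simp
      moreover have one: "conj \<one>\<^bsub>\<Gamma>\<^esub> (p x) = p x" using p[OF xG] by (simp add: conj_def)
      have "p x \<in> H" using power[OF xG] by (simp add: p_def)
      then have "b h x \<otimes> \<phi> h = \<phi> h \<otimes> b \<one>\<^bsub>\<Gamma>\<^esub> x"
        using \<phi>_mult[OF conj_in[OF H.mem_carrier[OF h] xG] h] \<phi>_mult[OF h, of "p x"] one h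
          H.mem_carrier[OF h] p[OF xG] by (simp add: b_def conj_def \<Gamma>.m_assoc)
      ultimately have "act (\<phi> h) (act (b \<one>\<^bsub>\<Gamma>\<^esub> x) w) = act (\<phi> h) w"
        using act_mult[of "b h x" "\<phi> h" w] act_mult[of "\<phi> h" "b \<one>\<^bsub>\<Gamma>\<^esub> x" w] w \<phi>h
          b_in[OF H.mem_carrier[OF h] xG] b_in[OF \<Gamma>.one_closed xG] by simp
      then show ?thesis
        using act_inj[OF \<phi>h] act_closed b_in[OF \<Gamma>.one_closed xG] w(1) by blast
    qed
    then have "w = v"
      using fixed_eq[of "\<one>\<^bsub>\<Gamma>\<^esub>" a\<^sub>1 a\<^sub>3 w v] v w(1) by simp
    then show ?thesis using w by simp
  qed
  then show ?thesis using v(1) by blast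
qed

text \<open>The vertex \<open>act g v\<close> is fixed by the conjugate of \<open>K\<close> by
  \<open>g\<close>. Suitable powers of \<open>x\<close> and \<open>y\<close> lie both in
  \<open>K\<close> and in this conjugate, and being a free pair they fix only one vertex.\<close>

lemma finite_index_fixed:
  assumes K: "subgroup K G" "finite (rcosets K)" and xy: "x \<in> K" "y \<in> K"
    and free: "\<And>k::nat. k \<ge> 2 \<Longrightarrow> free_pair G (x [^] k) (y [^] k)"
    and v: "v \<in> V" "\<And>k. k \<in> K \<Longrightarrow> act k v = v" and g: "g \<in> carrier G"
  shows "act g v = v"
proof -
  obtain m :: nat where m: "m \<ge> 2" "\<And>g. g \<in> carrier G \<Longrightarrow> g [^] m \<in> K"
    using finite_index_power[OF K] by blast
  have gv: "act g v \<in> V" using act_closed g v by simp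
  have "act (z [^] m) v = v \<and> act (z [^] m) (act g v) = act g v" if z: "z \<in> K" for z
  proof
    have zG: "z \<in> carrier G" using subgroup.mem_carrier[OF K(1) z] .
    show "act (z [^] m) v = v" using m(2)[OF zG] v(2) by blast
    have "inv g \<otimes> z [^] m \<otimes> g \<in> K"
      using m(2)[of "inv g \<otimes> z \<otimes> g"] conj_pow[of "inv g" z m] zG g by simp
    then have "act (inv g \<otimes> z [^] m \<otimes> g) v = v" by (rule v(2))
    then have "act g (act (inv g \<otimes> z [^] m \<otimes> g) v) = act g v" by simp
    moreover have "g \<otimes> (inv g \<otimes> z [^] m \<otimes> g) = z [^] m \<otimes> g"
      using zG g by (simp add: m_assoc[symmetric])
    ultimately show "act (z [^] m) (act g v) = act g v"
      using act_mult[of g "inv g \<otimes> z [^] m \<otimes> g" v] act_mult[of "z [^] m" g v] zG g v(1) by simp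
  qed
  then show ?thesis
    using fixed_unique[OF free[OF m(1)] gv v(1)] xy by blast
qed

end

section \<open>Free pairs in braid groups\<close>

text \<open>The Garside element \<open>a \<otimes> b \<otimes> a\<close> interchanges
  \<open>a\<close> and \<open>b\<close> by conjugation; its square is therefore central in the
  subgroup they generate.\<close>

lemma (in group) half_twist:
  assumes ab: "a \<in> carrier G" "b \<in> carrier G" and braid: "a \<otimes> b \<otimes> a = b \<otimes> a \<otimes> b"
  shows "a \<otimes> (a \<otimes> b \<otimes> a) = (a \<otimes> b \<otimes> a) \<otimes> b" "b \<otimes> (a \<otimes> b \<otimes> a) = (a \<otimes> b \<otimes> a) \<otimes> a"
proof -
  have "a \<otimes> (a \<otimes> b \<otimes> a) = a \<otimes> (b \<otimes> a \<otimes> b)" by (simp only: braid)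
  also have "\<dots> = (a \<otimes> b \<otimes> a) \<otimes> b" using ab by (simp add: m_assoc)
  finally show "a \<otimes> (a \<otimes> b \<otimes> a) = (a \<otimes> b \<otimes> a) \<otimes> b" .
  have "b \<otimes> (a \<otimes> b \<otimes> a) = (b \<otimes> a \<otimes> b) \<otimes> a" using ab by (simp add: m_assoc)
  then show "b \<otimes> (a \<otimes> b \<otimes> a) = (a \<otimes> b \<otimes> a) \<otimes> a" by (simp only: braid)
qed

text \<open>By the braid relation \<open>D\<close> is the cube of \<open>a \<otimes> b\<close>, the
  full twist on three strands.\<close>

lemma (in group) full_twist_commutes:
  assumes ab: "a \<in> carrier G" "b \<in> carrier G" and braid: "a \<otimes> b \<otimes> a = b \<otimes> a \<otimes> b"
  defines "D \<equiv> (a \<otimes> b \<otimes> a) \<otimes> (a \<otimes> b \<otimes> a)"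
  shows "a \<otimes> D = D \<otimes> a" "b \<otimes> D = D \<otimes> b"
proof -
  define \<Delta> where "\<Delta> = a \<otimes> b \<otimes> a"
  have \<Delta>: "\<Delta> \<in> carrier G" and D: "D = \<Delta> \<otimes> \<Delta>" using ab by (simp_all add: \<Delta>_def D_def)
  have h: "a \<otimes> \<Delta> = \<Delta> \<otimes> b" "b \<otimes> \<Delta> = \<Delta> \<otimes> a"
    using half_twist[OF ab braid] by (simp_all add: \<Delta>_def)
  have "a \<otimes> D = (a \<otimes> \<Delta>) \<otimes> \<Delta>" using ab \<Delta> by (simp add: D m_assoc)
  also have "\<dots> = \<Delta> \<otimes> (b \<otimes> \<Delta>)" using ab \<Delta> by (simp add: h m_assoc)
  also have "\<dots> = D \<otimes> a" using ab \<Delta> by (simp add: h D m_assoc)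
  finally show "a \<otimes> D = D \<otimes> a" .
  have "b \<otimes> D = (b \<otimes> \<Delta>) \<otimes> \<Delta>" using ab \<Delta> by (simp add: D m_assoc)
  also have "\<dots> = \<Delta> \<otimes> (a \<otimes> \<Delta>)" using ab \<Delta> by (simp add: h m_assoc)
  also have "\<dots> = D \<otimes> b" using ab \<Delta> by (simp add: h D m_assoc)
  finally show "b \<otimes> D = D \<otimes> b" .
qed

text \<open>A braid permutes the triples \<open>p < q < r\<close> of positions of three marked strands. Keeping
  only the crossings of marked strands gives a 3-strand braid, which acts on pairs of integers
  through its reduced Burau representation at \<open>-1\<close>.\<close>

type_synonym marked = "nat \<times> nat \<times> nat \<times> int \<times> int"

definition swap_pos :: "nat \<Rightarrow> nat \<Rightarrow> nat" where
  "swap_pos i x = (if x = i then i + 1 else if x = i + 1 then i else x)"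

text \<open>Triples that are not increasing are left alone, so that the map is a bijection of the
  whole type. If two marked strands cross, their set of positions is unchanged and the integer pair
  undergoes one of two unit shears, which satisfy the braid relation.\<close>

fun strand_act :: "nat \<Rightarrow> marked \<Rightarrow> marked" where
  "strand_act i (p, q, r, x, y) =
    (if \<not> (p < q \<and> q < r) then (p, q, r, x, y)
     else if p = i \<and> q = i + 1 then (p, q, r, x + y, y)
     else if q = i \<and> r = i + 1 then (p, q, r, x, y - x)
     else (swap_pos i p, swap_pos i q, swap_pos i r, x, y))"

fun strand_act_inv :: "nat \<Rightarrow> marked \<Rightarrow> marked" where
  "strand_act_inv i (p, q, r, x, y) =
    (if \<not> (p < q \<and> q < r) then (p, q, r, x, y)
     else if p = i \<and> q = i + 1 then (p, q, r, x - y, y)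
     else if q = i \<and> r = i + 1 then (p, q, r, x, y + x)
     else (swap_pos i p, swap_pos i q, swap_pos i r, x, y))"

lemma strand_act_inverse:
  "strand_act_inv i (strand_act i m) = m" "strand_act i (strand_act_inv i m) = m"
  by (cases m; auto simp: swap_pos_def)+

lemma bij_strand_act: "bij (strand_act i)"
  by (rule o_bij[of "strand_act_inv i"]) (auto simp: fun_eq_iff strand_act_inverse)

lemma swap_pos_simps: "swap_pos i i = Suc i" "swap_pos i (Suc i) = i" "x \<noteq> i \<Longrightarrow> x \<noteq> Suc i \<Longrightarrow> swap_pos i x = x"
  by (auto simp: swap_pos_def)

lemma strand_act_first: "Suc i < r \<Longrightarrow> strand_act i (i, Suc i, r, x, y) = (i, Suc i, r, x + y, y)"
  and strand_act_second: "p < i \<Longrightarrow> strand_act i (p, i, Suc i, x, y) = (p, i, Suc i, x, y - x)"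
  and strand_act_swap: "p < q \<Longrightarrow> q < r \<Longrightarrow> p \<noteq> i \<or> q \<noteq> Suc i \<Longrightarrow> q \<noteq> i \<or> r \<noteq> Suc i \<Longrightarrow>
    strand_act i (p, q, r, x, y) = (swap_pos i p, swap_pos i q, swap_pos i r, x, y)"
  and strand_act_other: "\<not> (p < q \<and> q < r) \<Longrightarrow> strand_act i (p, q, r, x, y) = (p, q, r, x, y)"
  by auto

declare strand_act.simps [simp del]

lemma strand_act_braid:
  "strand_act i (strand_act (Suc i) (strand_act i m)) =
    strand_act (Suc i) (strand_act i (strand_act (Suc i) m))"
proof -
  obtain p q r x y where m: "m = (p, q, r, x, y)" by (cases m)
  show ?thesis
  proof (cases "p < q \<and> q < r")
    case True
    \<comment> \<open>Only the place of each mark relative to the three positions \<open>i\<close>,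
      \<open>i + 1\<close>, \<open>i + 2\<close> matters. If all three are marked, the claim is the
      braid relation for the shears.\<close>
    have "k < i \<or> k = i \<or> k = Suc i \<or> k = Suc (Suc i) \<or> Suc (Suc i) < k" for k by linarith
    from this[of p] this[of q] this[of r] True show ?thesis
      unfolding m apply (elim disjE conjE)
      by (linarith | (hypsubst?, simp add: swap_pos_simps strand_act_first strand_act_second strand_act_swap))+
  qed (simp add: m strand_act_other)
qed

lemma strand_act_commute:
  assumes "Suc i < j"
  shows "strand_act i (strand_act j m) = strand_act j (strand_act i m)"
proof -
  obtain p q r x y where m: "m = (p, q, r, x, y)" by (cases m)
  show ?thesis
  proof (cases "p < q \<and> q < r")
    case True
    have "k < i \<or> k = i \<or> k = Suc i \<or> Suc i < k \<and> k < j \<or> k = j \<or> k = Suc j \<or> Suc j < k" for k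
      by linarith
    from this[of p] this[of q] this[of r] True assms show ?thesis
      unfolding m apply (elim disjE conjE)
      by (linarith | (hypsubst?, simp add: swap_pos_simps strand_act_first strand_act_second strand_act_swap))+
  qed (simp add: m strand_act_other)
qed

section \<open>Free pairs from powers of shears\<close>

lemma hom_perm_group_pow:
  assumes "\<psi> \<in> hom G perm_group" "group G" "x \<in> carrier G"
  shows "\<psi> (x [^]\<^bsub>G\<^esub> (k::nat)) = (\<psi> x ^^ k)"
proof (induction k)
  case 0
  then show ?case
    using hom_one[OF assms(1) assms(2) group_perm_group] by (simp add: perm_group_def id_def[symmetric])
next
  case (Suc k)
  interpret group G by fact
  have "\<psi> (x [^]\<^bsub>G\<^esub> k \<otimes>\<^bsub>G\<^esub> x) = \<psi> (x [^]\<^bsub>G\<^esub> k) \<otimes>\<^bsub>perm_group\<^esub> \<psi> x"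
    using assms by (simp add: hom_mult)
  then show ?case using Suc by (simp add: perm_group_def funpow_Suc_right del: funpow.simps)
qed

text \<open>Two integer shears with coefficients at least 2 play ping-pong on the four cones into which
  the axes and the diagonals cut the plane.\<close>

lemma shears_free_pair:
  fixes f g :: "marked \<Rightarrow> marked"
  assumes f: "\<And>x y. f (p, q, r, x, y) = (p, q, r, x + k * y, y)" "bij f" "k \<ge> 2"
    and g: "\<And>x y. g (p, q, r, x, y) = (p, q, r, x, y - l * x)" "bij g" "l \<ge> 2"
  shows "free_pair perm_group f g"
proof -
  \<comment> \<open>The cone bears the name of the letter whose map sends points into it:
    \<open>f\<close> enlarges the first coordinate and \<open>g\<close> the second. The sign of
    \<open>x * y\<close> separates a map from its inverse; it is reversed for \<open>g\<close>,
    which subtracts.\<close>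
  define C :: "bool \<times> bool \<Rightarrow> (int \<times> int) set" where
    "C s = {(x, y). (if fst s then \<bar>y\<bar> < \<bar>x\<bar> else \<bar>x\<bar> < \<bar>y\<bar>) \<and>
      (if fst s = snd s then x * y > 0 else x * y < 0)}" for s
  define U where "U s = (\<lambda>(x, y). (p, q, r, x, y)) ` C s" for s
  let ?h = "\<lambda>b. if b then f else g"
  have invf: "inv_into UNIV f (p, q, r, x, y) = (p, q, r, x - k * y, y)" for x y
    by (rule inv_f_eq) (use f in \<open>auto simp: bij_is_inj\<close>)
  have invg: "inv_into UNIV g (p, q, r, x, y) = (p, q, r, x, y + l * x)" for x y
    by (rule inv_f_eq) (use g in \<open>auto simp: bij_is_inj\<close>)
  \<comment> \<open>The single estimate behind all four letters; the others follow by exchanging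
    coordinates and changing signs. It is obtained by comparing the product of the new coordinate
    and \<open>y\<close> with the square of \<open>y\<close>.\<close>
  have shear: "\<bar>y\<bar> < \<bar>x + c * y\<bar> \<and> (x + c * y) * y > 0"
    if "c \<ge> 2" "(\<bar>x\<bar> < \<bar>y\<bar> \<or> x * y > 0) \<and> y \<noteq> 0" for x y c :: int
  proof -
    have "x * y + c * (y * y) > y * y"
    proof -
      have "c * (y * y) \<ge> 2 * (y * y)" using that(1) by (intro mult_right_mono) auto
      moreover have "x * y > - (y * y)"
      proof (cases "x * y > 0")
        case True
        then show ?thesis using zero_le_square[of y] by linarith
      next
        case False
        then have "\<bar>x\<bar> * \<bar>y\<bar> < \<bar>y\<bar> * \<bar>y\<bar>" using that(2) by (intro mult_strict_right_mono) auto
        then show ?thesis by (simp add: abs_mult[symmetric])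
      qed
      ultimately show ?thesis by linarith
    qed
    then have *: "(x + c * y) * y > y * y" by (simp add: algebra_simps)
    then have "\<bar>x + c * y\<bar> * \<bar>y\<bar> > \<bar>y\<bar> * \<bar>y\<bar>"
      by (simp add: abs_mult[symmetric])
    then have "\<bar>y\<bar> < \<bar>x + c * y\<bar>" by (rule mult_right_less_imp_less) simp
    moreover have "(x + c * y) * y > 0" using * zero_le_square[of y] by linarith
    ultimately show ?thesis by blast
  qed
  have "free_pair perm_group (?h True) (?h False)"
  proof (rule ping_pong[where U = U])
    show "bij (?h b)" for b using f g by simp
    show "U s \<noteq> {}" for s
    proof -
      have "(2, 1) \<in> C (True, True)" "(2, -1) \<in> C (True, False)" "(1, -2) \<in> C (False, True)"
        "(1, 2) \<in> C (False, False)" by (auto simp: C_def)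
      then show ?thesis by (cases s; cases "fst s"; cases "snd s") (auto simp: U_def)
    qed
    show "U s \<inter> U t = {}" if "s \<noteq> t" for s t
      using that by (auto simp: U_def C_def prod_eq_iff split: if_splits)
    have C_cond: "(\<bar>x\<bar> < \<bar>y\<bar> \<or> x * y > 0) \<and> y \<noteq> 0" if "(x, y) \<in> C s" "s \<noteq> (True, False)" for x y s
      using that by (cases s) (auto simp: C_def split: if_splits)
    have C_cond': "(\<bar>- x\<bar> < \<bar>y\<bar> \<or> - x * y > 0) \<and> y \<noteq> 0" if "(x, y) \<in> C s" "s \<noteq> (True, True)" for x y s
      using that by (cases s) (auto simp: C_def split: if_splits)
    have D_cond: "(\<bar>- y\<bar> < \<bar>x\<bar> \<or> - y * x > 0) \<and> x \<noteq> 0" if "(x, y) \<in> C s" "s \<noteq> (False, False)" for x y s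
      using that by (cases s) (auto simp: C_def mult.commute split: if_splits)
    have D_cond': "(\<bar>y\<bar> < \<bar>x\<bar> \<or> y * x > 0) \<and> x \<noteq> 0" if "(x, y) \<in> C s" "s \<noteq> (False, True)" for x y s
      using that by (cases s) (auto simp: C_def mult.commute split: if_splits)
    show "?h b ` U s \<subseteq> U (b, True)" if s: "s \<noteq> (b, False)" for b s
    proof -
      have "?h b (p, q, r, x, y) \<in> U (b, True)" if xy: "(x, y) \<in> C s" for x y
      proof (cases b)
        case True
        then have "(x + k * y, y) \<in> C (True, True)"
          using shear[OF f(3) C_cond[OF xy]] s by (simp add: C_def)
        then show ?thesis using True f(1) by (force simp: U_def)
      next
        case False
        then have "\<bar>x\<bar> < \<bar>- y + l * x\<bar> \<and> (- y + l * x) * x > 0"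
          using shear[OF g(3) D_cond[OF xy]] s by simp
        moreover have "\<bar>- y + l * x\<bar> = \<bar>y - l * x\<bar>" "(- y + l * x) * x = - (x * (y - l * x))"
          by (simp_all add: algebra_simps)
        ultimately have "(x, y - l * x) \<in> C (False, True)"
          by (simp add: C_def)
        then show ?thesis using False g(1) by (force simp: U_def)
      qed
      then show ?thesis by (auto simp: U_def)
    qed
    show "inv_into UNIV (?h b) ` U s \<subseteq> U (b, False)" if s: "s \<noteq> (b, True)" for b s
    proof -
      have "inv_into UNIV (?h b) (p, q, r, x, y) \<in> U (b, False)" if xy: "(x, y) \<in> C s" for x y
      proof (cases b)
        case True
        then have "\<bar>y\<bar> < \<bar>- x + k * y\<bar> \<and> (- x + k * y) * y > 0"
          using shear[OF f(3) C_cond'[OF xy]] s by simp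
        moreover have "\<bar>- x + k * y\<bar> = \<bar>x - k * y\<bar>" "(- x + k * y) * y = - ((x - k * y) * y)"
          by (simp_all add: algebra_simps)
        ultimately have "(x - k * y, y) \<in> C (True, False)"
          by (simp add: C_def)
        then show ?thesis using True invf by (force simp: U_def)
      next
        case False
        then have "(x, y + l * x) \<in> C (False, False)"
          using shear[OF g(3) D_cond'[OF xy]] s by (simp add: C_def mult.commute)
        then show ?thesis using False invg by (force simp: U_def)
      qed
      then show ?thesis by (auto simp: U_def)
    qed
  qed
  then show ?thesis by simp
qed

lemma shear_funpow:
  fixes f :: "marked \<Rightarrow> marked" and c :: int
  shows "(\<And>x y. f (p, q, r, x, y) = (p, q, r, x + c * y, y)) \<Longrightarrow>
      (f ^^ k) (p, q, r, x, y) = (p, q, r, x + int k * c * y, y)"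
    and "(\<And>x y. f (p, q, r, x, y) = (p, q, r, x, y - c * x)) \<Longrightarrow>
      (f ^^ k) (p, q, r, x, y) = (p, q, r, x, y - int k * c * x)"
  by (induction k) (simp_all add: algebra_simps)

text \<open>Taking a power multiplies the coefficient of a shear, so an exponent at least 2 lifts
  even unit shears to the range of the ping-pong argument.\<close>

lemma free_pair_powers:
  fixes \<psi> :: "'g \<Rightarrow> marked \<Rightarrow> marked"
  assumes G: "group G" and \<psi>: "\<psi> \<in> hom G perm_group" and ab: "a \<in> carrier G" "b \<in> carrier G"
    and a: "\<And>x y. \<psi> a (p, q, r, x, y) = (p, q, r, x + c * y, y)" "c \<ge> 1"
    and b: "\<And>x y. \<psi> b (p, q, r, x, y) = (p, q, r, x, y - e * x)" "e \<ge> 1"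
    and k: "k \<ge> 2"
  shows "free_pair G (a [^]\<^bsub>G\<^esub> (k::nat)) (b [^]\<^bsub>G\<^esub> k)"
proof -
  interpret group G by fact
  have bij: "bij (\<psi> z)" if "z \<in> carrier G" for z
    using hom_in_carrier[OF \<psi> that] by (simp add: perm_group_def)
  have ge: "int k * z \<ge> 2" if "z \<ge> 1" for z
    using mult_mono[of 2 "int k" 1 z] k that by simp
  have "free_pair perm_group (\<psi> (a [^]\<^bsub>G\<^esub> k)) (\<psi> (b [^]\<^bsub>G\<^esub> k))"
  proof (rule shears_free_pair)
    show "\<psi> (a [^]\<^bsub>G\<^esub> k) (p, q, r, x, y) = (p, q, r, x + int k * c * y, y)" for x y
      using shear_funpow(1)[of "\<psi> a", OF a(1)] hom_perm_group_pow[OF \<psi> G ab(1)] by simp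
    show "\<psi> (b [^]\<^bsub>G\<^esub> k) (p, q, r, x, y) = (p, q, r, x, y - int k * e * x)" for x y
      using shear_funpow(2)[of "\<psi> b", OF b(1)] hom_perm_group_pow[OF \<psi> G ab(2)] by simp
  qed (use bij ab ge a(2) b(2) in auto)
  then show ?thesis
    using free_pair_hom[OF G group_perm_group \<psi>] ab by simp
qed

section \<open>The standard generators and the pentagon in a braid group\<close>

lemma gen_class_in: "i \<in> S \<Longrightarrow> gen_class S R i \<in> carrier (presented_group S R)"
  by (simp add: carrier_presented_group)

lemma presented_by_self: "presented_by (presented_group S R) (gen_class S R) S R"
  unfolding presented_by_def using iso_set_refl by fastforce

definition sigma :: "nat \<Rightarrow> nat \<Rightarrow> nat word set" where
  "sigma n = gen_class {1..<n} (braid_relations n)"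

lemma braid_group_presented: "presented_by (braid_group n) (sigma n) {1..<n} (braid_relations n)"
  unfolding braid_group_def sigma_def by (rule presented_by_self)

lemma sigma_in: "i \<in> {1..<n} \<Longrightarrow> sigma n i \<in> carrier (braid_group n)"
  unfolding braid_group_def sigma_def by (rule gen_class_in)

lemma word_value_sigma:
  assumes "(l, r) \<in> braid_relations n" "l \<in> words {1..<n}" "r \<in> words {1..<n}"
  shows "word_value (braid_group n) (sigma n) l = word_value (braid_group n) (sigma n) r"
  by (rule presented_by_relation[OF group_braid_group braid_group_presented assms])

lemma sigma_braid:
  assumes "1 \<le> i" "i + 2 \<le> n"
  defines "B \<equiv> braid_group n"
  shows "sigma n i \<otimes>\<^bsub>B\<^esub> sigma n (i + 1) \<otimes>\<^bsub>B\<^esub> sigma n i =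
    sigma n (i + 1) \<otimes>\<^bsub>B\<^esub> sigma n i \<otimes>\<^bsub>B\<^esub> sigma n (i + 1)"
proof -
  interpret group B unfolding B_def by (rule group_braid_group)
  have "sigma n i \<in> carrier B" "sigma n (i + 1) \<in> carrier B"
    using sigma_in assms by (auto simp: B_def)
  then show ?thesis
    using word_value_sigma[of "[pos i, pos (i + 1), pos i]" "[pos (i + 1), pos i, pos (i + 1)]" n] assms(1,2)
    by (auto simp: braid_relations_def m_assoc B_def[symmetric])
qed

lemma sigma_commute:
  assumes "i \<in> {1..<n}" "j \<in> {1..<n}" "\<bar>int i - int j\<bar> > 1"
  defines "B \<equiv> braid_group n"
  shows "sigma n i \<otimes>\<^bsub>B\<^esub> sigma n j = sigma n j \<otimes>\<^bsub>B\<^esub> sigma n i"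
proof -
  interpret group B unfolding B_def by (rule group_braid_group)
  have "sigma n i \<in> carrier B" "sigma n j \<in> carrier B"
    using sigma_in assms by (auto simp: B_def)
  moreover have "([pos i, pos j], [pos j, pos i]) \<in> braid_relations n"
    unfolding braid_relations_def using assms by blast
  ultimately show ?thesis
    using word_value_sigma[of "[pos i, pos j]" "[pos j, pos i]" n] assms(1,2)
    by (simp add: B_def[symmetric])
qed

lemma braid_strand_hom:
  "\<exists>\<psi> \<in> hom (braid_group n) perm_group. \<forall>i\<in>{1..<n}. \<psi> (sigma n i) = strand_act i"
proof -
  have "word_value perm_group strand_act l = word_value perm_group strand_act r"
    if "(l, r) \<in> braid_relations n" for l r
  proof -
    have "strand_act i \<circ> strand_act j = strand_act j \<circ> strand_act i" if "\<bar>int i - int j\<bar> > 1" for i j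
    proof (cases "i < j")
      case True
      then show ?thesis using that strand_act_commute[of i j] by (auto simp: fun_eq_iff)
    next
      case False
      then show ?thesis using that strand_act_commute[of j i] by (auto simp: fun_eq_iff)
    qed
    moreover have "strand_act i \<circ> (strand_act (Suc i) \<circ> strand_act i) =
        strand_act (Suc i) \<circ> (strand_act i \<circ> strand_act (Suc i))" for i
      using strand_act_braid by (auto simp: fun_eq_iff)
    ultimately show ?thesis
      using that by (auto simp: braid_relations_def perm_group_def)
  qed
  moreover have "strand_act \<in> {1..<n} \<rightarrow> carrier perm_group"
    using bij_strand_act by (auto simp: perm_group_def)
  ultimately obtain \<psi> where "\<psi> \<in> hom (braid_group n) perm_group"
    "\<And>i. i \<in> {1..<n} \<Longrightarrow> \<psi> (sigma n i) = strand_act i"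
    using presented_by_extend[OF group_braid_group braid_group_presented group_perm_group] by metis
  then show ?thesis by blast
qed

text \<open>The cyclic order is \<open>s 1\<close>, \<open>s 3\<close>, \<open>D 2\<close>,
  \<open>s 2\<close>, \<open>D 1\<close>, and \<open>D i\<close> is the full twist on the strands
  \<open>i\<close>, \<open>i + 1\<close>, \<open>i + 2\<close>. Freeness of a pair is seen on three
  strands chosen to suit that pair.\<close>

lemma braid_pentagon:
  assumes "n \<ge> 4"
  defines "B \<equiv> braid_group n" and "s \<equiv> sigma n"
  defines "D \<equiv> \<lambda>i. (s i \<otimes>\<^bsub>B\<^esub> s (i + 1) \<otimes>\<^bsub>B\<^esub> s i) \<otimes>\<^bsub>B\<^esub> (s i \<otimes>\<^bsub>B\<^esub> s (i + 1) \<otimes>\<^bsub>B\<^esub> s i)"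
  shows "s 1 \<in> carrier B" "s 2 \<in> carrier B" "s 3 \<in> carrier B" "D 1 \<in> carrier B" "D 2 \<in> carrier B"
    and "s 1 \<otimes>\<^bsub>B\<^esub> D 1 = D 1 \<otimes>\<^bsub>B\<^esub> s 1" "s 2 \<otimes>\<^bsub>B\<^esub> D 1 = D 1 \<otimes>\<^bsub>B\<^esub> s 2"
      "s 2 \<otimes>\<^bsub>B\<^esub> D 2 = D 2 \<otimes>\<^bsub>B\<^esub> s 2" "s 3 \<otimes>\<^bsub>B\<^esub> D 2 = D 2 \<otimes>\<^bsub>B\<^esub> s 3"
      "s 1 \<otimes>\<^bsub>B\<^esub> s 3 = s 3 \<otimes>\<^bsub>B\<^esub> s 1"
    and "\<And>x y k. \<lbrakk>(x, y) \<in> {(s 1, D 2), (s 1, s 2), (s 3, s 2), (s 3, D 1), (D 2, D 1)}; k \<ge> 2\<rbrakk>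
      \<Longrightarrow> free_pair B (x [^]\<^bsub>B\<^esub> (k::nat)) (y [^]\<^bsub>B\<^esub> k)"
proof -
  interpret group B unfolding B_def by (rule group_braid_group)
  have s: "s i \<in> carrier B" if "i \<in> {1, 2, 3}" for i
    using sigma_in[of i n] that assms(1) by (auto simp: B_def s_def)
  show in_B: "s 1 \<in> carrier B" "s 2 \<in> carrier B" "s 3 \<in> carrier B" "D 1 \<in> carrier B" "D 2 \<in> carrier B"
    using s by (simp_all add: D_def numeral_2_eq_2 numeral_3_eq_3)
  have br: "s 1 \<otimes>\<^bsub>B\<^esub> s 2 \<otimes>\<^bsub>B\<^esub> s 1 = s 2 \<otimes>\<^bsub>B\<^esub> s 1 \<otimes>\<^bsub>B\<^esub> s 2"
    "s 2 \<otimes>\<^bsub>B\<^esub> s 3 \<otimes>\<^bsub>B\<^esub> s 2 = s 3 \<otimes>\<^bsub>B\<^esub> s 2 \<otimes>\<^bsub>B\<^esub> s 3"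
    using sigma_braid[of 1 n] sigma_braid[of 2 n] assms(1)
    by (simp_all add: B_def s_def numeral_2_eq_2 numeral_3_eq_3)
  have D: "D 1 = (s 1 \<otimes>\<^bsub>B\<^esub> s 2 \<otimes>\<^bsub>B\<^esub> s 1) \<otimes>\<^bsub>B\<^esub> (s 1 \<otimes>\<^bsub>B\<^esub> s 2 \<otimes>\<^bsub>B\<^esub> s 1)"
    "D 2 = (s 2 \<otimes>\<^bsub>B\<^esub> s 3 \<otimes>\<^bsub>B\<^esub> s 2) \<otimes>\<^bsub>B\<^esub> (s 2 \<otimes>\<^bsub>B\<^esub> s 3 \<otimes>\<^bsub>B\<^esub> s 2)"
    by (simp_all add: D_def numeral_2_eq_2 numeral_3_eq_3)
  show "s 1 \<otimes>\<^bsub>B\<^esub> D 1 = D 1 \<otimes>\<^bsub>B\<^esub> s 1" "s 2 \<otimes>\<^bsub>B\<^esub> D 1 = D 1 \<otimes>\<^bsub>B\<^esub> s 2"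
    using full_twist_commutes[OF in_B(1,2) br(1)] unfolding D by blast+
  show "s 2 \<otimes>\<^bsub>B\<^esub> D 2 = D 2 \<otimes>\<^bsub>B\<^esub> s 2" "s 3 \<otimes>\<^bsub>B\<^esub> D 2 = D 2 \<otimes>\<^bsub>B\<^esub> s 3"
    using full_twist_commutes[OF in_B(2,3) br(2)] unfolding D by blast+
  show "s 1 \<otimes>\<^bsub>B\<^esub> s 3 = s 3 \<otimes>\<^bsub>B\<^esub> s 1"
    using sigma_commute[of 1 n 3] assms(1) by (simp add: B_def s_def)
  obtain \<psi> where \<psi>: "\<psi> \<in> hom B perm_group" "\<And>i. i \<in> {1..<n} \<Longrightarrow> \<psi> (s i) = strand_act i"
    using braid_strand_hom[of n] unfolding B_def s_def by blast
  have mult: "\<psi> (x \<otimes>\<^bsub>B\<^esub> y) = \<psi> x \<circ> \<psi> y" if "x \<in> carrier B" "y \<in> carrier B" for x y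
    using hom_mult[OF \<psi>(1) that] by (simp add: perm_group_def)
  have \<psi>s: "\<psi> (s 1) = strand_act 1" "\<psi> (s 2) = strand_act 2" "\<psi> (s 3) = strand_act 3"
    using \<psi>(2) assms(1) by auto
  have \<psi>D: "\<psi> (D 1) m = strand_act 1 (strand_act 2 (strand_act 1 (strand_act 1 (strand_act 2 (strand_act 1 m)))))"
    "\<psi> (D 2) m = strand_act 2 (strand_act 3 (strand_act 2 (strand_act 2 (strand_act 3 (strand_act 2 m)))))" for m
    unfolding D using in_B by (simp_all add: mult \<psi>s del: One_nat_def)
  note simps = \<psi>s \<psi>D strand_act.simps swap_pos_def
  fix x y k
  assume xy: "(x, y) \<in> {(s 1, D 2), (s 1, s 2), (s 3, s 2), (s 3, D 1), (D 2, D 1)}" and k: "(k::nat) \<ge> 2"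
  note powers = free_pair_powers[OF is_group \<psi>(1) _ _ _ _ _ _ k]
  \<comment> \<open>In each case the marks are placed so that the first element twists only the
    first two marked strands, and the second only the last two. A generator then gives coefficient
    1, and a full twist, in which the two strands cross twice, gives 2.\<close>
  have "free_pair B (s 1 [^]\<^bsub>B\<^esub> k) (D 2 [^]\<^bsub>B\<^esub> k)"
    by (rule powers[where p = 1 and q = 2 and r = 4 and c = 1 and e = 2]) (use in_B in \<open>simp_all add: simps del: One_nat_def\<close>)
  moreover have "free_pair B (s 1 [^]\<^bsub>B\<^esub> k) (s 2 [^]\<^bsub>B\<^esub> k)"
    by (rule powers[where p = 1 and q = 2 and r = 3 and c = 1 and e = 1]) (use in_B in \<open>simp_all add: simps del: One_nat_def\<close>)
  moreover have "free_pair B (s 2 [^]\<^bsub>B\<^esub> k) (s 3 [^]\<^bsub>B\<^esub> k)"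
    by (rule powers[where p = 2 and q = 3 and r = 4 and c = 1 and e = 1]) (use in_B in \<open>simp_all add: simps del: One_nat_def\<close>)
  moreover have "free_pair B (D 1 [^]\<^bsub>B\<^esub> k) (s 3 [^]\<^bsub>B\<^esub> k)"
    by (rule powers[where p = 1 and q = 3 and r = 4 and c = 2 and e = 1]) (use in_B in \<open>simp_all add: simps del: One_nat_def\<close>)
  moreover have "free_pair B (D 1 [^]\<^bsub>B\<^esub> k) (D 2 [^]\<^bsub>B\<^esub> k)"
    by (rule powers[where p = 1 and q = 3 and r = 4 and c = 2 and e = 2]) (use in_B in \<open>simp_all add: simps del: One_nat_def\<close>)
  ultimately show "free_pair B (x [^]\<^bsub>B\<^esub> k) (y [^]\<^bsub>B\<^esub> k)"
    using xy by (auto intro: free_pair_swap)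
qed

lemma braid_group_no_tree_splitting:
  fixes G :: "('g, 'm) monoid_scheme"
  assumes "n \<ge> 4" and T: "tree_action G V d act"
    and moved: "\<And>v. v \<in> V \<Longrightarrow> \<exists>g\<in>carrier G. act g v \<noteq> v"
  shows "\<not> commensurable (braid_group n) G"
proof
  interpret T: tree_action G V d act by (rule T)
  let ?B = "braid_group n"
  interpret B: group ?B by (rule group_braid_group)
  assume "commensurable ?B G"
  then obtain H K \<phi> where H: "subgroup H ?B" "finite (rcosets\<^bsub>?B\<^esub> H)"
    and K: "subgroup K G" "finite (rcosets\<^bsub>G\<^esub> K)"
    and \<phi>: "\<phi> \<in> iso (?B\<lparr>carrier := H\<rparr>) (G\<lparr>carrier := K\<rparr>)"
    by (auto simp: commensurable_def finite_index_subgroup_def is_iso_def)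
  have inj: "inj_on \<phi> H" and onto: "\<phi> ` H = K"
    using \<phi> by (auto simp: iso_def bij_betw_def)
  have hom: "\<phi> \<in> hom (?B\<lparr>carrier := H\<rparr>) G"
    using \<phi> subgroup.subset[OF K(1)] by (auto simp: iso_def hom_def)
  obtain m :: nat where m: "m \<ge> 2" "\<And>g. g \<in> carrier ?B \<Longrightarrow> g [^]\<^bsub>?B\<^esub> m \<in> H"
    using B.finite_index_power[OF H] by blast
  let ?s = "sigma n"
  define D where "D i = (?s i \<otimes>\<^bsub>?B\<^esub> ?s (i + 1) \<otimes>\<^bsub>?B\<^esub> ?s i) \<otimes>\<^bsub>?B\<^esub> (?s i \<otimes>\<^bsub>?B\<^esub> ?s (i + 1) \<otimes>\<^bsub>?B\<^esub> ?s i)" for i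
  note pent = braid_pentagon[OF assms(1), folded D_def]
  have link: "\<exists>(x, y) \<in> {(?s 1, D 2), (?s 1, ?s 2), (?s 3, ?s 2), (?s 3, D 1), (D 2, D 1)}.
      ?s i \<otimes>\<^bsub>?B\<^esub> x = x \<otimes>\<^bsub>?B\<^esub> ?s i \<and> ?s i \<otimes>\<^bsub>?B\<^esub> y = y \<otimes>\<^bsub>?B\<^esub> ?s i" if i: "i \<in> {1..<n}" for i
  proof -
    \<comment> \<open>The generator commutes with the pair \<open>s 3\<close>, \<open>D 1\<close>
      for \<open>i = 1\<close>, with \<open>D 2\<close>, \<open>D 1\<close> for
      \<open>i = 2\<close>, with \<open>s 1\<close>, \<open>D 2\<close> for \<open>i = 3\<close>,
      and with \<open>s 1\<close>, \<open>s 2\<close> beyond that.\<close>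
    consider "i = 1" | "i = 2" | "i = 3" | "i \<ge> 4" using i by force
    then show ?thesis
    proof cases
      case 4
      then have "?s i \<otimes>\<^bsub>?B\<^esub> ?s 1 = ?s 1 \<otimes>\<^bsub>?B\<^esub> ?s i" "?s i \<otimes>\<^bsub>?B\<^esub> ?s 2 = ?s 2 \<otimes>\<^bsub>?B\<^esub> ?s i"
        using sigma_commute[of i n 1] sigma_commute[of i n 2] i by auto
      then show ?thesis by blast
    qed (use pent(6-10) in \<open>auto simp del: One_nat_def\<close>)
  qed
  have "sigma n \<in> {1..<n} \<rightarrow> carrier ?B" using sigma_in by blast
  then obtain v where v: "v \<in> V" "\<And>h. h \<in> H \<Longrightarrow> act (\<phi> h) v = v"
    using T.pentagon_group_fixes[OF B.is_group H(1) hom inj m(2) braid_group_presented _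
        pent(1,3,5,2,4,10,9) pent(8)[symmetric] pent(7) pent(6)[symmetric] pent(11)[OF _ m(1)] link]
    by blast
  \<comment> \<open>To pass from \<open>K\<close> to \<open>G\<close>, elements of \<open>K\<close>
    are wanted all of whose higher powers are free. The images of the \<open>m\<close>-th powers of
    \<open>s 1\<close> and \<open>s 2\<close> serve, since their \<open>k\<close>-th powers come
    from the exponent \<open>m * k\<close>, which is at least 2.\<close>
  have free: "free_pair G (\<phi> (?s 1 [^]\<^bsub>?B\<^esub> m) [^]\<^bsub>G\<^esub> k) (\<phi> (?s 2 [^]\<^bsub>?B\<^esub> m) [^]\<^bsub>G\<^esub> k)"
    if k: "k \<ge> 2" for k :: nat
  proof -
    have BH: "group (?B\<lparr>carrier := H\<rparr>)" by (rule B.subgroup_imp_group[OF H(1)])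
    have pow: "(x [^]\<^bsub>?B\<^esub> m) [^]\<^bsub>?B\<^esub> k = x [^]\<^bsub>?B\<^esub> (m * k)" "x [^]\<^bsub>?B\<^esub> (m * k) \<in> H"
      "\<phi> (x [^]\<^bsub>?B\<^esub> (m * k)) = \<phi> (x [^]\<^bsub>?B\<^esub> m) [^]\<^bsub>G\<^esub> k" if x: "x \<in> carrier ?B" for x
    proof -
      show 1: "(x [^]\<^bsub>?B\<^esub> m) [^]\<^bsub>?B\<^esub> k = x [^]\<^bsub>?B\<^esub> (m * k)" using x by (simp add: B.nat_pow_pow)
      have "x [^]\<^bsub>?B\<^esub> (m * k) = (x [^]\<^bsub>?B\<^esub> k) [^]\<^bsub>?B\<^esub> m"
        using x by (simp add: B.nat_pow_pow mult.commute)
      then show "x [^]\<^bsub>?B\<^esub> (m * k) \<in> H" using m(2) x by simp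
      show "\<phi> (x [^]\<^bsub>?B\<^esub> (m * k)) = \<phi> (x [^]\<^bsub>?B\<^esub> m) [^]\<^bsub>G\<^esub> k"
        using hom_nat_pow[OF hom _ BH T.is_group, of "x [^]\<^bsub>?B\<^esub> m" k] m(2)[OF x] 1
        by (simp add: B.nat_pow_consistent[of _ k H, symmetric])
    qed
    have "2 \<le> m * k" using m(1) k mult_le_mono[of 2 m 1 k] by simp
    then have "free_pair ?B (?s 1 [^]\<^bsub>?B\<^esub> (m * k)) (?s 2 [^]\<^bsub>?B\<^esub> (m * k))"
      using pent(11) by blast
    then have "free_pair (?B\<lparr>carrier := H\<rparr>) (?s 1 [^]\<^bsub>?B\<^esub> (m * k)) (?s 2 [^]\<^bsub>?B\<^esub> (m * k))"
      by (rule B.free_pair_subgroup[OF H(1)]) (use pow(2) pent(1,2) in auto)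
    from free_pair_inj_hom[OF BH T.is_group hom _ this] show ?thesis
      using inj pow(3)[OF pent(1)] pow(3)[OF pent(2)] by simp
  qed
  have "act g v = v" if "g \<in> carrier G" for g
    by (rule T.finite_index_fixed[OF K _ _ free v(1) _ that]) (use onto m(2) pent(1,2) v(2) in auto)
  then show False using moved[OF v(1)] by blast
qed

theorem theorem5p1:
  fixes n :: nat and G :: "('g, 'm) monoid_scheme"
  assumes "n \<ge> 4"
    and "group G"
    and "\<exists>C. subgroup C G \<and> NF (G\<lparr>carrier := C\<rparr>) \<and> splits_nontrivially_over G C"
  shows "\<not> commensurable (braid_group n) G"
proof -
  obtain V d where "tree_action G V d (monoid.translate G)"
    "\<And>v. v \<in> V \<Longrightarrow> \<exists>g\<in>carrier G. monoid.translate G g v \<noteq> v"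
    using group.splitting_tree[OF assms(2)] assms(3) by blast
  then show ?thesis by (rule braid_group_no_tree_splitting[OF assms(1)])
qed

end
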